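(* Let $n,k,p\ge1$ be integers and let $\varpi_{n,k,p}$ be the unique vexillary permutation of shape $\lambda_{n,p}=(np,(n-1)p,\dots,2p,p)$ and flag $\phi_{n,k}=(k+1,k+2,\dots,k+n)$. Then $$\mathfrak{G}^{(\beta-1)}_{\varpi_{n,1,p}}(x_i=1\ \forall i)=\sum_{j=1}^{n+1}\frac1{n+1}\binom{n+1}{j}\binom{(n+1)p}{j-1}\beta^{j-1}.$$ If $k\ge2$, then $G_{n,k,p}(\beta):=\mathfrak{G}^{(\beta-1)}_{\varpi_{n,k,p}}(x_i=1\ \forall i)$ is a polynomial of degree $nk$ in $\beta$, and the coefficient of $\beta^{nk}$ in $G_{n,k,p}(\beta)$ is $$\det\left(\binom{(n-i+1)(p-1)+j+k-1}{k+i-1}\right)_{1\le i,j\le n+1}.$$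
   Context: $\varpi_{n,k,p}$ is explicitly the permutation $1^k\times w_\lambda$ whose code $c_i=\#\{j>i:\varpi(j)<\varpi(i)\}$ is $(0^k,np,(n-1)p,\dots,p,0,0,\dots)$. $\beta$-Grothendieck polynomials: let $\mathrm{IdC}_m(\beta)$ be the associative $\mathbb{Z}[\beta]$-algebra with generators $e_1,\dots,e_{m-1}$ and relations $e_ie_j=e_je_i$ if $|i-j|\ge2$, $e_ie_je_i=e_je_ie_j$ if $|i-j|=1$, $e_i^2=\beta e_i$. For $w\in\mathbb{S}_m$ put $e_w=e_{i_1}\cdots e_{i_\ell}$ for any reduced word $w=s_{i_1}\cdots s_{i_\ell}$ ($s_i=(i,i+1)$, permutations composed from right to left). With $h_i(x)=1+xe_i$, $A_i(x)=h_{m-1}(x)\cdots h_i(x)$, the polynomials $\mathfrak{G}_w^{(\beta)}$ are defined by $A_1(x_1)\cdots A_{m-1}(x_{m-1})=\sum_{w\in\mathbb{S}_m}\mathfrak{G}_w^{(\beta)}(x_1,\dots,x_{m-1})e_w$; $\mathfrak{G}_w^{(\beta-1)}$ means $\beta$ is replaced by $\beta-1$. Binomial coefficients $\binom ac$ with $0\le a<c$ are zero. *)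

theory Defs
  imports
    "HOL-Library.Poly_Mapping"
    "HOL-Combinatorics.Permutations"
    "HOL-Algebra.QuotRing"
    "Jordan_Normal_Form.Determinant"
begin

section \<open>Permutations, codes, shapes and flags\<close>

text \<open>
  Permutations act on the positive integers (with \<open>0\<close> as an inert fixed point of every
  \<open>w :: nat \<Rightarrow> nat\<close> with \<open>w permutes {1..m}\<close>), so the symmetric group on \<open>m\<close> letters is
  \<open>{w. w permutes {1..m}}\<close>, and these groups are nested.
\<close>

definition finitary_perm :: "(nat \<Rightarrow> nat) \<Rightarrow> bool" where
  "finitary_perm w \<longleftrightarrow> (\<exists>m. w permutes {1..m})"

definition code :: "(nat \<Rightarrow> nat) \<Rightarrow> nat \<Rightarrow> nat" where
  "code w i = card {j. i < j \<and> w j < w i}"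

definition vexillary :: "(nat \<Rightarrow> nat) \<Rightarrow> bool" where
  "vexillary w \<longleftrightarrow>
     \<not> (\<exists>a b c d. 0 < a \<and> a < b \<and> b < c \<and> c < d \<and> w b < w a \<and> w a < w d \<and> w d < w c)"

definition code_support :: "(nat \<Rightarrow> nat) \<Rightarrow> nat set" where
  "code_support w = {i. 0 < i \<and> code w i \<noteq> 0}"

definition shape :: "(nat \<Rightarrow> nat) \<Rightarrow> nat list" where
  "shape w = rev (sorted_list_of_multiset (image_mset (code w) (mset_set (code_support w))))"

text \<open>
  The flag in the sense of Lascoux--Schuetzenberger and Macdonald: for every \<open>i\<close> with
  \<open>c\<^sub>i \<noteq> 0\<close> take the largest \<open>j \<ge> i\<close> with \<open>c\<^sub>j \<ge> c\<^sub>i\<close>, and sort the resulting numbers increasingly.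
\<close>

definition flag :: "(nat \<Rightarrow> nat) \<Rightarrow> nat list" where
  "flag w = sorted_list_of_multiset
     (image_mset (\<lambda>i. Max {j. i \<le> j \<and> code w i \<le> code w j}) (mset_set (code_support w)))"

definition varpi :: "nat \<Rightarrow> nat \<Rightarrow> nat \<Rightarrow> (nat \<Rightarrow> nat)" where
  "varpi n k p = (THE w. finitary_perm w \<and> vexillary w \<and>
     shape w = map (\<lambda>i. (n + 1 - i) * p) [1..<n + 1] \<and>
     flag w = map (\<lambda>i. k + i) [1..<n + 1])"


section \<open>Reduced words\<close>

definition perm_of_word :: "nat list \<Rightarrow> nat \<Rightarrow> nat" where
  "perm_of_word is = foldr (\<lambda>i f. transpose i (Suc i) \<circ> f) is id"

definition reduced_word :: "nat \<Rightarrow> (nat \<Rightarrow> nat) \<Rightarrow> nat list \<Rightarrow> bool" where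
  "reduced_word m w is \<longleftrightarrow> set is \<subseteq> {1..<m} \<and> perm_of_word is = w \<and>
     (\<forall>js. set js \<subseteq> {1..<m} \<and> perm_of_word js = w \<longrightarrow> length is \<le> length js)"


section \<open>Free associative algebras and the algebra IdC\<close>

text \<open>
  The free monoid on the letters \<open>nat\<close>, written additively so that \<^typ>\<open>'a \<Rightarrow>\<^sub>0 'b\<close> over it
  is, with its library multiplication, the free associative algebra over the ring \<^typ>\<open>'b\<close>.
\<close>

datatype fword = Word (letters: "nat list")

instantiation fword :: monoid_add
begin

definition zero_fword :: fword where
  "0 = Word []"

definition plus_fword :: "fword \<Rightarrow> fword \<Rightarrow> fword" where
  "u + v = Word (letters u @ letters v)"

instance
  by standard (simp_all add: zero_fword_def plus_fword_def)

end

definition gen :: "nat \<Rightarrow> (fword \<Rightarrow>\<^sub>0 'r::comm_ring_1)" where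
  "gen i = Poly_Mapping.single (Word [i]) 1"

definition scal :: "'r::comm_ring_1 \<Rightarrow> (fword \<Rightarrow>\<^sub>0 'r)" where
  "scal c = Poly_Mapping.single 0 c"

definition free_alg :: "nat \<Rightarrow> (fword \<Rightarrow>\<^sub>0 'r::comm_ring_1) ring" where
  "free_alg m = \<lparr>carrier = {f. \<forall>u \<in> Poly_Mapping.keys f. set (letters u) \<subseteq> {1..<m}},
     monoid.mult = (*), one = 1, zero = 0, add = (+)\<rparr>"

definition idC_relators :: "nat \<Rightarrow> 'r::comm_ring_1 \<Rightarrow> (fword \<Rightarrow>\<^sub>0 'r) set" where
  "idC_relators m b =
     {gen i * gen j - gen j * gen i | i j. i \<in> {1..<m} \<and> j \<in> {1..<m} \<and> 2 \<le> \<bar>int i - int j\<bar>} \<union>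
     {gen i * gen j * gen i - gen j * gen i * gen j | i j.
        i \<in> {1..<m} \<and> j \<in> {1..<m} \<and> \<bar>int i - int j\<bar> = 1} \<union>
     {gen i * gen i - scal b * gen i | i. i \<in> {1..<m}}"

definition idC_ideal :: "nat \<Rightarrow> 'r::comm_ring_1 \<Rightarrow> (fword \<Rightarrow>\<^sub>0 'r) set" where
  "idC_ideal m b = Idl\<^bsub>free_alg m\<^esub> (idC_relators m b)"

text \<open>
  \<open>IdC m b\<close> is the algebra with the given presentation over an arbitrary commutative ring
  \<^typ>\<open>'r\<close> of scalars and parameter \<open>b\<close>.  Below \<^typ>\<open>'r\<close> is \<open>\<int>[\<beta>][x\<^sub>1,x\<^sub>2,\<dots>]\<close>, that is, the
  algebra over \<open>\<int>[\<beta>]\<close> with central variables \<open>x\<^sub>i\<close> adjoined.  An equation between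
  \<open>idC_class m b f\<close> and \<open>idC_class m b g\<close> is an equation in \<open>carrier (IdC m b)\<close>.
\<close>

definition IdC :: "nat \<Rightarrow> 'r::comm_ring_1 \<Rightarrow> (fword \<Rightarrow>\<^sub>0 'r) set ring" where
  "IdC m b = free_alg m Quot (idC_ideal m b)"

definition idC_class :: "nat \<Rightarrow> 'r::comm_ring_1 \<Rightarrow> (fword \<Rightarrow>\<^sub>0 'r) \<Rightarrow> (fword \<Rightarrow>\<^sub>0 'r) set" where
  "idC_class m b f = idC_ideal m b +>\<^bsub>free_alg m\<^esub> f"

text \<open>The class of \<open>gen_perm m w\<close> in \<open>IdC m b\<close> is \<open>e\<^sub>w\<close>; it does not depend on the reduced word chosen.\<close>

definition gen_perm :: "nat \<Rightarrow> (nat \<Rightarrow> nat) \<Rightarrow> (fword \<Rightarrow>\<^sub>0 'r::comm_ring_1)" where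
  "gen_perm m w = prod_list (map gen (SOME is. reduced_word m w is))"


section \<open>\<open>\<beta>\<close>-Grothendieck polynomials\<close>

type_synonym xpoly = "(nat \<Rightarrow>\<^sub>0 nat) \<Rightarrow>\<^sub>0 int poly"

definition xvar :: "nat \<Rightarrow> xpoly" where
  "xvar i = Poly_Mapping.single (Poly_Mapping.single i 1) 1"

definition beta :: xpoly where
  "beta = Poly_Mapping.single 0 [:0, 1:]"

definition hfac :: "xpoly \<Rightarrow> nat \<Rightarrow> (fword \<Rightarrow>\<^sub>0 xpoly)" where
  "hfac x i = 1 + scal x * gen i"

definition Afac :: "nat \<Rightarrow> nat \<Rightarrow> xpoly \<Rightarrow> (fword \<Rightarrow>\<^sub>0 xpoly)" where
  "Afac m i x = prod_list (map (hfac x) (rev [i..<m]))"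

definition grothendieck :: "nat \<Rightarrow> (nat \<Rightarrow> nat) \<Rightarrow> xpoly" where
  "grothendieck m = (THE G. (\<forall>w. \<not> w permutes {1..m} \<longrightarrow> G w = 0) \<and>
     idC_class m beta (prod_list (map (\<lambda>i. Afac m i (xvar i)) [1..<m])) =
     idC_class m beta (\<Sum>w | w permutes {1..m}. scal (G w) * gen_perm m w))"

definition subst_beta :: "int poly \<Rightarrow> xpoly \<Rightarrow> xpoly" where
  "subst_beta q f = Poly_Mapping.map (\<lambda>c. pcompose c q) f"

definition eval_xpoly :: "(nat \<Rightarrow> int poly) \<Rightarrow> xpoly \<Rightarrow> int poly" where
  "eval_xpoly a f = (\<Sum>u \<in> Poly_Mapping.keys f.
     Poly_Mapping.lookup f u * (\<Prod>i \<in> Poly_Mapping.keys u. a i ^ Poly_Mapping.lookup u i))"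

text \<open>
  \<open>\<GG>\<^sub>w\<close> with parameter \<open>\<beta> - 1\<close> at \<open>x\<^sub>i = 1\<close>, as a polynomial in \<open>\<beta>\<close>, where \<open>w\<close> is regarded as an
  element of the symmetric group on \<open>m\<close> letters.
\<close>

definition grothendieck_spec :: "nat \<Rightarrow> (nat \<Rightarrow> nat) \<Rightarrow> int poly" where
  "grothendieck_spec m w = eval_xpoly (\<lambda>_. 1) (subst_beta [:- 1, 1:] (grothendieck m w))"


section \<open>Well-definedness\<close>

text \<open>
  \<^const>\<open>genideal\<close> is an intersection over sets that are ideals of a ring, so it would be
  degenerate if \<open>free_alg m\<close> were not a ring containing the relators.
\<close>

lemma ring_free_alg: "ring (free_alg m :: (fword \<Rightarrow>\<^sub>0 'r::comm_ring_1) ring)"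
proof -
  let ?F = "free_alg m :: (fword \<Rightarrow>\<^sub>0 'r) ring"
  have add: "f + g \<in> carrier ?F" if "f \<in> carrier ?F" "g \<in> carrier ?F" for f g
    using that Poly_Mapping.keys_add[of f g] unfolding free_alg_def by auto
  have neg: "- f \<in> carrier ?F" if "f \<in> carrier ?F" for f
    using that by (simp add: free_alg_def)
  have mult: "f * g \<in> carrier ?F" if "f \<in> carrier ?F" "g \<in> carrier ?F" for f g
  proof -
    have "set (letters u) \<subseteq> {1..<m}" if u: "u \<in> Poly_Mapping.keys (f * g)" for u
    proof -
      obtain a b where ab: "u = a + b" "a \<in> Poly_Mapping.keys f" "b \<in> Poly_Mapping.keys g"
        using u Poly_Mapping.keys_mult[of f g] by blast
      have "set (letters a) \<subseteq> {1..<m}" "set (letters b) \<subseteq> {1..<m}"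
        using ab(2,3) \<open>f \<in> carrier ?F\<close> \<open>g \<in> carrier ?F\<close> by (simp_all add: free_alg_def)
      then show ?thesis by (simp add: ab(1) plus_fword_def)
    qed
    then show ?thesis by (simp add: free_alg_def)
  qed
  have zero: "0 \<in> carrier ?F" and one: "1 \<in> carrier ?F"
    by (simp_all add: free_alg_def zero_fword_def)
  have ops: "x \<oplus>\<^bsub>?F\<^esub> y = x + y" "x \<otimes>\<^bsub>?F\<^esub> y = x * y" "\<zero>\<^bsub>?F\<^esub> = 0" "\<one>\<^bsub>?F\<^esub> = 1" for x y
    by (simp_all add: free_alg_def)
  show ?thesis
  proof (rule ringI)
    show "abelian_group ?F"
    proof (rule abelian_groupI, unfold ops)
      fix x assume "x \<in> carrier ?F"
      then show "\<exists>y\<in>carrier ?F. y + x = 0" by (intro bexI[of _ "- x"] neg) simp_all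
    qed (simp_all add: add zero add_ac)
    show "monoid ?F"
      by (rule monoidI; unfold ops) (simp_all add: mult one mult.assoc)
  qed (simp_all add: ops distrib_left distrib_right)
qed

lemma idC_relators_carrier:
  "idC_relators m b \<subseteq> carrier (free_alg m :: (fword \<Rightarrow>\<^sub>0 'r::comm_ring_1) ring)"
proof -
  let ?F = "free_alg m :: (fword \<Rightarrow>\<^sub>0 'r) ring"
  interpret ring ?F by (rule ring_free_alg)
  have [simp]: "x \<oplus>\<^bsub>?F\<^esub> y = x + y" "x \<otimes>\<^bsub>?F\<^esub> y = x * y" for x y by (simp_all add: free_alg_def)
  have diff: "x - y \<in> carrier ?F" if "x \<in> carrier ?F" "y \<in> carrier ?F" for x y
  proof -
    have "- y \<in> carrier ?F" using that by (simp add: free_alg_def)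
    then show ?thesis using a_closed[of x "- y"] that by simp
  qed
  have mult: "x * y \<in> carrier ?F" if "x \<in> carrier ?F" "y \<in> carrier ?F" for x y
    using m_closed[OF that] by simp
  have gen: "gen i \<in> carrier ?F" if "i \<in> {1..<m}" for i
    using that by (auto simp: free_alg_def gen_def)
  have scal: "scal b \<in> carrier ?F" 
    by (auto simp: free_alg_def scal_def zero_fword_def)
  show ?thesis unfolding idC_relators_def by (auto intro!: diff mult gen scal)
qed

text \<open>
  There is exactly one vexillary permutation with the shape and flag in question, and its code is
  \<open>(0\<^sup>k, np, (n-1)p, \<dots>, p, 0, 0, \<dots>)\<close>.
\<close>

lemma code_support_bounded:
  assumes "w permutes {1..m}"
  shows "code_support w \<subseteq> {1..m}"
proof
  fix i assume i: "i \<in> code_support w"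
  have out: "w j = j" if "j > m" for j
    using assms that by (auto simp: permutes_def)
  have "i \<le> m"
  proof (rule ccontr)
    assume "\<not> i \<le> m"
    then have "{j. i < j \<and> w j < w i} = {}" using out by auto
    then have "code w i = 0" unfolding code_def by (metis card.empty)
    with i show False by (simp add: code_support_def)
  qed
  with i show "i \<in> {1..m}" by (auto simp: code_support_def)
qed

lemma image_mset_mset_set_eq_mset:
  assumes "finite S" "image_mset f (mset_set S) = mset xs" "distinct xs"
  shows "f ` S = set xs \<and> inj_on f S"
proof -
  have "f ` S = set xs" using assms by (metis finite_set_mset_mset_set set_image_mset set_mset_mset)
  moreover have "card S = length xs" using assms by (metis size_image_mset size_mset size_mset_set)
  ultimately show ?thesis using assms by (simp add: distinct_card eq_card_imp_inj_on)
qed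

lemma code_of_shape_flag:
  assumes "finitary_perm w" "p \<ge> 1"
    and sh: "shape w = map (\<lambda>i. (n + 1 - i) * p) [1..<n + 1]"
    and fl: "flag w = map (\<lambda>i. k + i) [1..<n + 1]"
  shows "code w i = (if k < i \<and> i \<le> k + n then (k + n + 1 - i) * p else 0)"
proof -
  obtain m where m: "w permutes {1..m}" using assms by (auto simp: finitary_perm_def)
  define S where "S = code_support w"
  have S: "S \<subseteq> {1..m}" using code_support_bounded[OF m] by (simp add: S_def)
  then have fin: "finite S" using finite_subset by blast
  define E where "E = (\<lambda>i. Max {j. i \<le> j \<and> code w i \<le> code w j})"
  let ?sh = "map (\<lambda>i. (n + 1 - i) * p) [1..<n + 1]"
  have dsh: "distinct ?sh" using \<open>p \<ge> 1\<close> by (auto simp: distinct_map inj_on_def)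
  have "mset (shape w) = mset ?sh" using sh by simp
  then have "image_mset (code w) (mset_set S) = mset ?sh" by (simp add: shape_def S_def)
  from image_mset_mset_set_eq_mset[OF fin this dsh]
  have c: "code w ` S = set ?sh" "inj_on (code w) S" by auto
  have "mset (flag w) = mset (map (\<lambda>i. k + i) [1..<n + 1])" using fl by simp
  then have "image_mset E (mset_set S) = mset (map (\<lambda>i. k + i) [1..<n + 1])"
    by (simp add: flag_def S_def E_def)
  from image_mset_mset_set_eq_mset[OF fin this]
  have E: "E ` S = set (map (\<lambda>i. k + i) [1..<n + 1])" "inj_on E S"
    by (auto simp: distinct_map)
  have mem: "j \<in> S" if "i \<in> S" "i \<le> j" "code w i \<le> code w j" for i j
    using that by (auto simp: S_def code_support_def)
  have finE: "finite {j. i \<le> j \<and> code w i \<le> code w j}" if "i \<in> S" for i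
    using mem[OF that] fin by (auto intro: finite_subset[of _ S])
  have E1: "i \<le> E i \<and> code w i \<le> code w (E i)" if "i \<in> S" for i
    using Max_in[OF finE[OF that]] by (auto simp: E_def)
  have E2: "j \<le> E i" if "i \<in> S" "i \<le> j" "code w i \<le> code w j" for i j
    using that Max_ge[OF finE[OF that(1)]] by (auto simp: E_def)
  have Eid: "E i = i" if i: "i \<in> S" for i
  proof -
    have j: "E i \<in> S" using mem[OF i] E1[OF i] by blast
    have "E (E i) = E i"
      using E1[OF i] E1[OF j] E2[OF i, of "E (E i)"] by linarith
    then show ?thesis using E(2) i j by (auto dest: inj_onD)
  qed
  have Seq: "S = {k + 1..k + n}"
  proof -
    have "S = E ` S" using Eid by force
    also have "\<dots> = {k + 1..k + n}" unfolding E(1)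
      by (simp add: atLeastLessThanSuc_atLeastAtMost del: upt_Suc)
    finally show ?thesis .
  qed
  have dec: "code w j < code w i" if "i \<in> S" "i < j" for i j
    using E2[of i j] Eid[of i] that by (cases "code w i \<le> code w j") auto
  let ?xs = "map (code w) (rev [k + 1..<k + n + 1])"
  have "sorted_wrt (\<lambda>i j. j \<le> i) (map (code w) [k + 1..<k + n + 1])"
    unfolding sorted_wrt_map
    by (rule sorted_wrt_mono_rel[OF _ sorted_wrt_upt[of "k+1" "k+n+1"]])
       (use dec Seq in \<open>fastforce intro: less_imp_le\<close>)
  then have s1: "sorted ?xs" unfolding rev_map[symmetric] sorted_wrt_rev .
  have d1: "distinct ?xs" using c(2) unfolding Seq distinct_map
    by (auto simp: atLeastLessThanSuc_atLeastAtMost simp del: upt_Suc)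
  have s2: "sorted (rev ?sh)"
    unfolding sorted_wrt_rev sorted_wrt_map
    by (rule sorted_wrt_mono_rel[OF _ sorted_wrt_upt[of 1 "n+1"]]) auto
  have "set ?xs = set (rev ?sh)"
    using c(1) unfolding Seq by (auto simp: atLeastLessThanSuc_atLeastAtMost simp del: upt_Suc)
  with s1 d1 s2 dsh have "?xs = rev ?sh"
    by (intro sorted_distinct_set_unique) auto
  then have *: "map (code w) [k + 1..<k + n + 1] = ?sh"
    by (metis rev_map rev_rev_ident)
  show ?thesis
  proof (cases "k < i \<and> i \<le> k + n")
    case True
    define t where "t = i - (k + 1)"
    with True have t: "i = k + 1 + t" "t < n" by auto
    then have "map (code w) [k + 1..<k + n + 1] ! t = ?sh ! t" using * by simp
    moreover have "[k + 1..<k + n + 1] ! t = i" "[1..<n + 1] ! t = t + 1"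
      using t by (simp_all del: upt_Suc)
    ultimately show ?thesis using t by (simp del: upt_Suc)
  next
    case False
    then have "i \<notin> S" by (auto simp: Seq)
    moreover have "code w 0 = 0"
    proof -
      have "w 0 = 0" using m by (auto simp: permutes_def)
      then show ?thesis by (simp add: code_def)
    qed
    ultimately show ?thesis using False by (cases "i = 0") (auto simp: S_def code_support_def)
  qed
qed

lemma code_inj:
  assumes "finitary_perm w" "finitary_perm v" "code w = code v"
  shows "w = v"
proof
  fix i
  show "w i = v i"
  proof (induction i rule: less_induct)
    case (less i)
    have bw: "bij w" "bij v" using assms(1,2) by (auto simp: finitary_perm_def permutes_bij)
    define A where "A = - (w ` {..<i})"
    have A: "A = - (v ` {..<i})" using less by (auto simp: A_def)
    have cnt: "code u i = card {a \<in> A. a < u i} \<and> u i \<in> A"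
      if u: "bij u" "A = - (u ` {..<i})" for u
    proof -
      have inj: "inj u" using u by (simp add: bij_is_inj)
      have "{a \<in> A. a < u i} = u ` {j. i < j \<and> u j < u i}"
      proof (intro equalityI subsetI)
        fix a assume a: "a \<in> {a \<in> A. a < u i}"
        obtain j where j: "a = u j" using surjD[OF bij_is_surj[OF u(1)], of a] by blast
        have "\<not> j < i" "j \<noteq> i" using a j u(2) by auto
        with a j show "a \<in> u ` {j. i < j \<and> u j < u i}" by auto
      next
        fix a assume "a \<in> u ` {j. i < j \<and> u j < u i}"
        then show "a \<in> {a \<in> A. a < u i}" using inj by (auto simp: u(2) inj_eq)
      qed
      then have "card {a \<in> A. a < u i} = code u i"
        unfolding code_def using card_image[OF inj_on_subset[OF inj]] by auto
      moreover have "u i \<in> A" using inj by (auto simp: u(2) inj_eq)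
      ultimately show ?thesis by simp
    qed
    have mono: "card {a \<in> A. a < x} < card {a \<in> A. a < y}" if "x \<in> A" "x < y" for x y :: nat
      by (rule psubset_card_mono) (use that in auto)
    show ?case
    proof -
      have "card {a \<in> A. a < w i} = card {a \<in> A. a < v i}" "w i \<in> A" "v i \<in> A"
        using cnt[OF bw(1) A_def] cnt[OF bw(2) A] assms(3) by simp_all
      then show ?thesis using mono[of "w i" "v i"] mono[of "v i" "w i"] by fastforce
    qed
  qed
qed

lemma varpi_exists:
  assumes "p \<ge> 1"
  shows "\<exists>w. w permutes {1..n * p + k + 1} \<and> vexillary w \<and>
     shape w = map (\<lambda>i. (n + 1 - i) * p) [1..<n + 1] \<and>
     flag w = map (\<lambda>i. k + i) [1..<n + 1]"
proof -
  define r where "r = (\<lambda>i. k + (k + n + 1 - i) * p + 1)"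
  define R where "R = r ` {k+1..k+n}"
  define S where "S = {k<..} - R"
  have infS: "infinite S" unfolding S_def R_def
    by (rule Diff_infinite_finite) (simp_all add: infinite_Ioi)
  define w where "w = (\<lambda>i. if i \<le> k then i else if i \<le> k + n then r i
                           else enumerate S (i - (k + n + 1)))"
  define M where "M = n * p + k + 1"
  have rdec: "r j < r i" if "i < j" "j \<le> k + n" for i j
  proof -
    have "(k + n + 1 - j) < (k + n + 1 - i)" using that by linarith
    then show ?thesis using assms by (simp add: r_def)
  qed
  have rk: "k < r i" for i by (simp add: r_def)
  have rM: "r i \<le> M" if "k < i" for i
  proof -
    have "k + n + 1 - i \<le> n" using that by simp
    then have "(k + n + 1 - i) * p \<le> n * p" by (rule mult_le_mono1)
    then show ?thesis by (simp add: r_def M_def)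
  qed
  have kn: "k + n < M" using mult_le_mono2[OF assms, of n] unfolding M_def by linarith
  have wS: "w i \<in> S" if "k + n < i" for i
    using that enumerate_in_set[OF infS] by (simp add: w_def)
  have wmono: "w i < w j" if "k + n < i" "i < j" for i j
    using that enumerate_mono[OF _ infS, of "i - (k+n+1)" "j - (k+n+1)"] by (simp add: w_def)
  have wR: "w i = r i \<and> w i \<in> R" if "k < i" "i \<le> k + n" for i
    using that by (simp add: w_def R_def)
  have wk: "w i = i" if "i \<le> k" for i using that by (simp add: w_def)
  have gk: "k < w i" if "k < i" for i
    using wS[of i] wR[of i] rk[of i] that by (cases "i \<le> k + n") (auto simp: S_def)
  have inj: "w i \<noteq> w j" if "i < j" for i j
  proof -
    consider "i \<le> k" "j \<le> k" | "i \<le> k" "k < j" | "k < i" "j \<le> k + n"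
      | "k < i" "i \<le> k + n" "k + n < j" | "k + n < i" using that by linarith
    then show ?thesis
    proof cases
      case 1 with that wk show ?thesis by simp
    next
      case 2 with wk gk[of j] show ?thesis by simp
    next
      case 3 with rdec[OF that] wR[of i] wR[of j] that show ?thesis by simp
    next
      case 4 with wR[of i] wS[of j] show ?thesis by (auto simp: S_def)
    next
      case 5 with wmono[OF _ that] show ?thesis by simp
    qed
  qed
  have injw: "inj w" by (rule linorder_injI) (rule inj)
  have surj: "\<exists>i. w i = v" for v
  proof -
    have "v \<le> k \<or> v \<in> R \<or> v \<in> S" by (auto simp: S_def)
    then consider "v \<le> k" | "v \<in> R" | "v \<in> S" by blast
    then show ?thesis
    proof cases
      case 1 with wk show ?thesis by blast
    next
      case 2
      then obtain i where "i \<in> {k+1..k+n}" "v = r i" by (auto simp: R_def)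
      then have "w i = v" using wR[of i] by auto
      then show ?thesis by blast
    next
      case 3
      then obtain t where "enumerate S t = v" using enumerate_Ex[OF infS 3] by blast
      then have "w (t + (k + n + 1)) = v" by (simp add: w_def)
      then show ?thesis by blast
    qed
  qed
  have bij: "bij w" by (rule bijI[OF injw]) (use surj in \<open>auto simp: surj_def eq_commute\<close>)
  have below: "card {j. w j < v} = v" for v
  proof -
    have "bij_betw w {j. w j < v} {..<v}"
      unfolding bij_betw_def
    proof
      show "inj_on w {j. w j < v}" using injw by (rule inj_on_subset) simp
      show "w ` {j. w j < v} = {..<v}"
      proof (intro equalityI subsetI)
        fix a assume "a \<in> {..<v}"
        moreover obtain i where "w i = a" using surj by blast
        ultimately show "a \<in> w ` {j. w j < v}" by auto
      qed auto
    qed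
    from bij_betw_same_card[OF this] show ?thesis by simp
  qed
  have fixed: "w i = i" if i: "M < i" for i
  proof -
    have le: "w j < w i" if "j < i" "\<not> w i \<le> M" for j
    proof (cases "k + n < j")
      case True then show ?thesis using wmono that by blast
    next
      case False
      then have "w j \<le> M" using wk[of j] wR[of j] rM[of j] kn by (cases "j \<le> k") auto
      with that show ?thesis by simp
    qed
    have big: "\<not> w i \<le> M"
    proof
      assume wi: "w i \<le> M"
      have "w j < M + 1" if "j \<le> i" for j
      proof (cases "k + n < j")
        case True then show ?thesis using wmono[of j i] that wi by (cases "j = i") auto
      next
        case False
        then show ?thesis using wk[of j] wR[of j] rM[of j] kn by (cases "j \<le> k") auto
      qed
      then have "w ` {..i} \<subseteq> {..<M + 1}" by auto
      then have "card (w ` {..i}) \<le> M + 1" using card_mono[of "{..<M + 1}"] by fastforce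
      moreover have "card (w ` {..i}) = i + 1" using injw by (simp add: card_image inj_on_subset)
      ultimately show False using i by simp
    qed
    have "{j. w j < w i} = {..<i}"
    proof (intro equalityI subsetI)
      fix j assume "j \<in> {j. w j < w i}"
      then have "\<not> i < j" "j \<noteq> i" using wmono[of i j] i kn by auto
      then show "j \<in> {..<i}" by simp
    qed (use le big in auto)
    then show ?thesis using below[of "w i"] by simp
  qed
  have perm: "w permutes {1..M}"
    unfolding permutes_def
  proof (intro conjI allI impI)
    fix x assume "x \<notin> {1..M}"
    then show "w x = x" using fixed[of x] wk[of x] by (cases "x = 0") auto
  next
    fix y show "\<exists>!x. w x = y" using bij by (simp add: bij_iff)
  qed
  have code: "code w i = (if k < i \<and> i \<le> k + n then (k + n + 1 - i) * p else 0)" for i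
  proof -
    consider "i \<le> k" | "k + n < i" | "k < i" "i \<le> k + n" by linarith
    then show ?thesis
    proof cases
      case 1
      have "{j. i < j \<and> w j < w i} = {}"
      proof (rule equals0I)
        fix j assume j: "j \<in> {j. i < j \<and> w j < w i}"
        show False using 1 wk[of i] wk[of j] gk[of j] j by (cases "j \<le> k") auto
      qed
      then have "code w i = 0" unfolding code_def by (metis card.empty)
      then show ?thesis using 1 by simp
    next
      case 2
      have "{j. i < j \<and> w j < w i} = {}" using wmono[OF 2] by (auto dest: less_asym)
      then have "code w i = 0" unfolding code_def by (metis card.empty)
      then show ?thesis using 2 by simp
    next
      case 3
      have "{j. w j < w i} = {..k} \<union> {j. i < j \<and> w j < w i}"
      proof (intro equalityI subsetI)
        fix j assume j: "j \<in> {j. w j < w i}"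
        have "\<not> (k < j \<and> j < i)" using j rdec[of j i] wR[of i] wR[of j] 3 by auto
        with j show "j \<in> {..k} \<union> {j. i < j \<and> w j < w i}"
          by (cases "j = i") (auto simp: not_less)
      next
        fix j assume j: "j \<in> {..k} \<union> {j. i < j \<and> w j < w i}"
        then show "j \<in> {j. w j < w i}" using wk[of j] gk[OF 3(1)] by auto
      qed
      moreover have fin: "finite {j. w j < w i}"
        using below[of "w i"] gk[of i] 3 by (intro card_ge_0_finite) simp
      moreover have "finite {j. i < j \<and> w j < w i}" by (rule finite_subset[OF _ fin]) auto
      moreover have "{..k} \<inter> {j. i < j \<and> w j < w i} = {}" using 3 by auto
      ultimately have "card {j. w j < w i} = card {..k} + code w i"
        unfolding code_def by (simp add: card_Un_disjoint)
      then show ?thesis using below[of "w i"] wR[of i] 3 by (simp add: r_def)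
    qed
  qed
  have sup: "code_support w = {k+1..k+n}"
    using assms by (auto simp: code_support_def code)
  have vex: "vexillary w"
    unfolding vexillary_def
  proof (rule notI, elim exE conjE)
    fix a b c d assume h: "0 < a" "a < b" "b < c" "c < d" "w b < w a" "w a < w d" "w d < w c"
    have nz: "k < i \<and> i \<le> k + n" if "i < j" "w j < w i" for i j
    proof (rule ccontr)
      assume "\<not> ?thesis"
      then have "code w i = 0" by (auto simp: code)
      moreover have "finite {j. w j < w i}"
        using below[of "w i"] that by (intro card_ge_0_finite) simp
      then have "finite {j. i < j \<and> w j < w i}" by (rule rev_finite_subset) auto
      ultimately show False using that by (auto simp: code_def)
    qed
    have ac: "a < c" "k < a" "a \<le> k + n" "k < c" "c \<le> k + n"
      using nz[OF h(2,5)] nz[OF h(4,7)] h(2,3) by simp_all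
    have "w c < w a" using rdec[OF ac(1,5)] wR[OF ac(2,3)] wR[OF ac(4,5)] by simp
    with h(6,7) show False by simp
  qed
  have ms: "mset_set {k+1..k+n} = mset (map (\<lambda>i. k + i) [1..<n + 1])"
  proof -
    have "map (\<lambda>i. k + i) [1..<n + 1] = [k+1..<k+n+1]"
      by (rule nth_equalityI) (simp_all del: upt_Suc)
    then show ?thesis by (simp add: atLeastLessThanSuc_atLeastAtMost del: upt_Suc)
  qed
  have fl: "flag w = map (\<lambda>i. k + i) [1..<n + 1]"
  proof -
    have "Max {j. i \<le> j \<and> code w i \<le> code w j} = i" if i: "i \<in> {k+1..k+n}" for i
    proof -
      have "{j. i \<le> j \<and> code w i \<le> code w j} = {i}"
        using i assms by (auto simp: code split: if_splits)
      then show ?thesis by simp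
    qed
    then have "image_mset (\<lambda>i. Max {j. i \<le> j \<and> code w i \<le> code w j}) (mset_set {k+1..k+n})
      = image_mset (\<lambda>i. i) (mset_set {k+1..k+n})"
      by (intro image_mset_cong) auto
    then have "image_mset (\<lambda>i. Max {j. i \<le> j \<and> code w i \<le> code w j}) (mset_set {k+1..k+n})
      = mset (map (\<lambda>i. k + i) [1..<n + 1])" unfolding ms[symmetric] by simp
    then have "flag w = sort (map (\<lambda>i. k + i) [1..<n + 1])"
      unfolding flag_def sup by (simp only: sorted_list_of_multiset_mset)
    also have "\<dots> = map (\<lambda>i. k + i) [1..<n + 1]"
      by (rule sorted_sort_id) (simp add: sorted_map sorted_wrt_upt del: upt_Suc)
    finally show ?thesis .
  qed
  have "image_mset (code w) (mset_set {k+1..k+n}) = mset (map (\<lambda>i. (n + 1 - i) * p) [1..<n + 1])"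
    unfolding ms mset_map image_mset.compositionality
    by (rule image_mset_cong) (auto simp: code simp del: upt_Suc)
  then have "shape w = rev (sort (rev (map (\<lambda>i. (n + 1 - i) * p) [1..<n + 1])))"
    unfolding shape_def sup by (simp only: mset_rev[symmetric, of "map (\<lambda>i. (n + 1 - i) * p) [1..<n + 1]"] sorted_list_of_multiset_mset)
  also have "sort (rev (map (\<lambda>i. (n + 1 - i) * p) [1..<n + 1])) = rev (map (\<lambda>i. (n + 1 - i) * p) [1..<n + 1])"
  proof (rule sorted_sort_id)
    show "sorted (rev (map (\<lambda>i. (n + 1 - i) * p) [1..<n + 1]))"
      unfolding sorted_wrt_rev sorted_wrt_map
      by (rule sorted_wrt_mono_rel[OF _ sorted_wrt_upt[of 1 "n+1"]]) auto
  qed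
  finally have sh: "shape w = map (\<lambda>i. (n + 1 - i) * p) [1..<n + 1]" by simp
  show ?thesis using perm vex sh fl unfolding M_def by blast
qed

lemma varpi_ex1:
  assumes "p \<ge> 1"
  shows "\<exists>!w. finitary_perm w \<and> vexillary w \<and>
     shape w = map (\<lambda>i. (n + 1 - i) * p) [1..<n + 1] \<and>
     flag w = map (\<lambda>i. k + i) [1..<n + 1]"
proof -
  have "w = v" if "finitary_perm w \<and> vexillary w \<and>
     shape w = map (\<lambda>i. (n + 1 - i) * p) [1..<n + 1] \<and> flag w = map (\<lambda>i. k + i) [1..<n + 1]"
    "finitary_perm v \<and> vexillary v \<and>
     shape v = map (\<lambda>i. (n + 1 - i) * p) [1..<n + 1] \<and> flag v = map (\<lambda>i. k + i) [1..<n + 1]" for w v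
  proof -
    have "code w = code v"
      by (rule ext) (simp only: code_of_shape_flag[OF _ assms] that)
    then show ?thesis using code_inj that by blast
  qed
  then show ?thesis using varpi_exists[OF assms, of n k] unfolding finitary_perm_def by blast
qed

lemma varpi_code:
  assumes "p \<ge> 1"
  shows "varpi n k p permutes {1..n * p + k + 1}"
    and "code (varpi n k p) i = (if k < i \<and> i \<le> k + n then (k + n + 1 - i) * p else 0)"
proof -
  note ex1 = varpi_ex1[OF assms, of n k]
  obtain w where w: "w permutes {1..n * p + k + 1}" "vexillary w"
     "shape w = map (\<lambda>i. (n + 1 - i) * p) [1..<n + 1]" "flag w = map (\<lambda>i. k + i) [1..<n + 1]"
    using varpi_exists[OF assms, of n k] by blast
  have "varpi n k p = w" unfolding varpi_def
    by (rule the1_equality[OF ex1]) (use w in \<open>auto simp: finitary_perm_def\<close>)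
  then show "varpi n k p permutes {1..n * p + k + 1}"
    and "code (varpi n k p) i = (if k < i \<and> i \<le> k + n then (k + n + 1 - i) * p else 0)"
    using w(1) code_of_shape_flag[OF _ assms w(3,4)] unfolding finitary_perm_def by blast+
qed

end

theory Submission
  imports Defs "HOL-Computational_Algebra.Formal_Power_Series"
begin

text \<open>
  The right regular representation of IdC shows that the \<open>e\<^sub>w\<close> are linearly independent, and it
  computes \<open>\<GG>\<^sub>w\<close> at any point \<open>x\<close> of any commutative ring.  Over the reals, \<open>A\<^sub>i(x)\<close> and \<open>A\<^sub>i(y)\<close>
  commute by the Yang--Baxter relation, so \<open>A\<^sub>i(x) A\<^sub>i\<^sub>+\<^sub>1(y) h\<^sub>i(y)\<close> is symmetric in \<open>x\<close> and \<open>y\<close>; hence the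
  isobaric divided difference \<open>\<pi>\<^sub>i\<close> takes \<open>\<GG>\<close> of a permutation with a descent at \<open>i\<close> to \<open>\<GG>\<close> of the
  permutation without it.  This gives \<open>\<GG>\<^sub>w = x\<^sup>c\<close> for dominant \<open>w\<close> of code \<open>c\<close>, and \<open>\<varpi>\<close> is reached from
  the dominant permutation of code \<open>(\<lambda>\<^sub>1 + k, \<dots>, \<lambda>\<^sub>n + k)\<close> by moving every code entry \<open>k\<close> places to
  the right.

  The dominant monomial is a determinant whose row \<open>i\<close> is \<open>\<pi>\<^sub>i\<^sub>-\<^sub>1 \<cdots> \<pi>\<^sub>1\<close> applied to functions of \<open>x\<^sub>1\<close>,
  and each further \<open>\<pi>\<close> changes one row only, the other rows being symmetric in the two variables
  involved.  In the variable \<open>x / (1 + b x)\<close> the entries become ordinary divided differences, and letting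
  all variables tend to \<open>1\<close>, with \<open>b = \<beta> - 1\<close>, gives
  \<open>det ([s\<^sup>k\<^sup>+\<^sup>i\<^sup>-\<^sup>j] (1 + s)\<^bsup>\<lambda>\<^sub>i + k\<^esup> (1 - (\<beta> - 1) s)\<^bsup>-\<lambda>\<^sub>i\<^esup>)\<close>.
  For \<open>k = 1\<close> this is a Hessenberg determinant, evaluated by Lagrange inversion.  In general its
  coefficient at \<open>\<beta>\<^sup>n\<^sup>k\<close> is a determinant of binomial coefficients which counts plane partitions and is
  therefore positive.
\<close>

section \<open>Codes and reduced words\<close>

text \<open>\<open>grothendieck\<close> lives over integer polynomials, whereas divided differences
  need division and the specialisation at 1 needs limits. This is why \<open>groth\<close> is
  introduced: it is built from sums and products only, commutes with ring homomorphisms, and so lets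
  all analysis happen at real points. The way back is that integer polynomials agreeing at all real
  r > 1 are equal; r > 1 makes b = r - 1 positive, which keeps 1 + b x away from 0 near x = 1. The
  point with all coordinates 1 makes every denominator x_i - x_{i+1} vanish. It is therefore
  approached only once the determinant is known, along distinct coordinates. Each move of a code
  entry one place to the right costs one unit, whence the summand k in the exponents of the dominant
  start. The last entry travels first, so the place to the right of a travelling entry is always
  free, and every later row of the determinant already involves both variables of the current
  divided difference.\<close>

lemma finite_code_set:
  fixes w :: "nat \<Rightarrow> nat"
  assumes "inj w"
  shows "finite {j. i < j \<and> w j < c}"
proof -
  have "finite (w -` {..<c})" using assms by (intro finite_vimageI) auto
  then show ?thesis by (rule rev_finite_subset) auto
qed

text \<open>At an ascent every later smaller value seen from i is also seen from i + 1. At a descent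
  position i + 1 itself is one more such position for i.\<close>

lemma ascent_iff_code_le:
  assumes "inj w"
  shows "w i < w (Suc i) \<longleftrightarrow> code w i \<le> code w (Suc i)"
proof -
  have ne: "w i \<noteq> w (Suc i)" using injD[OF assms, of i "Suc i"] by auto
  show ?thesis
  proof (cases "w i < w (Suc i)")
    case True
    then have "{j. i < j \<and> w j < w i} \<subseteq> {j. Suc i < j \<and> w j < w (Suc i)}"
      using Suc_lessI by fastforce
    then have "code w i \<le> code w (Suc i)"
      unfolding code_def by (intro card_mono finite_code_set assms)
    with True show ?thesis by simp
  next
    case False
    with ne have "insert (Suc i) {j. Suc i < j \<and> w j < w (Suc i)} \<subseteq> {j. i < j \<and> w j < w i}"
      by auto
    then have "card (insert (Suc i) {j. Suc i < j \<and> w j < w (Suc i)}) \<le> code w i"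
      unfolding code_def by (intro card_mono finite_code_set assms)
    then have "code w (Suc i) < code w i"
      using finite_code_set[OF assms, of "Suc i" "w (Suc i)"] by (simp add: code_def)
    with False show ?thesis by simp
  qed
qed

text \<open>Right multiplication by s_i: it exchanges two positions and matches multiplication of
  \<open>e_w\<close> by a generator on the right.\<close>

definition rswap :: "(nat \<Rightarrow> nat) \<Rightarrow> nat \<Rightarrow> (nat \<Rightarrow> nat)" where
  "rswap w i = w \<circ> transpose i (Suc i)"

lemma rswap_apply: "rswap w i j = (if j = i then w (Suc i) else if j = Suc i then w i else w j)"
  by (simp add: rswap_def transpose_def)

lemma rswap_rswap [simp]: "rswap (rswap w i) i = w"
  by (simp add: rswap_def comp_assoc)

lemma inj_rswap [simp]: "inj (rswap w i) \<longleftrightarrow> inj w"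
proof -
  have "inj (rswap v i)" if "inj v" for v
    using that by (simp add: rswap_def inj_compose)
  from this[of w] this[of "rswap w i"] show ?thesis by auto
qed

lemma code_swap:
  assumes "inj w" "w i < w (Suc i)"
  shows "code (rswap w i) j =
    (if j = i then Suc (code w (Suc i)) else if j = Suc i then code w i else code w j)"
proof -
  let ?s = "transpose i (Suc i)"
  consider "j = i" | "j = Suc i" | "j \<noteq> i" "j \<noteq> Suc i" by blast
  then show ?thesis
  proof cases
    case 1
    have "{l. i < l \<and> rswap w i l < rswap w i i} =
        insert (Suc i) {l. Suc i < l \<and> w l < w (Suc i)}"
      using assms(2) by (auto simp: rswap_apply split: if_splits)
    then show ?thesis
      using finite_code_set[OF assms(1), of "Suc i" "w (Suc i)"] 1 by (simp add: code_def)
  next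
    case 2
    have "{l. Suc i < l \<and> rswap w i l < rswap w i (Suc i)} = {l. i < l \<and> w l < w i}"
      using assms(2) by (auto simp: rswap_apply split: if_splits dest: Suc_lessI)
    then show ?thesis using 2 by (simp add: code_def)
  next
    case 3
    \<comment> \<open>Away from i and i + 1 the counted set is merely moved by the transposition, so
      its size is kept.\<close>
    have "{l. j < l \<and> rswap w i l < rswap w i j} = ?s ` {l. j < l \<and> w l < w j}"
    proof (intro equalityI subsetI)
      fix l assume l: "l \<in> {l. j < l \<and> rswap w i l < rswap w i j}"
      have "?s l \<in> {l. j < l \<and> w l < w j}"
        using l 3 by (auto simp: transpose_def rswap_apply split: if_splits)
      then have "?s (?s l) \<in> ?s ` {l. j < l \<and> w l < w j}" by blast
      then show "l \<in> ?s ` {l. j < l \<and> w l < w j}" by simp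
    next
      fix l assume "l \<in> ?s ` {l. j < l \<and> w l < w j}"
      then show "l \<in> {l. j < l \<and> rswap w i l < rswap w i j}"
        using 3 by (auto simp: transpose_def rswap_apply split: if_splits)
    qed
    then show ?thesis using 3 by (simp add: code_def card_image[OF inj_on_subset[OF inj_transpose]])
  qed
qed

lemma permutes_rswap_iff:
  assumes "Suc 0 \<le> i" "i < m"
  shows "rswap w i permutes {Suc 0..m} \<longleftrightarrow> w permutes {Suc 0..m}"
proof -
  have s: "transpose i (Suc i) permutes {Suc 0..m}" using assms by (intro permutes_swap_id) auto
  have "rswap v i permutes {Suc 0..m}" if "v permutes {Suc 0..m}" for v
    unfolding rswap_def by (rule permutes_compose[OF s that])
  from this[of w] this[of "rswap w i"] show ?thesis by auto
qed

text \<open>For permutations of {1..m} this is the number of inversions, that is, the Coxeter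
  length; the index 0 contributes nothing because 0 is fixed.\<close>

definition perm_len :: "nat \<Rightarrow> (nat \<Rightarrow> nat) \<Rightarrow> nat" where
  "perm_len m w = (\<Sum>i<Suc m. code w i)"

lemma perm_len_ascent:
  assumes "inj w" "i < m" "w i < w (Suc i)"
  shows "perm_len m (rswap w i) = Suc (perm_len m w)"
proof -
  have split: "(\<Sum>j<Suc m. f j) = f i + (f (Suc i) + (\<Sum>j\<in>{..<Suc m} - {i, Suc i}. f j))"
    for f :: "nat \<Rightarrow> nat"
  proof -
    have "(\<Sum>j<Suc m. f j) = f i + (\<Sum>j\<in>{..<Suc m} - {i}. f j)"
      using assms(2) by (intro sum.remove) auto
    also have "(\<Sum>j\<in>{..<Suc m} - {i}. f j) = f (Suc i) + (\<Sum>j\<in>{..<Suc m} - {i} - {Suc i}. f j)"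
      using assms(2) by (intro sum.remove) auto
    also have "{..<Suc m} - {i} - {Suc i} = {..<Suc m} - {i, Suc i}" by blast
    finally show ?thesis .
  qed
  have "(\<Sum>j\<in>{..<Suc m} - {i, Suc i}. code (rswap w i) j) =
      (\<Sum>j\<in>{..<Suc m} - {i, Suc i}. code w j)"
    by (rule sum.cong) (auto simp: code_swap[OF assms(1,3)])
  then show ?thesis
    unfolding perm_len_def split[of "code (rswap w i)"] split[of "code w"]
    by (simp add: code_swap[OF assms(1,3)])
qed

lemma perm_len_descent:
  assumes "inj w" "i < m" "w (Suc i) < w i"
  shows "perm_len m w = Suc (perm_len m (rswap w i))"
proof -
  have "inj (rswap w i)" using assms(1) by simp
  from perm_len_ascent[OF this assms(2)] show ?thesis using assms(3) by (simp add: rswap_apply)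
qed

lemma ascent_or_descent: "inj w \<Longrightarrow> w i < w (Suc i) \<or> w (Suc i) < (w i :: nat)"
  using injD[of w i "Suc i"] by (cases "w i" "w (Suc i)" rule: linorder_cases) auto

lemma code_eq_0_outside:
  assumes "w permutes {1..m}" "i \<notin> {1..m}"
  shows "code w i = 0"
proof (cases "i = 0")
  case True
  have "w 0 = 0" using assms(1) by (auto simp: permutes_def)
  then show ?thesis by (simp add: code_def True)
next
  case False
  then have "i \<notin> code_support w" using code_support_bounded[OF assms(1)] assms(2) by blast
  with False show ?thesis by (simp add: code_support_def)
qed

lemma perm_len_id [simp]: "perm_len m id = 0"
proof -
  have "code id i = 0" for i by (auto simp: code_def card_eq_0_iff)
  then show ?thesis by (simp add: perm_len_def)
qed

text \<open>Take the last position with nonzero code: the next code is 0, so the codes drop there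
  and a descent occurs.\<close>

lemma exists_descent:
  assumes w: "w permutes {1..m}" and ne: "perm_len m w \<noteq> 0"
  shows "\<exists>i\<in>{1..<m}. w (Suc i) < w i"
proof -
  have inj: "inj w" using w by (rule permutes_inj)
  let ?I = "{i. i < Suc m \<and> code w i \<noteq> 0}"
  have "?I \<noteq> {}"
  proof
    assume "?I = {}"
    then have "perm_len m w = 0" unfolding perm_len_def by (intro sum.neutral) blast
    with ne show False by simp
  qed
  moreover have fin: "finite ?I" by simp
  ultimately have i: "Max ?I \<in> ?I" using Max_in by blast
  define i where "i = Max ?I"
  have ci: "code w i \<noteq> 0" "i < Suc m" using i by (auto simp: i_def)
  have "code w (Suc i) = 0"
  proof (cases "Suc i < Suc m")
    case True
    then show ?thesis using Max_ge[OF fin, of "Suc i"] unfolding i_def[symmetric] by fastforce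
  next
    case False
    then show ?thesis using code_eq_0_outside[OF w] by auto
  qed
  then have d: "w (Suc i) < w i"
    using ascent_iff_code_le[OF inj, of i] ci ascent_or_descent[OF inj, of i] by auto
  have "1 \<le> i" using code_eq_0_outside[OF w, of i] ci by (cases "i = 0") auto
  moreover have "i \<noteq> m"
  proof
    assume "i = m"
    then have "w (Suc i) = Suc i" "w i \<in> {1..m}"
      using w \<open>1 \<le> i\<close> permutes_in_image[OF w, of i] by (auto simp: permutes_def)
    then show False using d \<open>i = m\<close> by auto
  qed
  ultimately show ?thesis using d ci by (intro bexI[of _ i]) auto
qed

section \<open>Words, reduced words and the word property\<close>

lemma perm_of_word_Nil [simp]: "perm_of_word [] = id"
  by (simp add: perm_of_word_def)

lemma perm_of_word_Cons: "perm_of_word (i # is) = transpose i (Suc i) \<circ> perm_of_word is"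
  by (simp add: perm_of_word_def)

lemma perm_of_word_append: "perm_of_word (is @ js) = perm_of_word is \<circ> perm_of_word js"
  by (induction "is") (simp_all add: perm_of_word_Cons comp_assoc)

lemma perm_of_word_snoc: "perm_of_word (is @ [i]) = rswap (perm_of_word is) i"
  by (simp add: perm_of_word_append perm_of_word_Cons rswap_def)

lemma perm_of_word_permutes: "set is \<subseteq> {1..<m} \<Longrightarrow> perm_of_word is permutes {1..m}"
proof (induction "is" rule: rev_induct)
  case (snoc i "is")
  then show ?case by (simp add: perm_of_word_snoc permutes_rswap_iff)
qed (simp only: perm_of_word_Nil permutes_id)

lemma perm_len_le_length: "set is \<subseteq> {1..<m} \<Longrightarrow> perm_len m (perm_of_word is) \<le> length is"
proof (induction "is" rule: rev_induct)
  case (snoc i "is")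
  have inj: "inj (perm_of_word is)" using snoc.prems perm_of_word_permutes permutes_inj by fastforce
  show ?case
    using perm_len_ascent[OF inj, of i m] perm_len_descent[OF inj, of i m]
      ascent_or_descent[OF inj, of i] snoc by (auto simp: perm_of_word_snoc)
qed simp

lemma perm_len_0_imp_id:
  assumes "w permutes {1..m}" "perm_len m w = 0"
  shows "w = id"
proof (rule code_inj)
  show "finitary_perm w" using assms(1) by (auto simp: finitary_perm_def)
  show "finitary_perm id"
    unfolding finitary_perm_def using permutes_id by blast
  show "code w = code id"
  proof
    fix i
    have "code w i = 0"
      using assms(2) code_eq_0_outside[OF assms(1), of i]
      by (cases "i < Suc m") (auto simp: perm_len_def simp del: sum.lessThan_Suc lessThan_Suc)
    moreover have "code id i = 0" by (auto simp: code_def card_eq_0_iff)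
    ultimately show "code w i = code id i" by simp
  qed
qed

lemma word_of_perm_len_exists:
  assumes "w permutes {1..m}"
  shows "\<exists>is. set is \<subseteq> {1..<m} \<and> perm_of_word is = w \<and> length is = perm_len m w"
  using assms
proof (induction "perm_len m w" arbitrary: w)
  case 0
  then have "w = id" using perm_len_0_imp_id[of w m] by simp
  then show ?case by (intro exI[of _ "[]"]) (simp only: perm_len_id perm_of_word_Nil, simp)
next
  case (Suc n)
  then obtain i where i: "i \<in> {1..<m}" "w (Suc i) < w i" using exists_descent[of w m] by auto
  let ?v = "rswap w i"
  have "n = perm_len m ?v"
    using perm_len_descent[of w i m] permutes_inj[OF Suc.prems] i Suc.hyps(2) by simp
  moreover have "?v permutes {1..m}" using Suc.prems i by (simp add: permutes_rswap_iff)
  ultimately obtain "is" where "set is \<subseteq> {1..<m}" "perm_of_word is = ?v" "length is = perm_len m ?v"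
    using Suc.hyps(1) by blast
  then show ?case using i \<open>n = perm_len m ?v\<close> Suc.hyps(2)
    by (intro exI[of _ "is @ [i]"]) (auto simp: perm_of_word_snoc)
qed

text \<open>Each letter changes the number of inversions by exactly one, and removing descents one
  by one produces a word that attains this bound. Minimality among all words thus becomes a
  condition on a single word.\<close>

lemma reduced_word_iff:
  "reduced_word m w is \<longleftrightarrow>
    set is \<subseteq> {1..<m} \<and> perm_of_word is = w \<and> length is = perm_len m w"
proof
  assume r: "reduced_word m w is"
  then have "set is \<subseteq> {1..<m}" "perm_of_word is = w" by (auto simp: reduced_word_def)
  moreover obtain js where "set js \<subseteq> {1..<m} \<and> perm_of_word js = w \<and> length js = perm_len m w"
    using word_of_perm_len_exists[of w m] perm_of_word_permutes[of "is" m] calculation by auto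
  ultimately show "set is \<subseteq> {1..<m} \<and> perm_of_word is = w \<and> length is = perm_len m w"
    using r perm_len_le_length[of "is" m] by (force simp: reduced_word_def)
next
  assume "set is \<subseteq> {1..<m} \<and> perm_of_word is = w \<and> length is = perm_len m w"
  then show "reduced_word m w is"
    unfolding reduced_word_def using perm_len_le_length[of _ m] by metis
qed

text \<open>If the last letter were an ascent of w, then \<open>rswap w i\<close> would have more
  inversions than the remaining word has letters.\<close>

lemma reduced_word_snocD:
  assumes "reduced_word m w (is @ [i])"
  shows "i \<in> {1..<m}" "w (Suc i) < w i" "reduced_word m (rswap w i) is"
proof -
  let ?v = "rswap w i"
  have h: "set is \<subseteq> {1..<m}" "i \<in> {1..<m}" "rswap (perm_of_word is) i = w"
      "Suc (length is) = perm_len m w"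
    using assms by (auto simp: reduced_word_iff perm_of_word_snoc)
  have v: "perm_of_word is = ?v" unfolding h(3)[symmetric] by simp
  have inj: "inj w"
    using assms perm_of_word_permutes[of "is @ [i]" m] permutes_inj
    by (auto simp: reduced_word_iff)
  have le: "perm_len m ?v \<le> length is" using perm_len_le_length[OF h(1)] v by simp
  have "\<not> w i < w (Suc i)"
    using perm_len_ascent[OF inj, of i m] le h by auto
  then show d: "w (Suc i) < w i" using ascent_or_descent[OF inj, of i] by blast
  show "i \<in> {1..<m}" by fact
  show "reduced_word m ?v is"
    using perm_len_descent[OF inj _ d, of m] h v by (auto simp: reduced_word_iff)
qed

lemma reduced_word_snocI:
  assumes "reduced_word m w is" "i \<in> {1..<m}" "w i < w (Suc i)"
  shows "reduced_word m (rswap w i) (is @ [i])"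
proof -
  have "inj w"
    using assms(1) perm_of_word_permutes[of "is" m] permutes_inj by (auto simp: reduced_word_iff)
  from perm_len_ascent[OF this _ assms(3), of m] show ?thesis
    using assms by (auto simp: reduced_word_iff perm_of_word_snoc)
qed

lemma reduced_word_exists:
  assumes "w permutes {1..m}" shows "\<exists>is. reduced_word m w is"
  using word_of_perm_len_exists[OF assms] by (auto simp: reduced_word_iff)

lemma reduced_word_permutes: "reduced_word m w is \<Longrightarrow> w permutes {1..m}"
  using perm_of_word_permutes[of "is" m] by (auto simp: reduced_word_iff)

text \<open>Two reduced words ending in distinct letters \<open>s\<close> and \<open>t\<close> are compared through a reduced word
  that ends in the longest element of the parabolic subgroup generated by \<open>s\<close> and \<open>t\<close>.\<close>

lemma reduced_words_equiv:
  fixes R :: "nat list \<Rightarrow> nat list \<Rightarrow> bool"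
  assumes refl: "\<And>u. set u \<subseteq> {1..<m} \<Longrightarrow> R u u"
    and trans: "\<And>u v w. R u v \<Longrightarrow> R v w \<Longrightarrow> R u w"
    and sym: "\<And>u v. R u v \<Longrightarrow> R v u"
    and step: "\<And>u v i. R u v \<Longrightarrow> i \<in> {1..<m} \<Longrightarrow> R (u @ [i]) (v @ [i])"
    and comm: "\<And>u i j. set u \<subseteq> {1..<m} \<Longrightarrow> i \<in> {1..<m} \<Longrightarrow> j \<in> {1..<m} \<Longrightarrow> Suc i < j \<Longrightarrow>
      R (u @ [i, j]) (u @ [j, i])"
    and braid: "\<And>u i. set u \<subseteq> {1..<m} \<Longrightarrow> i \<in> {1..<m} \<Longrightarrow> Suc i \<in> {1..<m} \<Longrightarrow>
      R (u @ [i, Suc i, i]) (u @ [Suc i, i, Suc i])"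
    and "reduced_word m w is" "reduced_word m w js"
  shows "R is js"
  using assms(7,8)
proof (induction "perm_len m w" arbitrary: w "is" js rule: less_induct)
  case less
  have ds: "set is \<subseteq> {1..<m}" "set js \<subseteq> {1..<m}" "length is = length js" "length is = perm_len m w"
    using less.prems by (auto simp: reduced_word_iff)
  have w: "w permutes {1..m}" and inj: "inj w"
    using reduced_word_permutes[OF less.prems(1)] permutes_inj by auto
  show ?case
  proof (cases "is" rule: rev_cases)
    case Nil
    then show ?thesis using ds refl by auto
  next
    case (snoc is' s)
    note eq = snoc
    obtain js' t where js: "js = js' @ [t]" using ds(3) eq by (cases js rule: rev_cases) auto
    note s = reduced_word_snocD[OF less.prems(1)[unfolded eq]]
    note t = reduced_word_snocD[OF less.prems(2)[unfolded js]]
    have IH: "R u v" if "reduced_word m (rswap w i) u"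
      "reduced_word m (rswap w i) v" "i \<in> {1..<m}" "w (Suc i) < w i" for u v i
      using less.hyps[OF _ that(1,2)] perm_len_descent[OF inj _ that(4), of m] that(3) by simp
    have far: "R (u @ [i]) (v @ [j])"
      if h: "reduced_word m (rswap w i) u" "reduced_word m (rswap w j) v"
        "i \<in> {1..<m}" "w (Suc i) < w i" "j \<in> {1..<m}" "w (Suc j) < w j" "Suc i < j" for u v i j
    proof -
      let ?x = "rswap (rswap w i) j"
      have x2: "?x = rswap (rswap w j) i" using h(7) by (auto simp: fun_eq_iff rswap_apply)
      have "?x permutes {1..m}" using h w by (simp add: permutes_rswap_iff)
      then obtain K where K: "reduced_word m ?x K" using reduced_word_exists by blast
      then have sK: "set K \<subseteq> {1..<m}" by (auto simp: reduced_word_iff)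
      have "reduced_word m (rswap ?x j) (K @ [j])"
        by (rule reduced_word_snocI[OF K h(5)]) (use h in \<open>auto simp: rswap_apply\<close>)
      then have "R u (K @ [j])" using IH[OF h(1) _ h(3,4)] by simp
      then have 1: "R (u @ [i]) (K @ [j, i])" using step[OF _ h(3)] by fastforce
      have "reduced_word m (rswap ?x i) (K @ [i])"
        by (rule reduced_word_snocI[OF K h(3)]) (use h in \<open>auto simp: rswap_apply\<close>)
      then have "R v (K @ [i])" using IH[OF h(2) _ h(5,6)] by (simp add: x2)
      then have 2: "R (v @ [j]) (K @ [i, j])" using step[OF _ h(5)] by fastforce
      show ?thesis using 1 2 comm[OF sK h(3,5,7)] trans sym by blast
    qed
    have near: "R (u @ [i]) (v @ [j])"
      if h: "reduced_word m (rswap w i) u" "reduced_word m (rswap w j) v"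
        "i \<in> {1..<m}" "w (Suc i) < w i" "j \<in> {1..<m}" "w (Suc j) < w j" "j = Suc i" for u v i j
    proof -
      let ?x = "rswap (rswap (rswap w i) j) i"
      have x2: "?x = rswap (rswap (rswap w j) i) j" using h(7) by (auto simp: fun_eq_iff rswap_apply)
      have "?x permutes {1..m}" using h w by (simp add: permutes_rswap_iff)
      then obtain K where K: "reduced_word m ?x K" using reduced_word_exists by blast
      then have sK: "set K \<subseteq> {1..<m}" by (auto simp: reduced_word_iff)
      have "reduced_word m (rswap ?x i) (K @ [i])"
        by (rule reduced_word_snocI[OF K h(3)]) (use h in \<open>auto simp: rswap_apply\<close>)
      then have "reduced_word m (rswap (rswap ?x i) j) ((K @ [i]) @ [j])"
        by (rule reduced_word_snocI[OF _ h(5)]) (use h in \<open>auto simp: rswap_apply\<close>)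
      then have "R u ((K @ [i]) @ [j])" using IH[OF h(1) _ h(3,4)] by simp
      then have 1: "R (u @ [i]) (K @ [i, j, i])" using step[OF _ h(3)] by fastforce
      have "reduced_word m (rswap ?x j) (K @ [j])"
        by (rule reduced_word_snocI[OF K h(5)]) (use h in \<open>auto simp: rswap_apply\<close>)
      then have "reduced_word m (rswap (rswap ?x j) i) ((K @ [j]) @ [i])"
        by (rule reduced_word_snocI[OF _ h(3)]) (use h in \<open>auto simp: rswap_apply\<close>)
      then have "R v ((K @ [j]) @ [i])" using IH[OF h(2) _ h(5,6)] by (simp add: x2)
      then have 2: "R (v @ [j]) (K @ [j, i, j])" using step[OF _ h(5)] by fastforce
      show ?thesis using 1 2 braid[OF sK h(3)] h(5,7) trans sym by blast
    qed
    consider "s = t" | "Suc s < t" | "t = Suc s" | "Suc t < s" | "s = Suc t" by linarith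
    then show ?thesis
    proof cases
      case 1
      then show ?thesis using IH[OF s(3) _ s(1,2), of js'] t(3) step[OF _ s(1)] eq js by simp
    next
      case 2 then show ?thesis using far[OF s(3) t(3) s(1,2) t(1,2)] eq js by simp
    next
      case 3 then show ?thesis using near[OF s(3) t(3) s(1,2) t(1,2)] eq js by simp
    next
      case 4 then show ?thesis using far[OF t(3) s(3) t(1,2) s(1,2)] eq js sym by simp
    next
      case 5 then show ?thesis using near[OF t(3) s(3) t(1,2) s(1,2)] eq js sym by simp
    qed
  qed
qed

section \<open>The right regular representation of the algebra IdC\<close>

text \<open>In the right regular representation, with \<open>X\<close> standing for \<open>\<Sum>\<^sub>w X w e\<^sub>w\<close>, the function \<open>act_gen b i X\<close>
  is the coefficient function of \<open>X e\<^sub>i\<close>.\<close>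

definition act_gen ::
    "'r::comm_ring_1 \<Rightarrow> nat \<Rightarrow> ((nat \<Rightarrow> nat) \<Rightarrow> 'r) \<Rightarrow> (nat \<Rightarrow> nat) \<Rightarrow> 'r" where
  "act_gen b i X w = (if w (Suc i) < w i then X (rswap w i) + b * X w else 0)"

lemma act_gen_sq: "act_gen b i (act_gen b i X) = (\<lambda>w. b * act_gen b i X w)"
  by (auto simp: act_gen_def rswap_apply fun_eq_iff)

lemma act_gen_comm:
  assumes "Suc i < j"
  shows "act_gen b i (act_gen b j X) = act_gen b j (act_gen b i X)"
proof
  fix w
  have "rswap (rswap w i) j = rswap (rswap w j) i"
    using assms by (auto simp: rswap_apply fun_eq_iff)
  then show "act_gen b i (act_gen b j X) w = act_gen b j (act_gen b i X) w"
    using assms by (simp add: act_gen_def rswap_apply algebra_simps)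
qed

text \<open>Both sides depend only on the relative order of the values at i, i + 1, i + 2. The terms
  involving all three swaps agree by the braid relation for permutations, which is
  \<open>r\<close>.\<close>

lemma act_gen_braid:
  "act_gen b i (act_gen b (Suc i) (act_gen b i X)) =
    act_gen b (Suc i) (act_gen b i (act_gen b (Suc i) X))"
proof
  fix w
  have r: "rswap (rswap (rswap w i) (Suc i)) i = rswap (rswap (rswap w (Suc i)) i) (Suc i)"
    by (auto simp: rswap_apply fun_eq_iff)
  show "act_gen b i (act_gen b (Suc i) (act_gen b i X)) w =
    act_gen b (Suc i) (act_gen b i (act_gen b (Suc i) X)) w"
    by (simp add: act_gen_def rswap_apply algebra_simps r)
qed

lemma act_gen_zero: "act_gen b i (\<lambda>w. 0) = (\<lambda>w. 0)"
  by (auto simp: act_gen_def)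

lemma act_gen_add: "act_gen b i (\<lambda>w. X w + Y w) = (\<lambda>w. act_gen b i X w + act_gen b i Y w)"
  by (auto simp: act_gen_def fun_eq_iff algebra_simps)

lemma act_gen_smult: "act_gen b i (\<lambda>w. c * X w) = (\<lambda>w. c * act_gen b i X w)"
  by (auto simp: act_gen_def fun_eq_iff algebra_simps)

abbreviation act_word :: "'r::comm_ring_1 \<Rightarrow> nat list \<Rightarrow> ((nat \<Rightarrow> nat) \<Rightarrow> 'r) \<Rightarrow> (nat \<Rightarrow> nat) \<Rightarrow> 'r" where
  "act_word b is \<equiv> fold (act_gen b) is"

lemma act_word_zero: "act_word b is (\<lambda>w. 0) = (\<lambda>w. 0)"
  by (induction "is") (simp_all add: act_gen_zero)

lemma act_word_add: "act_word b is (\<lambda>w. X w + Y w) = (\<lambda>w. act_word b is X w + act_word b is Y w)"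
  by (induction "is" arbitrary: X Y) (simp_all add: act_gen_add)

lemma act_word_smult: "act_word b is (\<lambda>w. c * X w) = (\<lambda>w. c * act_word b is X w)"
  by (induction "is" arbitrary: X) (simp_all add: act_gen_smult)

definition act_alg :: "'r::comm_ring_1 \<Rightarrow> (fword \<Rightarrow>\<^sub>0 'r) \<Rightarrow> ((nat \<Rightarrow> nat) \<Rightarrow> 'r) \<Rightarrow> (nat \<Rightarrow> nat) \<Rightarrow> 'r" where
  "act_alg b f X w = (\<Sum>u\<in>Poly_Mapping.keys f. Poly_Mapping.lookup f u * act_word b (letters u) X w)"

lemma act_alg_superset:
  assumes "finite A" "Poly_Mapping.keys f \<subseteq> A"
  shows "act_alg b f X w = (\<Sum>u\<in>A. Poly_Mapping.lookup f u * act_word b (letters u) X w)"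
  unfolding act_alg_def
  by (rule sum.mono_neutral_left) (use assms in \<open>auto simp: in_keys_iff\<close>)

lemma act_alg_0 [simp]: "act_alg b 0 X = (\<lambda>w. 0)"
  by (simp add: act_alg_def fun_eq_iff)

lemma act_alg_single: "act_alg b (Poly_Mapping.single u c) X = (\<lambda>w. c * act_word b (letters u) X w)"
  by (simp add: act_alg_def fun_eq_iff)

lemma act_alg_add: "act_alg b (f + g) X = (\<lambda>w. act_alg b f X w + act_alg b g X w)"
proof
  fix w
  let ?A = "Poly_Mapping.keys f \<union> Poly_Mapping.keys g"
  have A: "finite ?A" "Poly_Mapping.keys f \<subseteq> ?A" "Poly_Mapping.keys g \<subseteq> ?A"
    "Poly_Mapping.keys (f + g) \<subseteq> ?A" using Poly_Mapping.keys_add[of f g] by auto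
  show "act_alg b (f + g) X w = act_alg b f X w + act_alg b g X w"
    unfolding act_alg_superset[OF A(1,2)] act_alg_superset[OF A(1,3)] act_alg_superset[OF A(1,4)]
    by (simp add: lookup_add algebra_simps sum.distrib)
qed

lemma act_alg_uminus: "act_alg b (- f) X = (\<lambda>w. - act_alg b f X w)"
  using act_alg_add[of b f "- f" X] by (auto simp: fun_eq_iff eq_neg_iff_add_eq_0 add.commute)

lemma act_alg_diff: "act_alg b (f - g) X = (\<lambda>w. act_alg b f X w - act_alg b g X w)"
  using act_alg_add[of b f "- g" X] by (simp add: act_alg_uminus)

lemma poly_mapping_single_add_induct [case_names zero single add]:
  fixes f :: "'a \<Rightarrow>\<^sub>0 'b::comm_monoid_add"
  assumes "P 0" "\<And>u c. P (Poly_Mapping.single u c)" "\<And>f g. P f \<Longrightarrow> P g \<Longrightarrow> P (f + g)"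
  shows "P f"
proof -
  have f: "f = (\<Sum>u\<in>Poly_Mapping.keys f. Poly_Mapping.single u (Poly_Mapping.lookup f u))"
    by (rule poly_mapping_eqI) (auto simp: lookup_sum lookup_single when_def in_keys_iff)
  have "P (\<Sum>u\<in>A. Poly_Mapping.single u (Poly_Mapping.lookup f u))" for A
    by (induction A rule: infinite_finite_induct) (simp_all add: assms)
  then show ?thesis by (subst f)
qed

lemma act_alg_zero_fun: "act_alg b f (\<lambda>w. 0) = (\<lambda>w. 0)"
  by (simp add: act_alg_def act_word_zero fun_eq_iff)

lemma act_alg_fun_add: "act_alg b f (\<lambda>w. X w + Y w) = (\<lambda>w. act_alg b f X w + act_alg b f Y w)"
  by (simp add: act_alg_def act_word_add fun_eq_iff algebra_simps sum.distrib)

lemma act_alg_fun_smult: "act_alg b f (\<lambda>w. c * X w) = (\<lambda>w. c * act_alg b f X w)"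
  by (simp add: act_alg_def act_word_smult fun_eq_iff algebra_simps sum_distrib_left)

text \<open>The factors appear in reversed order because this is a right action: \<open>fold\<close>
  applies the leftmost letter first.\<close>

lemma act_alg_mult: "act_alg b (f * g) X = act_alg b g (act_alg b f X)"
proof (induction f rule: poly_mapping_single_add_induct)
  case zero
  then show ?case by (simp add: act_alg_zero_fun)
next
  case (add f f')
  then show ?case by (simp add: distrib_right act_alg_add act_alg_fun_add)
next
  case (single u c)
  show ?case
  proof (induction g rule: poly_mapping_single_add_induct)
    case (add f g)
    then show ?case by (simp add: distrib_left act_alg_add)
  qed (simp_all add: mult_single act_alg_single act_word_smult plus_fword_def mult_ac)
qed

lemma scal_comm: "scal c * f = f * scal c"
proof (induction f rule: poly_mapping_single_add_induct)
  case (add f g)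
  then show ?case by (simp add: distrib_left distrib_right)
qed (simp_all add: scal_def mult_single mult.commute)

lemma scal_mult: "scal (c * d) = scal c * scal d" and scal_add: "scal (c + d) = scal c + scal d"
  and scal_0: "scal 0 = 0" and scal_1: "scal 1 = 1"
  by (simp_all add: scal_def mult_single single_add)

lemma act_alg_scal: "act_alg b (scal c) X = (\<lambda>w. c * X w)"
  by (simp add: scal_def act_alg_single zero_fword_def)

lemma act_alg_gen: "act_alg b (gen i) X = act_gen b i X"
  by (simp add: gen_def act_alg_single)

lemma act_alg_1: "act_alg b 1 X = X"
  unfolding scal_1[symmetric] act_alg_scal by simp

lemma act_alg_sum: "act_alg b (\<Sum>a\<in>A. f a) X = (\<lambda>w. \<Sum>a\<in>A. act_alg b (f a) X w)"
  by (induction A rule: infinite_finite_induct) (simp_all add: act_alg_add)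

lemma act_alg_prod_gen: "act_alg b (prod_list (map gen is)) X = act_word b is X"
  by (induction "is" arbitrary: X) (simp_all add: act_alg_1 act_alg_mult act_alg_gen)

lemma act_alg_relator:
  assumes "f \<in> idC_relators m b"
  shows "act_alg b f X = (\<lambda>w. 0)"
proof -
  have c: "act_gen b i (act_gen b j Y) = act_gen b j (act_gen b i Y)" if "2 \<le> \<bar>int i - int j\<bar>" for i j Y
  proof -
    have "Suc i < j \<or> Suc j < i" using that by linarith
    then show ?thesis using act_gen_comm by metis
  qed
  have br: "act_gen b i (act_gen b j (act_gen b i Y)) = act_gen b j (act_gen b i (act_gen b j Y))"
    if "\<bar>int i - int j\<bar> = 1" for i j Y
  proof -
    have "j = Suc i \<or> i = Suc j" using that by linarith
    then show ?thesis using act_gen_braid by metis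
  qed
  from assms consider
      i j where "f = gen i * gen j - gen j * gen i" "2 \<le> \<bar>int i - int j\<bar>"
    | i j where "f = gen i * gen j * gen i - gen j * gen i * gen j" "\<bar>int i - int j\<bar> = 1"
    | i where "f = gen i * gen i - scal b * gen i"
    unfolding idC_relators_def by blast
  then show ?thesis
  proof cases
    case 1 then show ?thesis using c by (simp add: act_alg_diff act_alg_mult act_alg_gen)
  next
    case 2 then show ?thesis using br by (simp add: act_alg_diff act_alg_mult act_alg_gen)
  next
    case 3 then show ?thesis
      by (simp add: act_alg_diff act_alg_mult act_alg_gen act_alg_scal act_gen_sq act_gen_smult)
  qed
qed

section \<open>The free algebra, its quotient and the basis indexed by permutations\<close>

lemma free_alg_simps [simp]:
  "x \<otimes>\<^bsub>free_alg m\<^esub> y = x * y" "x \<oplus>\<^bsub>free_alg m\<^esub> y = x + y"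
  "\<zero>\<^bsub>free_alg m\<^esub> = 0" "\<one>\<^bsub>free_alg m\<^esub> = 1"
  by (simp_all add: free_alg_def)

lemma free_alg_uminus:
  assumes "x \<in> carrier (free_alg m)"
  shows "- x \<in> carrier (free_alg m)" "\<ominus>\<^bsub>free_alg m\<^esub> x = - x"
proof -
  interpret ring "free_alg m" by (rule ring_free_alg)
  show c: "- x \<in> carrier (free_alg m)" using assms by (simp add: free_alg_def)
  show "\<ominus>\<^bsub>free_alg m\<^esub> x = - x" using minus_equality[of "- x" x] assms c by simp
qed

lemma free_alg_closed [intro]:
  "x \<in> carrier (free_alg m) \<Longrightarrow> y \<in> carrier (free_alg m) \<Longrightarrow> x * y \<in> carrier (free_alg m)"
  "x \<in> carrier (free_alg m) \<Longrightarrow> y \<in> carrier (free_alg m) \<Longrightarrow> x + y \<in> carrier (free_alg m)"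
  "x \<in> carrier (free_alg m) \<Longrightarrow> y \<in> carrier (free_alg m) \<Longrightarrow> x - y \<in> carrier (free_alg m)"
  "0 \<in> carrier (free_alg m)" "1 \<in> carrier (free_alg m)" "scal c \<in> carrier (free_alg m)"
  "Suc 0 \<le> i \<Longrightarrow> i < m \<Longrightarrow> gen i \<in> carrier (free_alg m)"
proof -
  interpret ring "free_alg m" by (rule ring_free_alg)
  show "x * y \<in> carrier (free_alg m)" "x + y \<in> carrier (free_alg m)" "x - y \<in> carrier (free_alg m)"
    if "x \<in> carrier (free_alg m)" "y \<in> carrier (free_alg m)" for x y
    using m_closed[OF that] a_closed[OF that] minus_closed[OF that]
    by (simp_all add: a_minus_def free_alg_uminus that)
  show "0 \<in> carrier (free_alg m)" "1 \<in> carrier (free_alg m)" using zero_closed one_closed by simp_all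
qed (auto simp: free_alg_def gen_def scal_def zero_fword_def)

lemma idC_ideal_ideal: "ideal (idC_ideal m b) (free_alg m)"
proof -
  interpret ring "free_alg m" by (rule ring_free_alg)
  show ?thesis unfolding idC_ideal_def by (rule genideal_ideal[OF idC_relators_carrier])
qed

text \<open>The elements that annihilate every X form a two-sided ideal containing the relators,
  hence containing the ideal they generate.\<close>

lemma act_alg_ideal:
  assumes "f \<in> idC_ideal m b"
  shows "act_alg b f X = (\<lambda>w. 0)"
proof -
  interpret ring "free_alg m" by (rule ring_free_alg)
  let ?J = "{f \<in> carrier (free_alg m). \<forall>X. act_alg b f X = (\<lambda>w. 0)}"
  have "ideal ?J (free_alg m)"
  proof (rule idealI)
    show "ring (free_alg m)" by (rule ring_free_alg)
    show "subgroup ?J (add_monoid (free_alg m))"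
      by (rule add.subgroupI)
         (auto simp: act_alg_add act_alg_uminus free_alg_uminus simp flip: a_inv_def)
  qed (auto simp: act_alg_mult act_alg_zero_fun)
  moreover have "idC_relators m b \<subseteq> ?J"
    using act_alg_relator idC_relators_carrier by blast
  ultimately have "idC_ideal m b \<subseteq> ?J" unfolding idC_ideal_def by (rule genideal_minimal)
  then show ?thesis using assms by blast
qed

text \<open>Equality in the quotient without cosets. Membership in the carrier is included so that
  congruences can be added, multiplied and chained without side conditions.\<close>

definition idC_cong :: "nat \<Rightarrow> 'r::comm_ring_1 \<Rightarrow> (fword \<Rightarrow>\<^sub>0 'r) \<Rightarrow> (fword \<Rightarrow>\<^sub>0 'r) \<Rightarrow> bool" where
  "idC_cong m b f g \<longleftrightarrow>
    f \<in> carrier (free_alg m) \<and> g \<in> carrier (free_alg m) \<and> f - g \<in> idC_ideal m b"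

lemma idC_ideal_closed:
  "0 \<in> idC_ideal m b"
  "f \<in> idC_ideal m b \<Longrightarrow> g \<in> idC_ideal m b \<Longrightarrow> f + g \<in> idC_ideal m b"
  "f \<in> idC_ideal m b \<Longrightarrow> - f \<in> idC_ideal m b"
  "f \<in> idC_ideal m b \<Longrightarrow> h \<in> carrier (free_alg m) \<Longrightarrow> h * f \<in> idC_ideal m b"
  "f \<in> idC_ideal m b \<Longrightarrow> h \<in> carrier (free_alg m) \<Longrightarrow> f * h \<in> idC_ideal m b"
proof -
  interpret ideal "idC_ideal m b" "free_alg m" by (rule idC_ideal_ideal)
  show "0 \<in> idC_ideal m b" using additive_subgroup.zero_closed[OF is_additive_subgroup] by simp
  show "f + g \<in> idC_ideal m b" if "f \<in> idC_ideal m b" "g \<in> idC_ideal m b"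
    using additive_subgroup.a_closed[OF is_additive_subgroup that] by simp
  show "- f \<in> idC_ideal m b" if "f \<in> idC_ideal m b"
    using additive_subgroup.a_inv_closed[OF is_additive_subgroup that] free_alg_uminus(2)[OF a_Hcarr[OF that]] by simp
  show "h * f \<in> idC_ideal m b" "f * h \<in> idC_ideal m b"
    if "f \<in> idC_ideal m b" "h \<in> carrier (free_alg m)"
    using I_l_closed[OF that] I_r_closed[OF that] by simp_all
qed

lemma idC_class_eq_iff:
  assumes "f \<in> carrier (free_alg m)" "g \<in> carrier (free_alg m)"
  shows "idC_class m b f = idC_class m b g \<longleftrightarrow> idC_cong m b f g"
proof -
  interpret ring "free_alg m" by (rule ring_free_alg)
  show ?thesis
    unfolding idC_class_def quotient_eq_iff_same_a_r_cos[OF idC_ideal_ideal assms, symmetric]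
    using assms by (simp add: idC_cong_def a_minus_def free_alg_uminus)
qed

lemma idC_cong_refl: "f \<in> carrier (free_alg m) \<Longrightarrow> idC_cong m b f f"
  by (simp add: idC_cong_def idC_ideal_closed)

lemma idC_cong_sym: "idC_cong m b f g \<Longrightarrow> idC_cong m b g f"
  using idC_ideal_closed(3)[of "f - g" m b] by (simp add: idC_cong_def)

lemma idC_cong_trans: "idC_cong m b f g \<Longrightarrow> idC_cong m b g h \<Longrightarrow> idC_cong m b f h"
  using idC_ideal_closed(2)[of "f - g" m b "g - h"] by (simp add: idC_cong_def)

lemma idC_cong_add:
  "idC_cong m b f g \<Longrightarrow> idC_cong m b f' g' \<Longrightarrow> idC_cong m b (f + f') (g + g')"
  using idC_ideal_closed(2)[of "f - g" m b "f' - g'"]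
  by (auto simp: idC_cong_def algebra_simps)

lemma idC_cong_mult:
  assumes "idC_cong m b f g" "idC_cong m b f' g'"
  shows "idC_cong m b (f * f') (g * g')"
proof -
  have "(f - g) * f' + g * (f' - g') \<in> idC_ideal m b"
    using assms by (intro idC_ideal_closed) (auto simp: idC_cong_def)
  then show ?thesis using assms by (auto simp: idC_cong_def algebra_simps)
qed

lemma idC_cong_sum:
  assumes "finite A" "\<And>a. a \<in> A \<Longrightarrow> idC_cong m b (f a) (g a)"
  shows "idC_cong m b (\<Sum>a\<in>A. f a) (\<Sum>a\<in>A. g a)"
  using assms
proof (induction A rule: finite_induct)
  case empty
  then show ?case using idC_cong_refl free_alg_closed(4) by simp blast
qed (simp add: idC_cong_add)

lemma idC_cong_act: "idC_cong m b f g \<Longrightarrow> act_alg b f X = act_alg b g X"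
  using act_alg_ideal[of "f - g" m b X] by (auto simp: idC_cong_def act_alg_diff fun_eq_iff)

lemma idC_cong_relator:
  assumes "f - g \<in> idC_relators m b" "f \<in> carrier (free_alg m)" "g \<in> carrier (free_alg m)"
  shows "idC_cong m b f g"
proof -
  interpret ring "free_alg m" by (rule ring_free_alg)
  show ?thesis
    using genideal_self[OF idC_relators_carrier] assms by (auto simp: idC_cong_def idC_ideal_def)
qed

lemma prod_gen_closed:
  "set is \<subseteq> {1..<m} \<Longrightarrow> prod_list (map gen is) \<in> carrier (free_alg m)"
  by (induction "is") auto

text \<open>The commutation and braid relators supply precisely what the word property asks of a
  relation, so \<open>e_w\<close> does not depend on the chosen reduced word.\<close>

lemma idC_cong_reduced_words:
  assumes "reduced_word m w is" "reduced_word m w js"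
  shows "idC_cong m b (prod_list (map gen is)) (prod_list (map gen js))"
proof -
  let ?R = "\<lambda>u v. idC_cong m b (prod_list (map gen u)) (prod_list (map gen v))"
  have pre: "idC_cong m b (prod_list (map gen (u @ v))) (prod_list (map gen (u @ v')))"
    if "set u \<subseteq> {1..<m}" "?R v v'" for u v v'
    using idC_cong_mult[OF idC_cong_refl[OF prod_gen_closed[OF that(1)]] that(2)] by simp
  show ?thesis
  proof (rule reduced_words_equiv[of m ?R, OF _ _ _ _ _ _ assms])
    fix u i j assume h: "set u \<subseteq> {1..<m}" "i \<in> {1..<m}" "j \<in> {1..<m}" "Suc i < j"
    have "2 \<le> \<bar>int i - int j\<bar>" using h by linarith
    then have "?R [i, j] [j, i]"
      using h(2,3) by (intro idC_cong_relator) (simp_all add: idC_relators_def free_alg_closed, blast)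
    then show "?R (u @ [i, j]) (u @ [j, i])" by (rule pre[OF h(1)])
  next
    fix u i assume h: "set u \<subseteq> {1..<m}" "i \<in> {1..<m}" "Suc i \<in> {1..<m}"
    have "gen i * gen (Suc i) * gen i - gen (Suc i) * gen i * gen (Suc i) \<in> idC_relators m b"
    proof -
      have "\<bar>int i - int (Suc i)\<bar> = 1" by simp
      then show ?thesis using h(2,3) unfolding idC_relators_def by blast
    qed
    then have "?R [i, Suc i, i] [Suc i, i, Suc i]"
      using h(2,3) by (intro idC_cong_relator) (simp_all add: free_alg_closed flip: mult.assoc)
    then show "?R (u @ [i, Suc i, i]) (u @ [Suc i, i, Suc i])" by (rule pre[OF h(1)])
  next
    fix u v :: "nat list" and i assume "?R u v" "i \<in> {1..<m}"
    then show "?R (u @ [i]) (v @ [i])"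
      using idC_cong_mult[OF \<open>?R u v\<close> idC_cong_refl[of "gen i" m b]] by auto
  next
    fix u v w assume "?R u v" "?R v w" then show "?R u w" by (rule idC_cong_trans)
  next
    fix u v assume "?R u v" then show "?R v u" by (rule idC_cong_sym)
  next
    fix u :: "nat list" assume "set u \<subseteq> {1..<m}"
    then show "?R u u" by (intro idC_cong_refl prod_gen_closed)
  qed
qed

lemma some_reduced_word:
  assumes "w permutes {1..m}"
  shows "reduced_word m w (SOME is. reduced_word m w is)"
  using reduced_word_exists[OF assms] by (rule someI_ex)

lemma reduced_word_letters: "reduced_word m w is \<Longrightarrow> set is \<subseteq> {1..<m}"
  by (simp add: reduced_word_def)

lemma gen_perm_closed: "w permutes {1..m} \<Longrightarrow> gen_perm m w \<in> carrier (free_alg m)"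
  unfolding gen_perm_def by (rule prod_gen_closed[OF reduced_word_letters[OF some_reduced_word]])

lemma gen_perm_cong:
  "reduced_word m w is \<Longrightarrow> idC_cong m b (gen_perm m w) (prod_list (map gen is))"
  unfolding gen_perm_def
  by (rule idC_cong_reduced_words[OF some_reduced_word]) (auto dest: reduced_word_permutes)

text \<open>At an ascent a reduced word can be prolonged by i. At a descent w has a reduced word
  ending in i, and the quadratic relation applies to the doubled last letter.\<close>

lemma gen_perm_mult_gen:
  assumes w: "w permutes {1..m}" and i: "i \<in> {1..<m}"
  shows "idC_cong m b (gen_perm m w * gen i)
    (if w i < w (Suc i) then gen_perm m (rswap w i) else scal b * gen_perm m w)"
proof (cases "w i < w (Suc i)")
  case True
  obtain "is" where is1: "reduced_word m w is" using reduced_word_exists[OF w] by blast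
  have "idC_cong m b (gen_perm m w * gen i) (prod_list (map gen is) * gen i)"
    using i by (intro idC_cong_mult gen_perm_cong is1 idC_cong_refl) auto
  moreover have "idC_cong m b (gen_perm m (rswap w i)) (prod_list (map gen (is @ [i])))"
    by (intro gen_perm_cong reduced_word_snocI is1 i True)
  ultimately show ?thesis using True idC_cong_sym idC_cong_trans by fastforce
next
  case False
  let ?v = "rswap w i"
  have d: "w (Suc i) < w i" using False ascent_or_descent[OF permutes_inj[OF w], of i] by blast
  have v: "?v permutes {1..m}" using w i by (simp add: permutes_rswap_iff)
  obtain "is" where is1: "reduced_word m ?v is" using reduced_word_exists[OF v] by blast
  then have c: "prod_list (map gen is) \<in> carrier (free_alg m)"
    by (intro prod_gen_closed) (auto simp: reduced_word_iff)
  have "reduced_word m (rswap ?v i) (is @ [i])"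
    by (rule reduced_word_snocI[OF is1 i]) (use d in \<open>simp add: rswap_apply\<close>)
  then have 1: "idC_cong m b (gen_perm m w) (prod_list (map gen is) * gen i)"
    using gen_perm_cong[of m w "is @ [i]" b] by simp
  have g: "gen i \<in> carrier (free_alg m)" using i by auto
  have "idC_cong m b (gen i * gen i) (scal b * gen i)"
    by (rule idC_cong_relator) (use i in \<open>auto simp: idC_relators_def\<close>)
  from idC_cong_mult[OF idC_cong_refl[OF c] this]
  have 2: "idC_cong m b (prod_list (map gen is) * gen i * gen i) (scal b * (prod_list (map gen is) * gen i))"
    by (simp add: mult.assoc scal_comm)
  have 3: "idC_cong m b (gen_perm m w * gen i) (prod_list (map gen is) * gen i * gen i)"
    by (rule idC_cong_mult[OF 1 idC_cong_refl[OF g]])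
  have 4: "idC_cong m b (scal b * gen_perm m w) (scal b * (prod_list (map gen is) * gen i))"
    by (rule idC_cong_mult[OF idC_cong_refl 1]) auto
  show ?thesis using False idC_cong_trans[OF idC_cong_trans[OF 3 2] idC_cong_sym[OF 4]] by simp
qed

section \<open>Linear independence and expansion of products\<close>

definition delta_id :: "(nat \<Rightarrow> nat) \<Rightarrow> 'r::comm_ring_1" where
  "delta_id w = (if w = id then 1 else 0)"

lemma act_word_reduced:
  assumes "reduced_word m w is" "v permutes {1..m}"
  shows "act_word b is delta_id v = (if v = w then 1 else 0)"
  using assms
proof (induction "is" arbitrary: w v rule: rev_induct)
  case Nil
  then have w: "w = id" unfolding reduced_word_def perm_of_word_Nil by blast
  have "act_word b [] delta_id v = delta_id v" by simp
  then show ?case unfolding delta_id_def w by assumption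
next
  case (snoc i "is")
  note r = reduced_word_snocD[OF snoc.prems(1)]
  have v: "rswap v i permutes {1..m}" using snoc.prems(2) r(1) by (simp add: permutes_rswap_iff)
  have eq: "rswap v i = rswap w i \<longleftrightarrow> v = w" by (metis rswap_rswap)
  \<comment> \<open>\<open>rswap w i\<close> has an ascent at i, so where \<open>act_gen\<close> is
    nonzero the summand with the factor b vanishes by induction.\<close>
  have "v \<noteq> rswap w i" if "v (Suc i) < v i" using that r(2) by (auto simp: rswap_apply)
  then show ?case
    using snoc.IH[OF r(3) v] snoc.IH[OF r(3) snoc.prems(2)] r(2) eq
    by (auto simp: act_gen_def)
qed

lemma act_alg_gen_perm:
  assumes "w permutes {1..m}" "v permutes {1..m}"
  shows "act_alg b (gen_perm m w) delta_id v = (if v = w then 1 else 0)"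
  unfolding gen_perm_def act_alg_prod_gen by (rule act_word_reduced[OF some_reduced_word]) fact+

text \<open>Acting on the identity element reads off the coefficient of \<open>e_v\<close>. This is
  the linear independence behind the uniqueness of the Grothendieck polynomials.\<close>

lemma act_alg_expansion:
  assumes "v permutes {1..m}"
  shows "act_alg b (\<Sum>w | w permutes {1..m}. scal (G w) * gen_perm m w) delta_id v = G v"
proof -
  have "act_alg b (\<Sum>w | w permutes {1..m}. scal (G w) * gen_perm m w) delta_id v =
      (\<Sum>w | w permutes {1..m}. G w * act_alg b (gen_perm m w) delta_id v)"
    by (simp add: act_alg_sum act_alg_mult act_alg_scal act_alg_fun_smult)
  also have "\<dots> = (\<Sum>w | w permutes {1..m}. if v = w then G w else 0)"
    by (rule sum.cong) (use assms in \<open>simp_all add: act_alg_gen_perm\<close>)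
  also have "\<dots> = G v" using assms by (simp add: finite_permutations)
  finally show ?thesis .
qed

definition act_fac :: "'r::comm_ring_1 \<Rightarrow> 'r \<times> nat \<Rightarrow> ((nat \<Rightarrow> nat) \<Rightarrow> 'r) \<Rightarrow> (nat \<Rightarrow> nat) \<Rightarrow> 'r" where
  "act_fac b f X = (\<lambda>w. X w + fst f * act_gen b (snd f) X w)"

text \<open>Multiplication by a factor 1 + x e_i changes the coefficients exactly as the regular
  representation does, so coefficients of long products can be computed by a fold.\<close>

lemma expansion_step:
  assumes i: "i \<in> {1..<m}"
    and f: "idC_cong m b f (\<Sum>w | w permutes {1..m}. scal (X w) * gen_perm m w)"
  shows "idC_cong m b (f * (1 + scal x * gen i))
    (\<Sum>w | w permutes {1..m}. scal (act_fac b (x, i) X w) * gen_perm m w)"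
proof -
  let ?S = "{w. w permutes {1..m}}"
  let ?A = "{w. w permutes {1..m} \<and> w i < w (Suc i)}"
  let ?D = "{w. w permutes {1..m} \<and> w (Suc i) < w i}"
  have fin: "finite ?S" by (simp add: finite_permutations)
  then have finAD: "finite ?A" "finite ?D" by (auto intro: rev_finite_subset)
  have S: "?S = ?A \<union> ?D" "?A \<inter> ?D = {}"
    using ascent_or_descent[OF permutes_inj] by (auto dest: less_asym)
  define E :: "(nat \<Rightarrow> nat) \<Rightarrow> fword \<Rightarrow>\<^sub>0 'a" where "E = gen_perm m"
  have bij: "bij_betw (\<lambda>w. rswap w i) ?D ?A"
    by (rule bij_betwI[of _ _ _ "\<lambda>w. rswap w i"])
       (use i in \<open>auto simp: permutes_rswap_iff rswap_apply\<close>)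
  have x: "idC_cong m b (1 + scal x * gen i) (1 + scal x * gen i)"
    using i by (intro idC_cong_refl) auto
  have 1: "idC_cong m b (f * (1 + scal x * gen i))
      ((\<Sum>w\<in>?S. scal (X w) * E w) * (1 + scal x * gen i))"
    using idC_cong_mult[OF f x] by (simp add: E_def)
  have eq: "(\<Sum>w\<in>?S. scal (X w) * E w) * (1 + scal x * gen i) =
      (\<Sum>w\<in>?S. scal (X w) * E w) + (\<Sum>w\<in>?S. scal (x * X w) * (E w * gen i))"
    by (simp add: algebra_simps sum_distrib_right scal_mult)
       (simp add: scal_comm[of x] mult.assoc)
  have Ec: "E w \<in> carrier (free_alg m)" if "w \<in> ?S" for w
    using that gen_perm_closed by (simp add: E_def)
  have sumc: "(\<Sum>w\<in>B. scal (Y w) * E w) \<in> carrier (free_alg m)" if "finite B" "B \<subseteq> ?S" for B Y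
    using that by (induction B rule: finite_induct) (simp_all add: Ec free_alg_closed)
  have 2: "idC_cong m b (\<Sum>w\<in>?S. scal (x * X w) * (E w * gen i))
      (\<Sum>w\<in>?S. scal (x * X w) * (if w i < w (Suc i) then E (rswap w i) else scal b * E w))"
  proof (rule idC_cong_sum[OF fin])
    fix w assume "w \<in> ?S"
    then show "idC_cong m b (scal (x * X w) * (E w * gen i))
       (scal (x * X w) * (if w i < w (Suc i) then E (rswap w i) else scal b * E w))"
      unfolding E_def by (intro idC_cong_mult idC_cong_refl gen_perm_mult_gen i) auto
  qed
  have "(\<Sum>w\<in>?S. scal (x * X w) * (if w i < w (Suc i) then E (rswap w i) else scal b * E w)) =
      (\<Sum>w\<in>?A. scal (x * X w) * E (rswap w i)) + (\<Sum>w\<in>?D. scal (x * X w) * (scal b * E w))"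
    unfolding S(1) by (subst sum.union_disjoint) (use finAD S(2) in auto)
  \<comment> \<open>The map w -> w s_i exchanges ascents and descents at i. After reindexing, both
    halves are sums over descents, where \<open>act_gen\<close> is supported.\<close>
  also have "(\<Sum>w\<in>?A. scal (x * X w) * E (rswap w i)) = (\<Sum>w\<in>?D. scal (x * X (rswap w i)) * E w)"
    by (subst sum.reindex_bij_betw[OF bij, symmetric]) simp
  also have "(\<Sum>w\<in>?D. scal (x * X (rswap w i)) * E w) + (\<Sum>w\<in>?D. scal (x * X w) * (scal b * E w)) =
      (\<Sum>w\<in>?D. scal (x * act_gen b i X w) * E w)"
  proof (subst sum.distrib[symmetric], rule sum.cong)
    fix w assume "w \<in> ?D"
    then have "x * act_gen b i X w = x * X (rswap w i) + x * X w * b"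
      by (simp add: act_gen_def algebra_simps)
    then show "scal (x * X (rswap w i)) * E w + scal (x * X w) * (scal b * E w) =
        scal (x * act_gen b i X w) * E w"
      by (simp only: scal_add scal_mult distrib_right mult.assoc)
  qed simp
  also have "\<dots> = (\<Sum>w\<in>?S. scal (x * act_gen b i X w) * E w)"
    by (rule sum.mono_neutral_left) (use fin in \<open>auto simp: act_gen_def scal_0\<close>)
  finally have eq2: "(\<Sum>w\<in>?S. scal (x * X w) * (if w i < w (Suc i) then E (rswap w i) else scal b * E w)) =
      (\<Sum>w\<in>?S. scal (x * act_gen b i X w) * E w)" .
  have "idC_cong m b (f * (1 + scal x * gen i))
      ((\<Sum>w\<in>?S. scal (X w) * E w) + (\<Sum>w\<in>?S. scal (x * act_gen b i X w) * E w))"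
    by (rule idC_cong_trans[OF 1[unfolded eq] idC_cong_add[OF idC_cong_refl[OF sumc] 2[unfolded eq2]]])
       (use fin in auto)
  then show ?thesis
    by (simp add: act_fac_def scal_add distrib_right sum.distrib E_def)
qed

lemma expansion:
  assumes "snd ` set L \<subseteq> {1..<m}"
  shows "idC_cong m b (prod_list (map (\<lambda>f. 1 + scal (fst f) * gen (snd f)) L))
    (\<Sum>w | w permutes {1..m}. scal (fold (act_fac b) L delta_id w) * gen_perm m w)"
  using assms
proof (induction L rule: rev_induct)
  case Nil
  have "reduced_word m id []" by (simp only: reduced_word_iff perm_of_word_Nil perm_len_id) simp
  from gen_perm_cong[OF this] have g: "idC_cong m b (gen_perm m id) 1" by simp
  have id: "id permutes {1..m}" by (rule permutes_id)
  have "(\<Sum>w | w permutes {1..m}. scal (delta_id w) * gen_perm m w) =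
      (\<Sum>w | w permutes {1..m}. if w = id then (gen_perm m id :: fword \<Rightarrow>\<^sub>0 'a) else 0)"
    by (rule sum.cong) (auto simp: delta_id_def scal_0 scal_1)
  also have "\<dots> = gen_perm m id" using id by (simp add: finite_permutations)
  finally show ?case using idC_cong_sym[OF g] by simp
next
  case (snoc f L)
  then show ?case using expansion_step[of "snd f" m b _ _ "fst f"] by simp
qed

definition groth_factors :: "nat \<Rightarrow> (nat \<Rightarrow> 'r) \<Rightarrow> ('r \<times> nat) list" where
  "groth_factors m x = concat (map (\<lambda>i. map (Pair (x i)) (rev [i..<m])) [1..<m])"

text \<open>The value of the Grothendieck polynomial at a point \<open>x\<close> of an arbitrary commutative ring, with \<open>\<beta>\<close>
  replaced by \<open>b\<close>.\<close>

definition groth :: "'r::comm_ring_1 \<Rightarrow> (nat \<Rightarrow> 'r) \<Rightarrow> nat \<Rightarrow> (nat \<Rightarrow> nat) \<Rightarrow> 'r" where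
  "groth b x m = fold (act_fac b) (groth_factors m x) delta_id"

lemma prod_Afac_eq:
  "prod_list (map (\<lambda>i. Afac m i (xvar i)) is) =
    prod_list (map (\<lambda>f. 1 + scal (fst f) * gen (snd f))
      (concat (map (\<lambda>i. map (Pair (xvar i)) (rev [i..<m])) is)))"
proof -
  have "Afac m i x = prod_list (map (\<lambda>f. 1 + scal (fst f) * gen (snd f)) (map (Pair x) (rev [i..<m])))"
    for i x
    unfolding Afac_def hfac_def map_map comp_def by simp
  then show ?thesis by (induction "is") simp_all
qed

text \<open>This justifies the definite description: existence is the expansion of the product of
  the factors, and uniqueness follows by letting both candidates act on
  \<open>delta_id\<close>.\<close>

lemma grothendieck_eq_groth:
  assumes w: "w permutes {1..m}"
  shows "grothendieck m w = groth beta xvar m w"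
proof -
  let ?P = "prod_list (map (\<lambda>i. Afac m i (xvar i)) [1..<m])"
  let ?E = "\<lambda>G. \<Sum>w | w permutes {1..m}. scal (G w) * gen_perm m w"
  let ?G = "\<lambda>w. if w permutes {1..m} then groth beta xvar m w else 0"
  have E: "?E G \<in> carrier (free_alg m)" for G :: "(nat \<Rightarrow> nat) \<Rightarrow> xpoly"
  proof -
    have "(\<Sum>w\<in>B. scal (G w) * gen_perm m w) \<in> carrier (free_alg m)"
      if "finite B" "\<And>w. w \<in> B \<Longrightarrow> w permutes {1..m}" for B
      using that by (induction B rule: finite_induct) (simp_all add: gen_perm_closed free_alg_closed)
    from this[of "{w. w permutes {1..m}}"] show ?thesis by (simp add: finite_permutations)
  qed
  have "snd ` set (groth_factors m xvar) \<subseteq> {1..<m}" by (auto simp: groth_factors_def)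
  from expansion[OF this, of beta]
  have c: "idC_cong m beta ?P (?E (groth beta xvar m))"
    unfolding prod_Afac_eq groth_factors_def[symmetric] groth_def[symmetric] .
  have P: "?P \<in> carrier (free_alg m)" using c by (simp only: idC_cong_def)
  have "?E ?G = ?E (groth beta xvar m)" by (rule sum.cong) auto
  then have G: "idC_class m beta ?P = idC_class m beta (?E ?G)"
    using idC_class_eq_iff[OF P E] c by simp
  have "grothendieck m = ?G"
    unfolding grothendieck_def
  proof (rule the_equality)
    show "(\<forall>w. \<not> w permutes {1..m} \<longrightarrow> ?G w = 0) \<and> idC_class m beta ?P = idC_class m beta (?E ?G)"
      using G by simp
  next
    fix H :: "(nat \<Rightarrow> nat) \<Rightarrow> xpoly"
    assume H: "(\<forall>w. \<not> w permutes {1..m} \<longrightarrow> H w = 0) \<and> idC_class m beta ?P = idC_class m beta (?E H)"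
    then have "idC_class m beta (?E ?G) = idC_class m beta (?E H)" using G by simp
    then have "idC_cong m beta (?E ?G) (?E H)" by (simp only: idC_class_eq_iff[OF E E])
    then have "act_alg beta (?E ?G) delta_id v = act_alg beta (?E H) delta_id v" for v
      by (simp only: idC_cong_act)
    then have "?G v = H v" if "v permutes {1..m}" for v
      using act_alg_expansion[OF that, of beta ?G] act_alg_expansion[OF that, of beta H] by simp
    with H show "H = ?G" by (auto simp: fun_eq_iff)
  qed
  then show ?thesis using w by simp
qed

section \<open>Ring homomorphisms and the specialisation at one\<close>

lemma act_fac_hom:
  assumes "comm_ring_hom h"
  shows "h \<circ> act_fac b (x, i) X = act_fac (h b) (h x, i) (h \<circ> X)"
proof -
  interpret comm_ring_hom h by fact
  show ?thesis by (auto simp: act_fac_def act_gen_def fun_eq_iff hom_distribs)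
qed

text \<open>Used twice: for the specialisation of the variables and of \<beta>, and for evaluating
  the resulting integer polynomial at a real number.\<close>

lemma groth_hom:
  assumes "comm_ring_hom h"
  shows "h (groth b x m w) = groth (h b) (\<lambda>i. h (x i)) m w"
proof -
  interpret comm_ring_hom h by fact
  have "h \<circ> fold (act_fac b) L X = fold (act_fac (h b)) (map (map_prod h id) L) (h \<circ> X)" for L X
    by (induction L arbitrary: X) (auto simp: act_fac_hom[OF assms])
  from this[of "groth_factors m x" delta_id]
  have "h \<circ> groth b x m = fold (act_fac (h b)) (map (map_prod h id) (groth_factors m x)) (h \<circ> delta_id)"
    by (simp add: groth_def)
  moreover have "map (map_prod h id) (groth_factors m x) = groth_factors m (\<lambda>i. h (x i))"
    by (simp add: groth_factors_def map_concat comp_def)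
  moreover have "h \<circ> delta_id = delta_id" by (auto simp: delta_id_def fun_eq_iff)
  ultimately show ?thesis by (simp add: groth_def fun_eq_iff)
qed

definition spec_one :: "xpoly \<Rightarrow> int poly" where
  "spec_one f = eval_xpoly (\<lambda>_. 1) (subst_beta [:- 1, 1:] f)"

lemma spec_one_superset:
  assumes "finite A" "Poly_Mapping.keys f \<subseteq> A"
  shows "spec_one f = (\<Sum>u\<in>A. pcompose (Poly_Mapping.lookup f u) [:- 1, 1:])"
proof -
  let ?g = "Poly_Mapping.map (\<lambda>c. pcompose c [:- 1, 1:]) f"
  have l: "Poly_Mapping.lookup ?g u = pcompose (Poly_Mapping.lookup f u) [:- 1, 1:]" for u
    by (simp add: Poly_Mapping.map.rep_eq when_def)
  have "Poly_Mapping.keys ?g \<subseteq> A" 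
    by (rule subset_trans[OF _ assms(2)]) (auto simp: in_keys_iff l)
  then have "(\<Sum>u\<in>Poly_Mapping.keys ?g. Poly_Mapping.lookup ?g u) = (\<Sum>u\<in>A. Poly_Mapping.lookup ?g u)"
    by (intro sum.mono_neutral_left assms(1)) (auto simp: in_keys_iff)
  then show ?thesis by (simp add: spec_one_def eval_xpoly_def subst_beta_def l)
qed

lemma spec_one_single: "spec_one (Poly_Mapping.single u c) = pcompose c [:- 1, 1:]"
  using spec_one_superset[of "{u}" "Poly_Mapping.single u c"] by simp

lemma spec_one_add: "spec_one (f + g) = spec_one f + spec_one g"
proof -
  let ?A = "Poly_Mapping.keys f \<union> Poly_Mapping.keys g"
  have A: "finite ?A" "Poly_Mapping.keys f \<subseteq> ?A" "Poly_Mapping.keys g \<subseteq> ?A"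
    "Poly_Mapping.keys (f + g) \<subseteq> ?A" using Poly_Mapping.keys_add[of f g] by auto
  show ?thesis
    unfolding spec_one_superset[OF A(1,2)] spec_one_superset[OF A(1,3)] spec_one_superset[OF A(1,4)]
    by (simp add: lookup_add pcompose_add sum.distrib)
qed

lemma spec_one_0: "spec_one 0 = 0"
  using spec_one_superset[of "{}" 0] by simp

lemma spec_one_mult: "spec_one (f * g) = spec_one f * spec_one g"
proof (induction f rule: poly_mapping_single_add_induct)
  case zero
  then show ?case by (simp add: spec_one_0)
next
  case (add f f')
  then show ?case by (simp add: distrib_right spec_one_add)
next
  case (single u c)
  show ?case
  proof (induction g rule: poly_mapping_single_add_induct)
    case (add f g)
    then show ?case by (simp add: distrib_left spec_one_add)
  qed (simp_all add: mult_single spec_one_single spec_one_0 pcompose_mult)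
qed

lemma spec_one_hom: "comm_ring_hom spec_one"
proof
  show "spec_one 1 = 1"
    using spec_one_single[of 0 1] by (simp add: pcompose_1)
qed (simp_all add: spec_one_add spec_one_mult spec_one_0)

lemma grothendieck_spec_eq_groth:
  assumes "w permutes {1..m}"
  shows "grothendieck_spec m w = groth [:- 1, 1:] (\<lambda>_. 1) m w"
proof -
  have "grothendieck_spec m w = spec_one (groth beta xvar m w)"
    by (simp add: grothendieck_spec_def spec_one_def grothendieck_eq_groth[OF assms])
  also have "\<dots> = groth (spec_one beta) (\<lambda>i. spec_one (xvar i)) m w"
    by (rule groth_hom[OF spec_one_hom])
  also have "spec_one beta = [:- 1, 1:]" by (simp add: beta_def spec_one_single pcompose_pCons)
  also have "(\<lambda>i. spec_one (xvar i)) = (\<lambda>_. 1)" by (simp add: xvar_def spec_one_single pcompose_1)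
  finally show ?thesis .
qed

lemma eval_int_poly_hom: "comm_ring_hom (\<lambda>p. poly (map_poly of_int p) (r :: real))"
proof
  have "map_poly (of_int :: int \<Rightarrow> real) (p + q) = map_poly of_int p + map_poly of_int q"
    "map_poly (of_int :: int \<Rightarrow> real) (p * q) = map_poly of_int p * map_poly of_int q" for p q
    by (auto intro!: poly_eqI simp: coeff_map_poly coeff_mult)
  then show "poly (map_poly of_int (p + q)) r = poly (map_poly of_int p) r + poly (map_poly of_int q) r"
    "poly (map_poly of_int (p * q)) r = poly (map_poly of_int p) r * poly (map_poly of_int q) r" for p q
    by simp_all
qed simp_all

lemma poly_grothendieck_spec:
  fixes r :: real
  assumes "w permutes {1..m}"
  shows "poly (map_poly of_int (grothendieck_spec m w)) r = groth (r - 1) (\<lambda>_. 1) m w"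
  using groth_hom[OF eval_int_poly_hom[of r], of "[:- 1, 1:]" "\<lambda>_. 1" m w]
  by (simp add: grothendieck_spec_eq_groth[OF assms] map_poly_pCons)

section \<open>Grothendieck polynomials and divided differences\<close>

lemma act_fac_apply: "act_fac b (x, i) X = (\<lambda>w. X w + x * act_gen b i X w)"
  by (simp add: act_fac_def)

lemma act_gen_act_fac:
  "act_gen b j (act_fac b (x, i) X) = (\<lambda>w. act_gen b j X w + x * act_gen b j (act_gen b i X) w)"
  by (simp add: act_fac_apply act_gen_add act_gen_smult)

lemma act_fac_comm:
  assumes "Suc i < j"
  shows "act_fac b (x, i) (act_fac b (y, j) X) = act_fac b (y, j) (act_fac b (x, i) X)"
  unfolding act_fac_apply[of b x i "act_fac b (y, j) X"] act_fac_apply[of b y j "act_fac b (x, i) X"]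
    act_gen_act_fac act_gen_comm[OF assms]
  by (simp add: act_fac_apply fun_eq_iff algebra_simps)

lemma act_fac_comm_same:
  "act_fac b (x, i) (act_fac b (y, i) X) = act_fac b (y, i) (act_fac b (x, i) X)"
  unfolding act_fac_apply[of b x i "act_fac b (y, i) X"] act_fac_apply[of b y i "act_fac b (x, i) X"]
    act_gen_act_fac
  by (simp add: act_fac_apply fun_eq_iff algebra_simps)

lemma act_fac_comm_list:
  assumes "\<And>f. f \<in> set L \<Longrightarrow> Suc i < snd f"
  shows "act_fac b (x, i) (fold (act_fac b) L X) = fold (act_fac b) L (act_fac b (x, i) X)"
  using assms
proof (induction L arbitrary: X)
  case (Cons f L)
  have "act_fac b (x, i) (act_fac b f X) = act_fac b f (act_fac b (x, i) X)"
    using act_fac_comm[of i "snd f" b x "fst f" X] Cons.prems by simp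
  then show ?case using Cons by simp
qed simp

lemma act_fac_smult: "act_fac b f (\<lambda>w. c * X w) = (\<lambda>w. c * act_fac b f X w)"
  by (simp add: act_fac_def act_gen_smult fun_eq_iff algebra_simps)

text \<open>The Yang--Baxter relation in a form free of inverses: up to a scalar the first factor
  is the inverse of \<open>1 + y e\<^sub>i\<^sub>+\<^sub>1\<close>, and the product is symmetric in \<open>x\<close> and \<open>y\<close> apart from that scalar.\<close>

lemma yang_baxter:
  "act_fac b (y, i) (act_fac b (y, Suc i) (act_fac b (x, i)
      (\<lambda>w. (1 + b * y) * S w - y * act_gen b (Suc i) S w))) =
    (\<lambda>w. (1 + b * y) * (S w + (x + y + b * x * y) * act_gen b i S w + x * y *
      (act_gen b (Suc i) (act_gen b i S) w - act_gen b i (act_gen b (Suc i) S) w)))"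
proof -
  define p where "p = act_gen b i S"
  define q where "q = act_gen b (Suc i) S"
  define pq where "pq = act_gen b (Suc i) p"
  define qp where "qp = act_gen b i q"
  define t where "t = act_gen b i pq"
  have t': "act_gen b (Suc i) qp = t"
    unfolding t_def pq_def qp_def p_def q_def act_gen_braid ..
  have sq: "act_gen b i p = (\<lambda>w. b * p w)" "act_gen b (Suc i) q = (\<lambda>w. b * q w)"
    "act_gen b (Suc i) pq = (\<lambda>w. b * pq w)" "act_gen b i qp = (\<lambda>w. b * qp w)" "act_gen b i t = (\<lambda>w. b * t w)"
    by (simp_all add: p_def q_def pq_def qp_def t_def act_gen_sq)
  note simps = act_gen_add act_gen_smult sq t' p_def[symmetric] q_def[symmetric] pq_def[symmetric]
    qp_def[symmetric] t_def[symmetric]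
  have V0: "(\<lambda>w. (1 + b * y) * S w - y * q w) = (\<lambda>w. (1 + b * y) * S w + (- y) * q w)" by simp
  have V1: "act_fac b (x, i) (\<lambda>w. (1 + b * y) * S w - y * q w) =
      (\<lambda>w. (1 + b * y) * S w + (- y) * q w + (x * (1 + b * y)) * p w + (- (x * y)) * qp w)"
    unfolding V0 act_fac_apply simps by (simp add: fun_eq_iff algebra_simps)
  have V2: "act_fac b (y, Suc i) \<dots> = (\<lambda>w. (1 + b * y) * S w + (x * (1 + b * y)) * p w + (- (x * y)) * qp w +
      (x * y * (1 + b * y)) * pq w + (- (x * y * y)) * t w)"
    unfolding act_fac_apply simps by (simp add: fun_eq_iff algebra_simps)
  have V3: "act_fac b (y, i) \<dots> = (\<lambda>w. (1 + b * y) * (S w + (x + y + b * x * y) * p w + x * y * (pq w - qp w)))"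
    unfolding act_fac_apply simps by (simp add: fun_eq_iff algebra_simps)
  show ?thesis
    unfolding p_def[symmetric] q_def[symmetric] pq_def[symmetric] qp_def[symmetric] V1 V2 V3 ..
qed

abbreviation act_row :: "'r::comm_ring_1 \<Rightarrow> nat \<Rightarrow> nat \<Rightarrow> 'r \<Rightarrow> ((nat \<Rightarrow> nat) \<Rightarrow> 'r) \<Rightarrow> (nat \<Rightarrow> nat) \<Rightarrow> 'r" where
  "act_row b m i x \<equiv> fold (act_fac b) (map (Pair x) (rev [i..<m]))"

lemma act_row_rec: "i < m \<Longrightarrow> act_row b m i x X = act_fac b (x, i) (act_row b m (Suc i) x X)"
  by (simp add: upt_conv_Cons)

text \<open>Induction from the short rows upwards. The factor h_i(x) passes the letters above i + 1
  in the second row, which leaves three factors with the letters i, i + 1, i for the Yang-Baxter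
  relation.\<close>

lemma act_row_comm:
  fixes b :: "'r::idom"
  assumes "1 + b * x \<noteq> 0" "1 + b * y \<noteq> 0"
  shows "act_row b m i y (act_row b m i x X) = act_row b m i x (act_row b m i y X)"
proof (induction "m - i" arbitrary: i)
  case 0
  then show ?case by simp
next
  case (Suc d)
  then have im: "i < m" and d: "d = m - Suc i" by auto
  note IH = Suc.hyps(1)[OF d]
  show ?case
  proof (cases "Suc i < m")
    case False
    then have "[i..<m] = [i]" using im by (simp add: upt_conv_Cons)
    then show ?thesis using act_fac_comm_same by simp
  next
    case True
    \<comment> \<open>The result of the Yang-Baxter relation; it is symmetric in x and y as soon as
      S is, and S is symmetric by the induction hypothesis.\<close>
    let ?N = "\<lambda>x y S w. S w + (x + y + b * x * y) * act_gen b i S w + x * y *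
      (act_gen b (Suc i) (act_gen b i S) w - act_gen b i (act_gen b (Suc i) S) w)"
    have main: "act_row b m i y (act_row b m i x X) =
        ?N x y (act_row b m (Suc i) y (act_row b m (Suc i) x X))" if y: "1 + b * y \<noteq> 0" for x y
    proof -
      define Y where "Y = act_row b m (Suc (Suc i)) y (act_row b m (Suc i) x X)"
      define S where "S = act_row b m (Suc i) y (act_row b m (Suc i) x X)"
      have S: "S = act_fac b (y, Suc i) Y" unfolding S_def Y_def by (rule act_row_rec[OF True])
      have "act_row b m i y (act_row b m i x X) =
          act_fac b (y, i) (act_fac b (y, Suc i) (act_row b m (Suc (Suc i)) y (act_fac b (x, i)
            (act_row b m (Suc i) x X))))"
        by (simp only: act_row_rec[OF im] act_row_rec[OF True])
      also have "act_row b m (Suc (Suc i)) y (act_fac b (x, i) (act_row b m (Suc i) x X)) = act_fac b (x, i) Y"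
        unfolding Y_def by (rule act_fac_comm_list[symmetric]) auto
      finally have U: "act_row b m i y (act_row b m i x X) =
        act_fac b (y, i) (act_fac b (y, Suc i) (act_fac b (x, i) Y))" .
      \<comment> \<open>S is Y followed by 1 + y e_{i+1}, and (1 + y e)(1 + b y - y e) = 1 + b y
        when e^2 = b e. This recovers Y from S up to a scalar.\<close>
      have "(\<lambda>w. (1 + b * y) * S w - y * act_gen b (Suc i) S w) = (\<lambda>w. (1 + b * y) * Y w)"
        unfolding S act_gen_act_fac act_gen_sq by (simp add: act_fac_apply fun_eq_iff algebra_simps)
      then have "(\<lambda>w. (1 + b * y) * act_row b m i y (act_row b m i x X) w) =
          (\<lambda>w. (1 + b * y) * ?N x y S w)"
        using yang_baxter[of b y i x S] by (simp only: U act_fac_smult)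
      then show ?thesis using y by (simp add: fun_eq_iff S_def)
    qed
    show ?thesis
      unfolding main[OF assms(2)] main[OF assms(1)] IH by (simp add: fun_eq_iff algebra_simps)
  qed
qed

lemma groth_swap_symmetric:
  fixes b :: "'r::idom"
  assumes i: "1 \<le> i" "i < m" and x: "1 + b * x i \<noteq> 0" "1 + b * x (Suc i) \<noteq> 0"
  shows "act_fac b (x (Suc i), i) (groth b x m) =
    act_fac b (x i, i) (groth b (x \<circ> transpose i (Suc i)) m)"
proof -
  define rows :: "(nat \<Rightarrow> 'r) \<Rightarrow> nat list \<Rightarrow> ('r \<times> nat) list" where
    "rows = (\<lambda>x is. concat (map (\<lambda>i. map (Pair (x i)) (rev [i..<m])) is))"
  \<comment> \<open>The range is extended to include m, whose row is empty, so that a row i + 1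
    exists even for i = m - 1.\<close>
  have split: "[1..<Suc m] = [1..<i] @ i # Suc i # [Suc (Suc i)..<Suc m]"
    using upt_add_eq_append[of 1 i "Suc m - i"] i by (simp add: upt_conv_Cons del: upt_Suc)
  have g: "groth b x m = fold (act_fac b) (rows x [Suc (Suc i)..<Suc m])
      (act_row b m (Suc i) (x (Suc i)) (act_row b m i (x i) (fold (act_fac b) (rows x [1..<i]) delta_id)))"
    for x
  proof -
    have "groth_factors m x = rows x [1..<Suc m]"
      using i by (simp add: groth_factors_def rows_def)
    then show ?thesis unfolding groth_def split by (simp add: rows_def del: upt_Suc)
  qed
  have m: "act_fac b (z, i) (groth b x m) = fold (act_fac b) (rows x [Suc (Suc i)..<Suc m])
      (act_row b m i z (act_row b m i (x i) (fold (act_fac b) (rows x [1..<i]) delta_id)))"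
    if "z = x (Suc i)" for x z
    unfolding g that act_row_rec[OF i(2), of b "x (Suc i)"]
    by (rule act_fac_comm_list) (auto simp: rows_def)
  let ?y = "x \<circ> transpose i (Suc i)"
  have r: "rows ?y [Suc (Suc i)..<Suc m] = rows x [Suc (Suc i)..<Suc m]" "rows ?y [1..<i] = rows x [1..<i]"
    unfolding rows_def by (intro arg_cong[of _ _ concat] map_cong; auto simp: transpose_def)+
  have y: "?y i = x (Suc i)" "?y (Suc i) = x i" by simp_all
  show ?thesis
    using m[of "x (Suc i)" x] m[of "x i" ?y] y unfolding r act_row_comm[OF x] by simp
qed

text \<open>Coefficients are compared in the symmetric identity. At the ascent w the extra factor
  has no effect, so the value at w is symmetric in the two variables; the coefficient at w s_i then
  gives the formula, with the denominator cleared.\<close>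

lemma groth_divided_difference:
  fixes b :: "'r::idom"
  assumes i: "1 \<le> i" "i < m" and x: "1 + b * x i \<noteq> 0" "1 + b * x (Suc i) \<noteq> 0"
    and w: "w i < w (Suc i)"
  shows "(x i - x (Suc i)) * groth b x m w =
    (1 + b * x (Suc i)) * groth b x m (rswap w i) -
    (1 + b * x i) * groth b (x \<circ> transpose i (Suc i)) m (rswap w i)"
proof -
  note eq = fun_cong[OF groth_swap_symmetric[OF i x]]
  have 1: "groth b x m w = groth b (x \<circ> transpose i (Suc i)) m w"
    using eq[of w] w by (simp add: act_fac_apply act_gen_def)
  have "act_gen b i X (rswap w i) = X w + b * X (rswap w i)" for X
    using w by (simp add: act_gen_def rswap_apply)
  then have "groth b x m (rswap w i) + x (Suc i) * (groth b x m w + b * groth b x m (rswap w i)) =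
    groth b (x \<circ> transpose i (Suc i)) m (rswap w i) + x i * (groth b (x \<circ> transpose i (Suc i)) m w +
      b * groth b (x \<circ> transpose i (Suc i)) m (rswap w i))"
    using eq[of "rswap w i"] by (simp add: act_fac_apply)
  then show ?thesis unfolding 1[symmetric] by (simp add: algebra_simps)
qed

text \<open>The letter m acts nontrivially only at a descent at m, and no permutation reached from w
  by swaps below m has one. All factors with the letter m may be dropped.\<close>

lemma groth_stable_Suc:
  assumes w: "w permutes {1..m}"
  shows "groth b x (Suc m) w = groth b x m w"
proof -
  have fold_eq: "fold (act_fac b) L delta_id w = fold (act_fac b) (filter (\<lambda>f. snd f \<noteq> m) L) delta_id w"
    if "snd ` set L \<subseteq> {1..m}" "w permutes {1..m}" for L w
    using that
  proof (induction L arbitrary: w rule: rev_induct)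
    case (snoc f L)
    obtain z i where f: "f = (z, i)" by (cases f)
    have IH: "fold (act_fac b) L delta_id v = fold (act_fac b) (filter (\<lambda>f. snd f \<noteq> m) L) delta_id v"
      if "v permutes {1..m}" for v
      using snoc.IH[OF _ that] snoc.prems(1) by simp
    show ?case
    proof (cases "i = m")
      case True
      have "w (Suc m) = Suc m" using snoc.prems(2) by (auto simp: permutes_def)
      moreover have "w m \<le> m" using snoc.prems True f permutes_in_image[OF snoc.prems(2), of m] by auto
      ultimately show ?thesis using IH[OF snoc.prems(2)] True f by (simp add: act_fac_apply act_gen_def)
    next
      case False
      then have "rswap w i permutes {1..m}" using snoc.prems f by (simp add: permutes_rswap_iff)
      then show ?thesis using IH IH[OF snoc.prems(2)] False f by (simp add: act_fac_apply act_gen_def)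
    qed
  qed simp
  have "filter (\<lambda>f. snd f \<noteq> m) (map (Pair (x i)) (rev [i..<Suc m])) = map (Pair (x i)) (rev [i..<m])" for i
    by (cases "i \<le> m") (auto simp: filter_map comp_def rev_filter[symmetric] intro!: filter_True)
  then have "filter (\<lambda>f. snd f \<noteq> m) (groth_factors (Suc m) x) = groth_factors m x"
    unfolding groth_factors_def filter_concat map_map comp_def by (cases m) simp_all
  moreover have "snd ` set (groth_factors (Suc m) x) \<subseteq> {1..m}" by (auto simp: groth_factors_def)
  ultimately show ?thesis using fold_eq[OF _ w] by (simp add: groth_def)
qed

lemma groth_stable:
  assumes w: "w permutes {1..m}" and "m \<le> M"
  shows "groth b x M w = groth b x m w"
  using assms(2)
proof (induction M rule: dec_induct)
  case (step M)
  have "w permutes {1..M}" by (rule permutes_subset[OF w]) (use step in auto)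
  with step show ?case by (simp add: groth_stable_Suc)
qed simp

text \<open>A product with at most as many factors as w has inversions reaches w only if every
  factor contributes its generator, so neither the summand 1 nor b can enter.\<close>

lemma fold_act_fac_top:
  assumes "snd ` set L \<subseteq> {1..<m}" "w permutes {1..m}" "length L \<le> perm_len m w"
  shows "fold (act_fac b) L delta_id w =
    (if reduced_word m w (map snd L) then prod_list (map fst L) else 0)"
  using assms
proof (induction L arbitrary: w rule: rev_induct)
  case Nil
  have "reduced_word m w [] \<longleftrightarrow> w = id"
    unfolding reduced_word_def perm_of_word_Nil by (simp add: eq_commute)
  then show ?case unfolding delta_id_def by simp
next
  case (snoc f L)
  obtain x i where f: "f = (x, i)" by (cases f)
  have i: "i \<in> {1..<m}" and L: "snd ` set L \<subseteq> {1..<m}" using snoc.prems(1) f by auto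
  have len: "Suc (length L) \<le> perm_len m w" using snoc.prems(3) by simp
  have "\<not> reduced_word m w (map snd L)" using len by (auto simp: reduced_word_iff)
  then have 0: "fold (act_fac b) L delta_id w = 0"
    using snoc.IH[OF L snoc.prems(2)] len by simp
  show ?case
  proof (cases "w (Suc i) < w i")
    case True
    have v: "rswap w i permutes {1..m}" using snoc.prems(2) i by (simp add: permutes_rswap_iff)
    have lv: "perm_len m w = Suc (perm_len m (rswap w i))"
      using perm_len_descent[OF permutes_inj[OF snoc.prems(2)] _ True] i by simp
    have "reduced_word m w (map snd L @ [i]) \<longleftrightarrow> reduced_word m (rswap w i) (map snd L)"
      using reduced_word_snocD(3)[of m w "map snd L" i]
        reduced_word_snocI[of m "rswap w i" "map snd L" i] i True by (auto simp: rswap_apply)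
    then show ?thesis
      using snoc.IH[OF L v] lv len 0 True f by (simp add: act_fac_apply act_gen_def mult.commute)
  next
    case False
    then have "\<not> reduced_word m w (map snd L @ [i])" using reduced_word_snocD(2) by blast
    then show ?thesis using 0 False f by (simp add: act_fac_apply act_gen_def)
  qed
qed

section \<open>The longest element and dominant permutations\<close>

lemma perm_of_word_descending:
  "perm_of_word (rev [i..<m]) j = (if i \<le> j \<and> j \<le> m \<and> i \<le> m then if j = i then m else j - 1 else j)"
proof (induction m)
  case (Suc m)
  show ?case
  proof (cases "i \<le> m")
    case True
    then have "perm_of_word (rev [i..<Suc m]) j = transpose m (Suc m) (perm_of_word (rev [i..<m]) j)"
      by (simp add: perm_of_word_Cons)
    then show ?thesis using Suc True by (auto simp: transpose_def)
  next
    case False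
    then show ?thesis by simp
  qed
qed simp

lemma perm_of_staircase_word:
  assumes "a \<le> m"
  shows "perm_of_word (concat (map (\<lambda>i. rev [i..<m]) [a..<m])) j = (if a \<le> j \<and> j \<le> m then m + a - j else j)"
  using assms
proof (induction "m - a" arbitrary: a j)
  case 0
  then show ?case by auto
next
  case (Suc d)
  then have a: "a < m" by simp
  have "perm_of_word (concat (map (\<lambda>i. rev [i..<m]) [a..<m])) j =
    perm_of_word (rev [a..<m]) (perm_of_word (concat (map (\<lambda>i. rev [i..<m]) [Suc a..<m])) j)"
    unfolding upt_conv_Cons[OF a] list.map concat.simps perm_of_word_append by simp
  also have "\<dots> = (if a \<le> j \<and> j \<le> m then m + a - j else j)"
    using a Suc.hyps(1)[of "Suc a" j] Suc.hyps(2) by (auto simp: perm_of_word_descending)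
  finally show ?case .
qed

lemma code_le:
  assumes "w permutes {1..m}" "i \<le> m"
  shows "code w i \<le> m - i"
proof -
  have "{j. i < j \<and> w j < w i} \<subseteq> {i<..m}"
  proof
    fix j assume j: "j \<in> {j. i < j \<and> w j < w i}"
    have "w i \<le> m"
    proof (cases "i = 0")
      case True then show ?thesis using assms(1) by (simp add: permutes_def)
    next
      case False then show ?thesis using permutes_in_image[OF assms(1), of i] assms(2) by auto
    qed
    have "j \<le> m"
    proof (rule ccontr)
      assume "\<not> j \<le> m"
      then have "w j = j" using assms(1) by (auto simp: permutes_def)
      then show False using j \<open>w i \<le> m\<close> \<open>\<not> j \<le> m\<close> by auto
    qed
    then show "j \<in> {i<..m}" using j by simp
  qed
  then have "code w i \<le> card {i<..m}" unfolding code_def by (intro card_mono) auto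
  then show ?thesis by simp
qed

lemma staircase_code:
  assumes w: "w = perm_of_word (concat (map (\<lambda>i. rev [i..<m]) [1..<m]))" and i: "1 \<le> i" "i \<le> m"
  shows "code w i = m - i"
proof -
  have w': "w j = (if 1 \<le> j \<and> j \<le> m then m + 1 - j else j)" for j
    unfolding w by (rule perm_of_staircase_word) (use i in simp)
  have "{j. i < j \<and> w j < w i} = {i<..m}" using i by (auto simp: w')
  then show ?thesis by (simp add: code_def)
qed

lemma groth_factors_prod:
  "prod_list (map fst (groth_factors m x)) = (\<Prod>i\<in>{1..<m}. x i ^ (m - i))"
proof -
  have "prod_list (map fst (concat (map (\<lambda>i. map (Pair (x i)) (rev [i..<m])) is))) =
      prod_list (map (\<lambda>i. x i ^ (m - i)) is)" for "is"
    by (induction "is") (simp_all add: comp_def map_replicate_const)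
  then show ?thesis
    unfolding groth_factors_def by (simp add: prod.distinct_set_conv_list[symmetric])
qed

text \<open>The defining product has exactly as many factors as the longest element has inversions,
  and its letters form a reduced word. Only the term using all generators survives.\<close>

lemma groth_longest:
  assumes "w permutes {1..m}" "\<And>i. 1 \<le> i \<Longrightarrow> i \<le> m \<Longrightarrow> code w i = m - i"
  shows "groth b x m w = (\<Prod>i\<in>{1..<m}. x i ^ (m - i))"
proof -
  let ?u = "concat (map (\<lambda>i. rev [i..<m]) [1..<m])"
  have su: "set ?u \<subseteq> {1..<m}" by auto
  have u: "perm_of_word ?u permutes {1..m}" by (rule perm_of_word_permutes[OF su])
  have weq: "w = perm_of_word ?u"
  proof (rule code_inj)
    show "finitary_perm w" "finitary_perm (perm_of_word ?u)"
      using assms(1) u unfolding finitary_perm_def by blast+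
    show "code w = code (perm_of_word ?u)"
    proof
      fix i
      show "code w i = code (perm_of_word ?u) i"
        using code_eq_0_outside[OF assms(1), of i] code_eq_0_outside[OF u, of i] assms(2)[of i]
          staircase_code[OF refl, of i m] by (cases "i \<in> {1..m}") auto
    qed
  qed
  have "{..<Suc m} = insert 0 {1..m}" by auto
  then have "perm_len m w = (\<Sum>i\<in>{1..m}. code w i)"
    using code_eq_0_outside[OF assms(1), of 0] by (simp add: perm_len_def del: lessThan_Suc)
  also have "\<dots> = (\<Sum>i\<in>{1..m}. m - i)" by (rule sum.cong) (use assms(2) in auto)
  also have "\<dots> = (\<Sum>i\<in>{1..<m}. m - i)" by (rule sum.mono_neutral_right) auto
  also have "\<dots> = length ?u"
    by (simp add: length_concat comp_def sum.distinct_set_conv_list[symmetric])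
  finally have len: "length ?u = perm_len m w" by simp
  have snd: "map snd (groth_factors m x) = ?u"
    by (simp add: groth_factors_def map_concat comp_def)
  then have l: "length (groth_factors m x) = length ?u" by (metis length_map)
  have "reduced_word m w (map snd (groth_factors m x))"
    unfolding snd using su len weq by (simp only: reduced_word_iff)
  moreover have "snd ` set (groth_factors m x) \<subseteq> {1..<m}" by (auto simp: groth_factors_def)
  ultimately show ?thesis
    using fold_act_fac_top[of "groth_factors m x" m w b] assms(1) l len
    by (simp add: groth_def groth_factors_prod)
qed

text \<open>Distinctness allows division by differences of coordinates. All indices are included, so
  the condition survives transpositions and the passage to larger symmetric groups.\<close>

definition generic_point :: "real \<Rightarrow> (nat \<Rightarrow> real) \<Rightarrow> bool" where
  "generic_point b x \<longleftrightarrow> inj x \<and> (\<forall>i. 1 + b * x i \<noteq> 0)"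

lemma generic_point_transpose: "generic_point b x \<Longrightarrow> generic_point b (x \<circ> transpose i j)"
  by (simp add: generic_point_def inj_compose)

lemma generic_pointD:
  "generic_point b x \<Longrightarrow> 1 + b * x i \<noteq> 0"
  "generic_point b x \<Longrightarrow> i \<noteq> j \<Longrightarrow> x i \<noteq> x j"
  by (auto simp: generic_point_def dest: injD)

lemma prod_split_adjacent:
  assumes "1 \<le> i" "i < m"
  shows "(\<Prod>j\<in>{1..m}. f j) = f i * f (Suc i) * (\<Prod>j\<in>{1..m} - {i, Suc i}. f j)"
proof -
  have "(\<Prod>j\<in>{1..m}. f j) = f i * (\<Prod>j\<in>{1..m} - {i}. f j)"
    using assms by (intro prod.remove) auto
  also have "(\<Prod>j\<in>{1..m} - {i}. f j) = f (Suc i) * (\<Prod>j\<in>{1..m} - {i} - {Suc i}. f j)"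
    using assms by (intro prod.remove) auto
  also have "{1..m} - {i} - {Suc i} = {1..m} - {i, Suc i}" by blast
  finally show ?thesis by (simp add: mult.assoc)
qed

text \<open>Every dominant permutation is reached from the longest element by divided differences that
  lower one exponent at a time.\<close>

lemma groth_dominant:
  fixes x :: "nat \<Rightarrow> real"
  assumes "w permutes {1..m}" "\<And>i. 1 \<le> i \<Longrightarrow> code w (Suc i) \<le> code w i" "generic_point b x"
  shows "groth b x m w = (\<Prod>i\<in>{1..m}. x i ^ code w i)"
  using assms
proof (induction "(\<Sum>i<Suc m. m - i) - perm_len m w" arbitrary: w x rule: less_induct)
  case less
  note w = less.prems(1) and dom = less.prems(2) and x = less.prems(3)
  show ?case
  proof (cases "\<exists>i. 1 \<le> i \<and> i < m \<and> code w i = code w (Suc i)")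
    case False
    then have dec: "code w (Suc i) < code w i" if "1 \<le> i" "i < m" for i
      using dom[OF that(1)] that by fastforce
    have ge: "m - i \<le> code w i" if "1 \<le> i" "i \<le> m" for i
      using that(2,1)
    proof (induction i rule: inc_induct)
      case (step i)
      then show ?case using dec[of i] by simp
    qed simp
    have eq: "code w i = m - i" if "1 \<le> i" "i \<le> m" for i
      using ge[OF that] code_le[OF w that(2)] by simp
    have "(\<Prod>i\<in>{1..m}. x i ^ code w i) = (\<Prod>i\<in>{1..<m}. x i ^ (m - i))"
      by (rule prod.mono_neutral_cong_right) (auto simp: eq)
    then show ?thesis using groth_longest[OF w eq] by simp
  next
    case True
    \<comment> \<open>The least such i is chosen because the code drops strictly before it: raising
      the entry at i by one keeps the code weakly decreasing.\<close>
    define i where "i = (LEAST i. 1 \<le> i \<and> i < m \<and> code w i = code w (Suc i))"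
    have i: "1 \<le> i" "i < m" "code w i = code w (Suc i)" using LeastI_ex[OF True] by (auto simp: i_def)
    have least: "code w j \<noteq> code w (Suc j)" if "1 \<le> j" "j < i" for j
      using not_less_Least[of j "\<lambda>i. 1 \<le> i \<and> i < m \<and> code w i = code w (Suc i)"] that i
      by (auto simp: i_def)
    have inj: "inj w" using w by (rule permutes_inj)
    have asc: "w i < w (Suc i)" using ascent_iff_code_le[OF inj] i by simp
    let ?v = "rswap w i"
    have v: "?v permutes {1..m}" using w i by (simp add: permutes_rswap_iff)
    have cv: "code ?v j = (if j = i then Suc (code w i) else code w j)" for j
      using code_swap[OF inj asc, of j] i(3) by simp
    have domv: "code ?v (Suc j) \<le> code ?v j" if "1 \<le> j" for j
      using dom[OF that] least[OF that] by (cases "Suc j = i") (auto simp: cv)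
    have "(\<Sum>j<Suc m. code ?v j) \<le> (\<Sum>j<Suc m. m - j)"
      by (rule sum_mono) (use code_le[OF v] in auto)
    then have "perm_len m ?v \<le> (\<Sum>j<Suc m. m - j)" by (simp only: perm_len_def)
    then have meas: "(\<Sum>i<Suc m. m - i) - perm_len m ?v < (\<Sum>i<Suc m. m - i) - perm_len m w"
      using perm_len_ascent[OF inj i(2) asc] by linarith
    let ?y = "x \<circ> transpose i (Suc i)"
    have y: "generic_point b ?y" using x by (rule generic_point_transpose)
    define c where "c = code w i"
    define P where "P = (\<Prod>j\<in>{1..m} - {i, Suc i}. x j ^ code w j)"
    have Px: "(\<Prod>j\<in>{1..m} - {i, Suc i}. x j ^ code ?v j) = P"
      unfolding P_def by (rule prod.cong) (auto simp: cv)
    have Py: "(\<Prod>j\<in>{1..m} - {i, Suc i}. ?y j ^ code ?v j) = P"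
      unfolding P_def by (rule prod.cong) (auto simp: cv transpose_def)
    have gx: "groth b x m ?v = x i ^ Suc c * x (Suc i) ^ c * P"
      using less.hyps[OF meas v domv x, unfolded prod_split_adjacent[OF i(1,2)] Px] i
      by (simp add: cv c_def)
    have gy: "groth b ?y m ?v = x (Suc i) ^ Suc c * x i ^ c * P"
      using less.hyps[OF meas v domv y, unfolded prod_split_adjacent[OF i(1,2)] Py] i
      by (simp add: cv c_def)
    have gw: "(\<Prod>j\<in>{1..m}. x j ^ code w j) = x i ^ c * x (Suc i) ^ c * P"
      unfolding prod_split_adjacent[OF i(1,2)] using i by (simp add: c_def P_def)
    \<comment> \<open>In the difference (1 + b x_{i+1}) x_i^{c+1} x_{i+1}^c - (1 + b x_i)
      x_{i+1}^{c+1} x_i^c the terms with b cancel.\<close>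
    have "(x i - x (Suc i)) * groth b x m w = (x i - x (Suc i)) * (x i ^ c * x (Suc i) ^ c * P)"
      using groth_divided_difference[where b = b and x = x and w = w, OF i(1,2) _ _ asc]
        generic_pointD(1)[OF x]
      unfolding gx gy by (simp add: algebra_simps)
    then show ?thesis using generic_pointD(2)[OF x, of i "Suc i"] unfolding gw by simp
  qed
qed

section \<open>A determinantal formula\<close>

text \<open>The three matrices have the same cofactors along row i. The coefficient a on the left
  lets the divided difference identity be used with its denominator cleared.\<close>

lemma det_row_linear:
  fixes F G H :: "nat \<Rightarrow> nat \<Rightarrow> 'a::comm_ring_1"
  assumes "i < n"
    and "\<And>l j. l < n \<Longrightarrow> l \<noteq> i \<Longrightarrow> j < n \<Longrightarrow> F l j = G l j"
    and "\<And>l j. l < n \<Longrightarrow> l \<noteq> i \<Longrightarrow> j < n \<Longrightarrow> F l j = H l j"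
    and "\<And>j. j < n \<Longrightarrow> a * F i j = c * G i j + d * H i j"
  shows "a * det (mat n n (\<lambda>(i, j). F i j)) =
    c * det (mat n n (\<lambda>(i, j). G i j)) + d * det (mat n n (\<lambda>(i, j). H i j))"
proof -
  define C where "C = cofactor (mat n n (\<lambda>(i, j). F i j)) i"
  have exp: "det (mat n n (\<lambda>(i, j). K i j)) = (\<Sum>j<n. K i j * C j)"
    if "\<And>l j. l < n \<Longrightarrow> l \<noteq> i \<Longrightarrow> j < n \<Longrightarrow> F l j = K l j" for K
  proof -
    have "mat_delete (mat n n (\<lambda>(i, j). K i j)) i j = mat_delete (mat n n (\<lambda>(i, j). F i j)) i j" for j
      unfolding mat_delete_def using that assms(1) by (intro eq_matI) auto
    then have "cofactor (mat n n (\<lambda>(i, j). K i j)) i j = C j" for j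
      by (simp add: cofactor_def C_def)
    then show ?thesis
      using laplace_expansion_row[of "mat n n (\<lambda>(i, j). K i j)" n i] assms(1) by simp
  qed
  have "a * (F i j * C j) = c * (G i j * C j) + d * (H i j * C j)" if "j < n" for j
    using assms(4)[OF that] by (metis (no_types) distrib_right mult.assoc)
  then have "(\<Sum>j<n. a * (F i j * C j)) = (\<Sum>j<n. c * (G i j * C j) + d * (H i j * C j))"
    by (intro sum.cong) auto
  then show ?thesis
    using exp[of F] exp[of G] exp[of H] assms(2,3) by (simp add: sum.distrib sum_distrib_left)
qed

lemma det_lower_triangular_mat:
  fixes F :: "nat \<Rightarrow> nat \<Rightarrow> 'a::idom"
  assumes "\<And>i j. i < j \<Longrightarrow> j < n \<Longrightarrow> F i j = 0"
  shows "det (mat n n (\<lambda>(i, j). F i j)) = (\<Prod>i<n. F i i)"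
proof -
  have "det (mat n n (\<lambda>(i, j). F i j)) = prod_list (diag_mat (mat n n (\<lambda>(i, j). F i j)))"
    by (rule det_lower_triangular[of n]) (use assms in auto)
  also have "diag_mat (mat n n (\<lambda>(i, j). F i j)) = map (\<lambda>i. F i i) [0..<n]"
    by (simp add: diag_mat_def)
  finally show ?thesis by (simp add: prod.distinct_set_conv_list[symmetric] atLeast0LessThan)
qed

text \<open>Column operations in one step: G is the product of F and T, and T has determinant 1.
  Both orientations of T occur below.\<close>

lemma det_mult_unitriangular:
  fixes F T :: "nat \<Rightarrow> nat \<Rightarrow> 'a::idom"
  assumes "\<And>i j. i < n \<Longrightarrow> j < n \<Longrightarrow> G i j = (\<Sum>l<n. F i l * T l j)"
    and "(\<forall>i j. i < j \<longrightarrow> j < n \<longrightarrow> T i j = 0) \<or> (\<forall>i j. j < i \<longrightarrow> i < n \<longrightarrow> T i j = 0)"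
    and "\<And>i. i < n \<Longrightarrow> T i i = 1"
  shows "det (mat n n (\<lambda>(i, j). G i j)) = det (mat n n (\<lambda>(i, j). F i j))"
proof -
  have T: "det (mat n n (\<lambda>(i, j). T i j)) = 1"
    using assms(2)
  proof
    assume "\<forall>i j. i < j \<longrightarrow> j < n \<longrightarrow> T i j = 0"
    then show ?thesis using assms(3) by (simp add: det_lower_triangular_mat)
  next
    assume up: "\<forall>i j. j < i \<longrightarrow> i < n \<longrightarrow> T i j = 0"
    have "transpose_mat (mat n n (\<lambda>(i, j). T i j)) = mat n n (\<lambda>(i, j). T j i)" by (intro eq_matI) auto
    then have "det (mat n n (\<lambda>(i, j). T i j)) = det (mat n n (\<lambda>(i, j). T j i))"
      using det_transpose[of "mat n n (\<lambda>(i, j). T i j)" n] by simp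
    then show ?thesis using up assms(3) by (simp add: det_lower_triangular_mat)
  qed
  have "mat n n (\<lambda>(i, j). G i j) = mat n n (\<lambda>(i, j). F i j) * mat n n (\<lambda>(i, j). T i j)"
    using assms(1) by (intro eq_matI) (auto simp: scalar_prod_def atLeast0LessThan intro!: sum.cong)
  then show ?thesis using det_mult[of "mat n n (\<lambda>(i, j). F i j)" n "mat n n (\<lambda>(i, j). T i j)"] T by simp
qed

text \<open>For \<open>b = 0\<close> this is the ordinary divided difference of \<open>f\<close> at \<open>x\<^sub>1, \<dots>, x\<^sub>M\<close>.  In general it is the
  result of applying the isobaric operators \<open>\<pi>\<^sub>1, \<dots>, \<pi>\<^sub>M\<^sub>-\<^sub>1\<close> to \<open>f(x\<^sub>1)\<close>.\<close>

definition lagr :: "real \<Rightarrow> (nat \<Rightarrow> real) \<Rightarrow> nat \<Rightarrow> (real \<Rightarrow> real) \<Rightarrow> real" where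
  "lagr b x M f = (\<Sum>r\<in>{1..M}. f (x r) * (\<Prod>s\<in>{1..M} - {r}. (1 + b * x s) / (x r - x s)))"

lemma lagr_permute:
  assumes "p permutes {1..M}"
  shows "lagr b (x \<circ> p) M f = lagr b x M f"
proof -
  have inj: "inj p" and im: "p ` {1..M} = {1..M}"
    using permutes_inj[OF assms] permutes_image[OF assms] by auto
  have "lagr b x M f = (\<Sum>r\<in>{1..M}. f (x (p r)) * (\<Prod>s\<in>{1..M} - {p r}. (1 + b * x s) / (x (p r) - x s)))"
    unfolding lagr_def
    using sum.reindex_bij_betw[OF permutes_imp_bij[OF assms], symmetric] by blast
  also have "\<dots> = (\<Sum>r\<in>{1..M}. f (x (p r)) * (\<Prod>s\<in>{1..M} - {r}. (1 + b * x (p s)) / (x (p r) - x (p s))))"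
  proof (intro sum.cong refl arg_cong2[of _ _ _ _ "(*)"])
    fix r
    have "p ` ({1..M} - {r}) = {1..M} - {p r}" using inj im by (simp add: image_set_diff)
    then have "bij_betw p ({1..M} - {r}) ({1..M} - {p r})"
      using inj_on_subset[OF inj] by (simp add: bij_betw_def)
    from prod.reindex_bij_betw[OF this, symmetric]
    show "(\<Prod>s\<in>{1..M} - {p r}. (1 + b * x s) / (x (p r) - x s)) =
      (\<Prod>s\<in>{1..M} - {r}. (1 + b * x (p s)) / (x (p r) - x (p s)))" by blast
  qed
  finally show ?thesis by (simp add: lagr_def)
qed

lemma lagr_cong:
  assumes "\<And>r. 1 \<le> r \<Longrightarrow> r \<le> M \<Longrightarrow> x r = y r"
  shows "lagr b x M f = lagr b y M f"
  unfolding lagr_def by (rule sum.cong) (auto simp: assms intro!: prod.cong)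

lemma lagr_Suc:
  "lagr b x (Suc M) f =
    (\<Sum>r\<in>{1..M}. f (x r) * (\<Prod>s\<in>{1..M} - {r}. (1 + b * x s) / (x r - x s)) *
      ((1 + b * x (Suc M)) / (x r - x (Suc M)))) +
    f (x (Suc M)) * (\<Prod>s\<in>{1..M}. (1 + b * x s) / (x (Suc M) - x s))"
proof -
  have S: "{1..Suc M} = insert (Suc M) {1..M}" by auto
  have 1: "{1..Suc M} - {Suc M} = {1..M}" by auto
  have 2: "(\<Prod>s\<in>{1..Suc M} - {r}. (1 + b * x s) / (x r - x s)) =
      (\<Prod>s\<in>{1..M} - {r}. (1 + b * x s) / (x r - x s)) * ((1 + b * x (Suc M)) / (x r - x (Suc M)))"
    if "r \<in> {1..M}" for r
  proof -
    have "{1..Suc M} - {r} = insert (Suc M) ({1..M} - {r})" using that by auto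
    then show ?thesis by (simp add: mult.commute)
  qed
  have "lagr b x (Suc M) f =
    f (x (Suc M)) * (\<Prod>s\<in>{1..Suc M} - {Suc M}. (1 + b * x s) / (x (Suc M) - x s)) +
    (\<Sum>r\<in>{1..M}. f (x r) * (\<Prod>s\<in>{1..Suc M} - {r}. (1 + b * x s) / (x r - x s)))"
    unfolding lagr_def S by (subst sum.insert) auto
  also have "(\<Sum>r\<in>{1..M}. f (x r) * (\<Prod>s\<in>{1..Suc M} - {r}. (1 + b * x s) / (x r - x s))) =
    (\<Sum>r\<in>{1..M}. f (x r) * (\<Prod>s\<in>{1..M} - {r}. (1 + b * x s) / (x r - x s)) *
      ((1 + b * x (Suc M)) / (x r - x (Suc M))))"
    by (rule sum.cong) (simp_all only: 2 mult.assoc)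
  finally show ?thesis unfolding 1 by simp
qed

text \<open>The contributions of each point are compared. For the first M - 1 points the identity is
  the partial fraction expansion of 1 / ((X - u) (X - v)); each of the last two points occurs in
  only one term on the right.\<close>

lemma lagr_divided_difference:
  assumes inj: "inj x" and M: "1 \<le> M"
  shows "(x M - x (Suc M)) * lagr b x (Suc M) f =
    (1 + b * x (Suc M)) * lagr b x M f - (1 + b * x M) * lagr b (x \<circ> transpose M (Suc M)) M f"
proof -
  obtain K where K: "M = Suc K" using M by (cases M) auto
  let ?y = "x \<circ> transpose M (Suc M)"
  define P where "P = (\<lambda>r. \<Prod>s\<in>{1..K} - {r}. (1 + b * x s) / (x r - x s))"
  define u v where "u = x M" and "v = x (Suc M)"
  have y: "?y r = x r" if "r \<le> K" for r using that K by (simp add: transpose_def)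
  have yM: "?y M = v" "?y (Suc M) = u" by (simp_all add: u_def v_def)
  have uv: "u \<noteq> v" using injD[OF inj, of M "Suc M"] by (auto simp: u_def v_def)
  have ne: "x r \<noteq> u" "x r \<noteq> v" if "r \<in> {1..K}" for r
    using injD[OF inj, of r M] injD[OF inj, of r "Suc M"] that K by (auto simp: u_def v_def)
  define R where "R = (\<lambda>c. \<Prod>s\<in>{1..K}. (1 + b * x s) / (c - x s))"
  have Py: "(\<Prod>s\<in>{1..K} - {r}. (1 + b * ?y s) / (?y r - ?y s)) = P r" if "r \<in> {1..K}" for r
    unfolding P_def by (rule prod.cong) (use y that in auto)
  have Ly: "lagr b ?y M f = (\<Sum>r\<in>{1..K}. f (x r) * P r * ((1 + b * v) / (x r - v))) + f v * R v"
  proof -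
    have "(\<Sum>r\<in>{1..K}. f (?y r) * (\<Prod>s\<in>{1..K} - {r}. (1 + b * ?y s) / (?y r - ?y s)) *
        ((1 + b * ?y M) / (?y r - ?y M))) = (\<Sum>r\<in>{1..K}. f (x r) * P r * ((1 + b * v) / (x r - v)))"
      by (rule sum.cong) (use Py y yM in auto)
    moreover have "(\<Prod>s\<in>{1..K}. (1 + b * ?y s) / (?y M - ?y s)) = R v"
      unfolding R_def by (rule prod.cong) (use y yM in auto)
    ultimately show ?thesis using lagr_Suc[of b ?y K f] yM unfolding K[symmetric] by simp
  qed
  have Lx: "lagr b x M f = (\<Sum>r\<in>{1..K}. f (x r) * P r * ((1 + b * u) / (x r - u))) + f u * R u"
    using lagr_Suc[of b x K f] unfolding K[symmetric] P_def R_def u_def by simp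
  have LS: "lagr b x (Suc M) f =
      (\<Sum>r\<in>{1..K}. f (x r) * P r * ((1 + b * u) / (x r - u)) * ((1 + b * v) / (x r - v))) +
      f u * R u * ((1 + b * v) / (u - v)) + f v * (R v * ((1 + b * u) / (v - u)))"
  proof -
    have S: "{1..M} = insert M {1..K}" using K by auto
    have "(\<Prod>s\<in>insert M {1..K} - {r}. (1 + b * x s) / (x r - x s)) = P r * ((1 + b * u) / (x r - u))"
      if "r \<in> {1..K}" for r
    proof -
      have "insert M {1..K} - {r} = insert M ({1..K} - {r})" using that K by auto
      moreover have "M \<notin> {1..K} - {r}" using K by auto
      ultimately show ?thesis by (simp add: P_def u_def mult.commute)
    qed
    moreover have "insert M {1..K} - {M} = {1..K}" using K by auto
    moreover have "(\<Prod>s\<in>insert M {1..K}. (1 + b * x s) / (v - x s)) = R v * ((1 + b * u) / (v - u))"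
      using K unfolding R_def u_def by (simp add: mult.commute)
    moreover have "(\<Prod>s\<in>{1..K}. (1 + b * x s) / (c - x s)) = R c" for c by (simp add: R_def)
    moreover have "x M = u" by (simp add: u_def)
    moreover have "M \<notin> {1..K}" using K by auto
    ultimately show ?thesis
      unfolding lagr_Suc[of b x M f] v_def[symmetric] unfolding S by (simp add: mult.assoc)
  qed
  have "(u - v) * (\<Sum>r\<in>{1..K}. f (x r) * P r * ((1 + b * u) / (x r - u)) * ((1 + b * v) / (x r - v))) =
    (1 + b * v) * (\<Sum>r\<in>{1..K}. f (x r) * P r * ((1 + b * u) / (x r - u))) -
    (1 + b * u) * (\<Sum>r\<in>{1..K}. f (x r) * P r * ((1 + b * v) / (x r - v)))"
    unfolding sum_distrib_left sum_subtractf[symmetric]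
  proof (rule sum.cong)
    fix r assume "r \<in> {1..K}"
    then have "x r - u \<noteq> 0" "x r - v \<noteq> 0" using ne by auto
    then show "(u - v) * (f (x r) * P r * ((1 + b * u) / (x r - u)) * ((1 + b * v) / (x r - v))) =
      (1 + b * v) * (f (x r) * P r * ((1 + b * u) / (x r - u))) -
      (1 + b * u) * (f (x r) * P r * ((1 + b * v) / (x r - v)))"
      by (simp add: divide_simps) (simp add: algebra_simps)
  qed simp
  moreover have "(u - v) * (f u * R u * ((1 + b * v) / (u - v))) = (1 + b * v) * (f u * R u)"
    using uv by simp
  moreover have "(u - v) * (f v * (R v * ((1 + b * u) / (v - u)))) = - ((1 + b * u) * (f v * R v))"
    using uv by (simp add: divide_simps) (simp add: algebra_simps)
  ultimately show ?thesis
    unfolding u_def[symmetric] v_def[symmetric] Lx Ly LS by (simp add: algebra_simps)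
qed

lemma lagr_sum: "lagr b x M (\<lambda>y. \<Sum>l\<in>A. c l * f l y) = (\<Sum>l\<in>A. c l * lagr b x M (f l))"
proof -
  have "lagr b x M (\<lambda>y. \<Sum>l\<in>A. c l * f l y) = (\<Sum>r\<in>{1..M}. \<Sum>l\<in>A.
      c l * (f l (x r) * (\<Prod>s\<in>{1..M} - {r}. (1 + b * x s) / (x r - x s))))"
    by (simp add: lagr_def sum_distrib_right mult.assoc)
  also have "\<dots> = (\<Sum>l\<in>A. \<Sum>r\<in>{1..M}.
      c l * (f l (x r) * (\<Prod>s\<in>{1..M} - {r}. (1 + b * x s) / (x r - x s))))"
    by (rule sum.swap)
  finally show ?thesis by (simp add: lagr_def sum_distrib_left)
qed

text \<open>The coefficients of a power in Newton's interpolation basis: \<open>newton z l j\<close>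
  is the complete homogeneous symmetric polynomial of degree j - l in z_1, ..., z_{l+1}, and 0 for j
  < l.\<close>

fun newton :: "(nat \<Rightarrow> real) \<Rightarrow> nat \<Rightarrow> nat \<Rightarrow> real" where
  "newton z l 0 = (if l = 0 then 1 else 0)"
| "newton z l (Suc j) = z (Suc l) * newton z l j + (if l = 0 then 0 else newton z (l - 1) j)"

lemma newton_eq_0: "j < l \<Longrightarrow> newton z l j = 0"
  by (induction j arbitrary: l) auto

lemma newton_diag: "newton z l l = 1"
  by (induction l) (auto simp: newton_eq_0)

lemma newton_expansion:
  "j < n \<Longrightarrow> y ^ j = (\<Sum>l<n. newton z l j * (\<Prod>s\<in>{1..l}. y - z s))"
proof (induction j)
  case 0
  have "(\<Sum>l<n. newton z l 0 * (\<Prod>s\<in>{1..l}. y - z s)) =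
      (\<Sum>l<n. if l = 0 then (\<Prod>s\<in>{1..l}. y - z s) else 0)" by (rule sum.cong) auto
  then show ?case using 0 by simp
next
  case (Suc j)
  define P where "P = (\<lambda>l. \<Prod>s\<in>{1..l}. y - z s)"
  have PS: "P (Suc l) = P l * (y - z (Suc l))" for l
    by (simp add: P_def atLeastAtMostSuc_conv mult.commute)
  obtain n' where n: "n = Suc n'" using Suc.prems by (cases n) auto
  have last: "newton z n' j = 0" using Suc.prems n by (intro newton_eq_0) simp
  have "y ^ Suc j = (\<Sum>l<n. newton z l j * (y * P l))"
    using Suc by (simp add: P_def sum_distrib_left mult_ac)
  also have "\<dots> = (\<Sum>l<n. z (Suc l) * newton z l j * P l) + (\<Sum>l<n. newton z l j * P (Suc l))"
    by (simp add: PS sum.distrib[symmetric] algebra_simps)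
  also have "(\<Sum>l<n. newton z l j * P (Suc l)) = (\<Sum>l<n'. newton z l j * P (Suc l))"
    by (simp add: n last)
  also have "\<dots> = (\<Sum>l<n. (if l = 0 then 0 else newton z (l - 1) j) * P l)"
    unfolding n sum.lessThan_Suc_shift by simp
  finally show ?case by (simp add: P_def sum.distrib[symmetric] algebra_simps)
qed

text \<open>This is y^{a+j} (1 + b y)^{i-j}, written as a quotient because i - j may be negative. In
  t = y / (1 + b y), column j carries the factor t^j and the rest depends only on the row.\<close>

definition flag_fun :: "real \<Rightarrow> nat \<Rightarrow> nat \<Rightarrow> nat \<Rightarrow> real \<Rightarrow> real" where
  "flag_fun b a i j y = y ^ (a + j) * (1 + b * y) ^ i / (1 + b * y) ^ j"

text \<open>Column operations replace t^j by the Newton products over z_1, ..., z_l. Column l then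
  vanishes at the first l points, and row i sees only the first i + 1 points, so the matrix is lower
  triangular and each diagonal entry comes from a single point.\<close>

lemma det_lagr_dominant:
  assumes x: "generic_point b x"
  shows "det (mat n n (\<lambda>(i, j). lagr b x (Suc i) (flag_fun b (a i) i j))) = (\<Prod>i<n. x (Suc i) ^ a i)"
proof -
  define z where "z = (\<lambda>r. x r / (1 + b * x r))"
  define g where "g = (\<lambda>i l y. y ^ a i * (1 + b * y) ^ i * (\<Prod>s\<in>{1..l}. y / (1 + b * y) - z s))"
  define L where "L = (\<lambda>i l. lagr b x (Suc i) (g i l))"
  note nz = generic_pointD(1)[OF x] and ne = generic_pointD(2)[OF x]
  have zdiff: "z r - z s = (x r - x s) / ((1 + b * x r) * (1 + b * x s))" for r s
    using nz[of r] nz[of s] unfolding z_def by (simp add: divide_simps) (simp add: algebra_simps)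
  have G: "lagr b x (Suc i) (flag_fun b (a i) i j) = (\<Sum>l<n. L i l * newton z l j)" if "j < n" for i j
  proof -
    have "flag_fun b (a i) i j y = (\<Sum>l<n. newton z l j * g i l y)" for y
    proof -
      have "flag_fun b (a i) i j y = y ^ a i * (1 + b * y) ^ i * (y / (1 + b * y)) ^ j"
        by (simp add: flag_fun_def power_add power_divide)
      then show ?thesis
        unfolding newton_expansion[OF that, of "y / (1 + b * y)" z] g_def
        by (simp add: sum_distrib_left mult_ac)
    qed
    then have "lagr b x (Suc i) (flag_fun b (a i) i j) = lagr b x (Suc i) (\<lambda>y. \<Sum>l<n. newton z l j * g i l y)"
      by presburger
    then show ?thesis unfolding lagr_sum L_def by (simp add: mult.commute)
  qed
  have vanish: "g i l (x r) = 0" if "r \<in> {1..l}" for i l r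
    using that by (auto simp: g_def z_def)
  have L0: "L i l = 0" if "i < l" for i l
    unfolding L_def lagr_def using that by (intro sum.neutral) (auto intro!: vanish)
  have Ld: "L i i = x (Suc i) ^ a i" for i
  proof -
    have "L i i = (\<Sum>r\<in>{Suc i}. g i i (x r) * (\<Prod>s\<in>{1..Suc i} - {r}. (1 + b * x s) / (x r - x s)))"
      unfolding L_def lagr_def by (rule sum.mono_neutral_right) (auto intro!: vanish)
    also have "\<dots> = g i i (x (Suc i)) * (\<Prod>s\<in>{1..i}. (1 + b * x s) / (x (Suc i) - x s))"
    proof -
      have "{1..Suc i} - {Suc i} = {1..i}" by auto
      then show ?thesis by simp
    qed
    also have "\<dots> = x (Suc i) ^ a i * (1 + b * x (Suc i)) ^ i *
      (\<Prod>s\<in>{1..i}. (z (Suc i) - z s) * ((1 + b * x s) / (x (Suc i) - x s)))"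
      unfolding g_def z_def[symmetric] prod.distrib by (simp add: z_def)
    also have "(\<Prod>s\<in>{1..i}. (z (Suc i) - z s) * ((1 + b * x s) / (x (Suc i) - x s))) =
        (\<Prod>s\<in>{1..i}. 1 / (1 + b * x (Suc i)))"
    proof (rule prod.cong)
      fix s assume "s \<in> {1..i}"
      then have "x (Suc i) - x s \<noteq> 0" using ne[of "Suc i" s] by auto
      then show "(z (Suc i) - z s) * ((1 + b * x s) / (x (Suc i) - x s)) = 1 / (1 + b * x (Suc i))"
        unfolding zdiff using nz[of s] nz[of "Suc i"] by (simp add: divide_simps)
    qed simp
    finally show ?thesis using nz[of "Suc i"] by (simp add: power_divide)
  qed
  have "det (mat n n (\<lambda>(i, j). lagr b x (Suc i) (flag_fun b (a i) i j))) = det (mat n n (\<lambda>(i, j). L i j))"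
    by (rule det_mult_unitriangular[where T = "newton z"]) (auto simp: G newton_eq_0 newton_diag)
  also have "\<dots> = (\<Prod>i<n. L i i)" by (rule det_lower_triangular_mat) (rule L0)
  finally show ?thesis by (simp add: Ld)
qed

text \<open>An induction over all intermediate positions of the code entries: \<phi> records where
  the entries stand, and the entry in row i has lost one unit for each place travelled from i + 1.
  The bound on \<phi> keeps the subtraction from being truncated.\<close>

lemma groth_flagged_det:
  fixes lam \<phi> :: "nat \<Rightarrow> nat"
  assumes lam: "\<And>i. Suc i < n \<Longrightarrow> lam (Suc i) \<le> lam i"
    and "\<And>i j. i < j \<Longrightarrow> j < n \<Longrightarrow> \<phi> i < \<phi> j"
    and "\<And>i. i < n \<Longrightarrow> Suc i \<le> \<phi> i \<and> \<phi> i \<le> k + Suc i"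
    and "w permutes {1..m}"
    and "\<And>i. i < n \<Longrightarrow> code w (\<phi> i) = lam i + k + Suc i - \<phi> i"
    and "\<And>j. j \<notin> \<phi> ` {..<n} \<Longrightarrow> code w j = 0"
    and "generic_point b x"
  shows "groth b x m w = det (mat n n (\<lambda>(i, j). lagr b x (\<phi> i) (flag_fun b (lam i + k) i j)))"
  using assms(2-)
proof (induction "\<Sum>i<n. \<phi> i" arbitrary: \<phi> w m x rule: less_induct)
  case less
  note mono = less.prems(1) and bd = less.prems(2) and w = less.prems(3) and c = less.prems(4)
    and c0 = less.prems(5) and x = less.prems(6)
  show ?case
  proof (cases "\<exists>i<n. \<phi> i \<noteq> Suc i")
    case False
    then have \<phi>: "\<phi> i = Suc i" if "i < n" for i using that by blast
    have cS: "code w (Suc i) = (if i < n then lam i + k else 0)" for i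
      using c[of i] c0[of "Suc i"] \<phi> by auto
    have dom: "code w (Suc i) \<le> code w i" if "1 \<le> i" for i
      using that lam[of "i - 1"] cS[of "i - 1"] cS[of i] by (cases i) auto
    have "groth b x m w = (\<Prod>i\<in>{1..m}. x i ^ code w i)" by (rule groth_dominant[OF w dom x])
    also have "\<dots> = (\<Prod>i\<in>{1..max m n}. x i ^ code w i)"
      by (rule prod.mono_neutral_left) (auto simp: code_eq_0_outside[OF w])
    also have "\<dots> = (\<Prod>i\<in>{1..n}. x i ^ code w i)"
    proof (rule prod.mono_neutral_right)
      show "\<forall>i\<in>{1..max m n} - {1..n}. x i ^ code w i = 1"
      proof
        fix i assume "i \<in> {1..max m n} - {1..n}"
        then show "x i ^ code w i = 1" using cS[of "i - 1"] by (cases i) auto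
      qed
    qed auto
    also have "\<dots> = (\<Prod>i<n. x (Suc i) ^ (lam i + k))"
      using prod.atLeast1_atMost_eq[of "\<lambda>i. x i ^ code w i" n] by (simp add: cS)
    also have "\<dots> = det (mat n n (\<lambda>(i, j). lagr b x (Suc i) (flag_fun b (lam i + k) i j)))"
      by (rule det_lagr_dominant[OF x, symmetric])
    also have "mat n n (\<lambda>(i, j). lagr b x (Suc i) (flag_fun b (lam i + k) i j)) =
        mat n n (\<lambda>(i, j). lagr b x (\<phi> i) (flag_fun b (lam i + k) i j))"
      by (intro eq_matI) (auto simp: \<phi>)
    finally show ?thesis .
  next
    case True
    \<comment> \<open>Undoing the moves, the first entry that has left its start goes back one
      place; earlier entries are at their starts and later ones lie further right, so place \<mu> is
      free.\<close>
    define i where "i = (LEAST i. i < n \<and> \<phi> i \<noteq> Suc i)"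
    have i: "i < n" "\<phi> i \<noteq> Suc i" using LeastI_ex[OF True] by (auto simp: i_def)
    have least: "\<phi> l = Suc l" if "l < i" for l
      using not_less_Least[of l "\<lambda>i. i < n \<and> \<phi> i \<noteq> Suc i"] that i by (auto simp: i_def)
    define \<mu> where "\<mu> = \<phi> i - 1"
    have \<mu>: "\<phi> i = Suc \<mu>" "Suc i \<le> \<mu>" "\<mu> \<le> k + i"
      using bd[OF i(1)] i(2) by (auto simp: \<mu>_def)
    define \<psi> where "\<psi> = \<phi>(i := \<mu>)"
    have \<psi>_less: "(\<Sum>l<n. \<psi> l) < (\<Sum>l<n. \<phi> l)"
      by (rule sum_strict_mono_ex1) (use i \<mu> in \<open>auto simp: \<psi>_def\<close>)
    have \<psi>_mono: "\<psi> l < \<psi> j" if "l < j" "j < n" for l j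
      using mono[OF that] least[of l] mono[of i j] that \<mu> by (auto simp: \<psi>_def)
    have \<psi>_bd: "Suc l \<le> \<psi> l \<and> \<psi> l \<le> k + Suc l" if "l < n" for l
      using bd[OF that] \<mu> by (auto simp: \<psi>_def)
    have notin: "\<mu> \<noteq> \<phi> l" if "l < n" for l
      using least[of l] mono[of i l] that \<mu> by (cases l i rule: linorder_cases) auto
    have c\<mu>: "code w \<mu> = 0" using c0[of \<mu>] notin by blast
    have inj: "inj w" using w by (rule permutes_inj)
    have asc: "w \<mu> < w (Suc \<mu>)" using ascent_iff_code_le[OF inj] c\<mu> by simp
    \<comment> \<open>The swap at \<mu> needs position \<mu> + 1 inside the symmetric group;
      stability undoes the enlargement at the end.\<close>
    define M where "M = max m (Suc \<mu>)"
    have \<mu>M: "\<mu> < M" by (simp add: M_def)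
    have wM: "w permutes {1..M}" by (rule permutes_subset[OF w]) (auto simp: M_def)
    let ?v = "rswap w \<mu>"
    have v: "?v permutes {1..M}" using wM \<mu>(2) by (simp add: permutes_rswap_iff M_def)
    have cv: "code ?v j = (if j = \<mu> then lam i + k + Suc i - \<mu> else if j = Suc \<mu> then 0 else code w j)" for j
      using code_swap[OF inj asc, of j] c\<mu> c[OF i(1)] \<mu> by (auto simp: Suc_diff_le)
    have cv1: "code ?v (\<psi> l) = lam l + k + Suc l - \<psi> l" if "l < n" for l
      using c[OF that] notin[OF that] mono[of l i] mono[of i l] that i \<mu>
      by (cases l i rule: linorder_cases) (auto simp: \<psi>_def cv)
    have cv0: "code ?v j = 0" if "j \<notin> \<psi> ` {..<n}" for j
    proof -
      have "\<mu> \<in> \<psi> ` {..<n}" using i by (auto simp: \<psi>_def image_iff intro!: bexI[of _ i])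
      then have "j \<noteq> \<mu>" using that by auto
      moreover have "j \<notin> \<phi> ` {..<n}" if "j \<noteq> Suc \<mu>"
      proof
        assume "j \<in> \<phi> ` {..<n}"
        then obtain l where "l < n" "j = \<phi> l" by auto
        then have "j = \<psi> l" using that \<mu> by (auto simp: \<psi>_def)
        then show False using \<open>l < n\<close> \<open>j \<notin> \<psi> ` {..<n}\<close> by blast
      qed
      ultimately show ?thesis using c0[of j] by (auto simp: cv)
    qed
    let ?y = "x \<circ> transpose \<mu> (Suc \<mu>)"
    have y: "generic_point b ?y" using x by (rule generic_point_transpose)
    let ?f = "\<lambda>l. flag_fun b (lam l + k) l"
    have IH: "groth b u M ?v = det (mat n n (\<lambda>(l, j). lagr b u (\<psi> l) (?f l j)))"
      if "generic_point b u" for u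
      by (rule less.hyps[OF \<psi>_less]) (fact \<psi>_mono \<psi>_bd v cv1 cv0 that)+
    have "(x \<mu> - x (Suc \<mu>)) * det (mat n n (\<lambda>(l, j). lagr b x (\<phi> l) (?f l j))) =
      (1 + b * x (Suc \<mu>)) * det (mat n n (\<lambda>(l, j). lagr b x (\<psi> l) (?f l j))) +
      (- (1 + b * x \<mu>)) * det (mat n n (\<lambda>(l, j). lagr b ?y (\<psi> l) (?f l j)))"
    proof (rule det_row_linear[OF i(1)])
      fix l j assume l: "l < n" "l \<noteq> i" "j < n"
      then show "lagr b x (\<phi> l) (?f l j) = lagr b x (\<psi> l) (?f l j)" by (simp add: \<psi>_def)
      show "lagr b x (\<phi> l) (?f l j) = lagr b ?y (\<psi> l) (?f l j)"
      \<comment> \<open>Earlier rows use only points with index below \<mu>; later rows use both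
        \<mu> and \<mu> + 1 and are symmetric in them.\<close>
      proof (cases "l < i")
        case True
        then have "lagr b x (\<phi> l) (?f l j) = lagr b ?y (\<phi> l) (?f l j)"
          using least[OF True] \<mu> by (intro lagr_cong) (auto simp: transpose_def)
        then show ?thesis using l by (simp add: \<psi>_def)
      next
        case False
        then have "transpose \<mu> (Suc \<mu>) permutes {1..\<phi> l}"
          using mono[of i l] l \<mu> by (intro permutes_swap_id) auto
        then show ?thesis using l lagr_permute by (simp add: \<psi>_def)
      qed
    next
      fix j
      show "(x \<mu> - x (Suc \<mu>)) * lagr b x (\<phi> i) (?f i j) =
        (1 + b * x (Suc \<mu>)) * lagr b x (\<psi> i) (?f i j) + (- (1 + b * x \<mu>)) * lagr b ?y (\<psi> i) (?f i j)"
        using lagr_divided_difference[of x \<mu> b "?f i j"] x \<mu>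
        by (simp add: \<psi>_def generic_point_def algebra_simps)
    qed
    also have "\<dots> = (x \<mu> - x (Suc \<mu>)) * groth b x M w"
      unfolding IH[OF x, symmetric] IH[OF y, symmetric]
      using groth_divided_difference[where b = b and x = x and w = w and m = M and i = \<mu>, OF _ _ _ _ asc]
        generic_pointD(1)[OF x] \<mu> \<mu>M by (simp add: algebra_simps)
    finally have "groth b x M w = det (mat n n (\<lambda>(l, j). lagr b x (\<phi> l) (?f l j)))"
      using generic_pointD(2)[OF x, of \<mu> "Suc \<mu>"] by simp
    moreover have "groth b x M w = groth b x m w" by (rule groth_stable[OF w]) (simp add: M_def)
    ultimately show ?thesis by simp
  qed
qed

section \<open>Generating functions and the limit at equal variables\<close>

definition geo_fps :: "'a::comm_ring_1 \<Rightarrow> 'a fps" where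
  "geo_fps b = Abs_fps (\<lambda>n. b ^ n)"

lemma geo_fps_inverse: "(1 - fps_const b * fps_X) * geo_fps b = 1"
proof (rule fps_ext)
  fix n
  show "fps_nth ((1 - fps_const b * fps_X) * geo_fps b) n = fps_nth 1 n"
    by (cases n) (simp_all add: geo_fps_def left_diff_distrib mult.assoc)
qed

text \<open>The series (1 + X)^A / (1 - b X)^B, over a ring in which b may itself be a
  polynomial.\<close>

definition wfps :: "'a::comm_ring_1 \<Rightarrow> nat \<Rightarrow> nat \<Rightarrow> 'a fps" where
  "wfps b A B = (1 + fps_X) ^ A * geo_fps b ^ B"

lemma wfps_Suc_left: "fps_nth (wfps b (Suc A) B) M = fps_nth (wfps b A B) M + (if M = 0 then 0 else fps_nth (wfps b A B) (M - 1))"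
proof -
  have "wfps b (Suc A) B = wfps b A B + fps_X * wfps b A B"
    by (simp add: wfps_def algebra_simps)
  then show ?thesis by simp
qed

lemma wfps_Suc_right:
  "fps_nth (wfps b A (Suc B)) M = fps_nth (wfps b A B) M + b * (if M = 0 then 0 else fps_nth (wfps b A (Suc B)) (M - 1))"
proof -
  have "(1 - fps_const b * fps_X) * wfps b A (Suc B) =
      ((1 - fps_const b * fps_X) * geo_fps b) * wfps b A B"
    by (simp add: wfps_def mult_ac)
  then have "(1 - fps_const b * fps_X) * wfps b A (Suc B) = wfps b A B"
    by (simp only: geo_fps_inverse mult_1)
  then have "wfps b A (Suc B) = wfps b A B + fps_const b * (fps_X * wfps b A (Suc B))"
    by (simp add: algebra_simps)
  then have "fps_nth (wfps b A (Suc B)) M = fps_nth (wfps b A B + fps_const b * (fps_X * wfps b A (Suc B))) M" by simp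
  then show ?thesis by simp
qed

text \<open>The Leibniz rule for a linear factor: write y as z_{M+1} + (y - z_{M+1}); the second
  summand cancels the denominator belonging to the last point.\<close>

lemma lagr0_mult:
  assumes "inj z"
  shows "lagr 0 z (Suc M) (\<lambda>y. y * g y) = z (Suc M) * lagr 0 z (Suc M) g + lagr 0 z M g"
proof -
  define P where "P = (\<lambda>r. \<Prod>s\<in>{1..M} - {r}. 1 / (z r - z s))"
  have "z r * g (z r) * P r * (1 / (z r - z (Suc M))) =
      z (Suc M) * (g (z r) * P r * (1 / (z r - z (Suc M)))) + g (z r) * P r" if "r \<in> {1..M}" for r
  proof -
    have "z r - z (Suc M) \<noteq> 0" using injD[OF assms, of r "Suc M"] that by auto
    then show ?thesis by (simp add: divide_simps) (simp add: algebra_simps)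
  qed
  then have "(\<Sum>r\<in>{1..M}. z r * g (z r) * P r * (1 / (z r - z (Suc M)))) =
      z (Suc M) * (\<Sum>r\<in>{1..M}. g (z r) * P r * (1 / (z r - z (Suc M)))) + (\<Sum>r\<in>{1..M}. g (z r) * P r)"
    by (simp add: sum_distrib_left sum.distrib)
  then show ?thesis
    unfolding lagr_Suc lagr_def[of 0 z M] P_def by (simp add: algebra_simps)
qed

lemma lagr0_one:
  assumes "inj z"
  shows "lagr 0 z M (\<lambda>_. 1) = (if M = 1 then 1 else 0)"
  using assms
proof (induction M arbitrary: z)
  case (Suc M)
  show ?case
  proof (cases "M = 0")
    case True
    then show ?thesis by (simp add: lagr_def)
  next
    case False
    define y where "y = z \<circ> transpose M (Suc M)"
    have "inj y" using Suc.prems by (simp add: y_def inj_compose)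
    from Suc.IH[OF this] Suc.IH[OF Suc.prems]
    have "(z M - z (Suc M)) * lagr 0 z (Suc M) (\<lambda>_. 1) = 0"
      using lagr_divided_difference[OF Suc.prems, of M 0 "\<lambda>_. 1"] False
      unfolding y_def[symmetric] by simp
    then show ?thesis using injD[OF Suc.prems, of M "Suc M"] False by auto
  qed
qed (simp add: lagr_def)

text \<open>The limit is a Taylor coefficient of \<open>y\<^sup>A / (1 - b y)\<^sup>B\<close> at \<open>1 / \<beta>\<close>, expressed through the
  coordinate \<open>s\<close> with \<open>y = (1 + s) / \<beta>\<close>.\<close>

lemma tendsto_lagr0:
  fixes z :: "real \<Rightarrow> nat \<Rightarrow> real" and b \<beta> :: real
  assumes inj: "\<forall>\<^sub>F e in F. inj (z e)"
    and nz: "\<forall>\<^sub>F e in F. \<forall>r. 1 - b * z e r \<noteq> 0"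
    and lim: "\<And>r. ((\<lambda>e. z e r) \<longlongrightarrow> 1 / \<beta>) F"
    and \<beta>: "\<beta> = 1 + b" "\<beta> \<noteq> 0"
  shows "((\<lambda>e. lagr 0 (z e) (Suc M) (\<lambda>y. y ^ A / (1 - b * y) ^ B)) \<longlongrightarrow>
    \<beta> ^ B * \<beta> ^ M / \<beta> ^ A * fps_nth (wfps b A B) M) F"
proof (induction B arbitrary: M)
  case 0
  show ?case
  proof (induction A arbitrary: M)
    case 0
    have "\<forall>\<^sub>F e in F. \<beta> ^ 0 * \<beta> ^ M / \<beta> ^ 0 * fps_nth (wfps b 0 0) M =
        lagr 0 (z e) (Suc M) (\<lambda>y. y ^ 0 / (1 - b * y) ^ 0)"
      using inj by eventually_elim (simp add: lagr0_one wfps_def)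
    then show ?case using tendsto_const Lim_transform_eventually by fast
  next
    case (Suc A)
    let ?L = "\<lambda>A M e. lagr 0 (z e) M (\<lambda>y. y ^ A / (1 - b * y) ^ 0)"
    have e: "\<forall>\<^sub>F e in F. z e (Suc M) * ?L A (Suc M) e + ?L A M e = ?L (Suc A) (Suc M) e"
      using inj by eventually_elim (use lagr0_mult[where g = "\<lambda>y. y ^ A"] in simp)
    have 1: "((\<lambda>e. z e (Suc M) * ?L A (Suc M) e) \<longlongrightarrow> 1 / \<beta> * (\<beta> ^ 0 * \<beta> ^ M / \<beta> ^ A * fps_nth (wfps b A 0) M)) F"
      by (intro tendsto_mult lim Suc)
    have 2: "(?L A M \<longlongrightarrow> (if M = 0 then 0 else \<beta> ^ (M - 1) / \<beta> ^ A * fps_nth (wfps b A 0) (M - 1))) F"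
      using Suc[of "M - 1"] by (cases M) (simp_all add: lagr_def)
    have "1 / \<beta> * (\<beta> ^ 0 * \<beta> ^ M / \<beta> ^ A * fps_nth (wfps b A 0) M) +
        (if M = 0 then 0 else \<beta> ^ (M - 1) / \<beta> ^ A * fps_nth (wfps b A 0) (M - 1)) =
      \<beta> ^ 0 * \<beta> ^ M / \<beta> ^ Suc A * fps_nth (wfps b (Suc A) 0) M"
      using \<beta>(2) unfolding wfps_Suc_left by (cases M) (simp_all add: field_simps)
    then show ?case using Lim_transform_eventually[OF tendsto_add[OF 1 2] e] by simp
  qed
next
  case (Suc B)
  let ?L = "\<lambda>B M e. lagr 0 (z e) M (\<lambda>y. y ^ A / (1 - b * y) ^ B)"
  have c: "1 - b * (1 / \<beta>) = 1 / \<beta>" using \<beta> by (simp add: field_simps)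
  \<comment> \<open>The Leibniz rule for (1 - b y) times the function with exponent B + 1, solved
    for the divided difference at M + 1 points. It mirrors the recurrence of
    \<open>wfps\<close>.\<close>
  have e: "\<forall>\<^sub>F e in F. (?L B (Suc M) e + b * ?L (Suc B) M e) / (1 - b * z e (Suc M)) = ?L (Suc B) (Suc M) e" for M
    using inj nz
  proof eventually_elim
    fix e assume i: "inj (z e)" and n: "\<forall>r. 1 - b * z e r \<noteq> 0"
    let ?q = "\<lambda>y. y ^ A / (1 - b * y) ^ Suc B"
    \<comment> \<open>A sum over two indices brings the linear combination into the form to which
      \<open>lagr_sum\<close> applies.\<close>
    have "?L B (Suc M) e = lagr 0 (z e) (Suc M) (\<lambda>y. \<Sum>l<2. (if l = 0 then 1 else - b) *
        (if l = (0::nat) then ?q y else y * ?q y))"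
      unfolding lagr_def
    proof (rule sum.cong)
      fix r
      have "z e r ^ A / (1 - b * z e r) ^ B = (\<Sum>l<2. (if l = 0 then 1 else - b) *
        (if l = (0::nat) then ?q (z e r) else z e r * ?q (z e r)))"
        using spec[OF n, of r] by (simp add: numeral_2_eq_2 divide_simps) (simp add: algebra_simps)
      then show "z e r ^ A / (1 - b * z e r) ^ B * (\<Prod>s\<in>{1..Suc M} - {r}. (1 + 0 * z e s) / (z e r - z e s)) =
        (\<Sum>l<2. (if l = 0 then 1 else - b) * (if l = (0::nat) then ?q (z e r) else z e r * ?q (z e r))) *
        (\<Prod>s\<in>{1..Suc M} - {r}. (1 + 0 * z e s) / (z e r - z e s))" by simp
    qed simp
    also have "\<dots> = lagr 0 (z e) (Suc M) ?q - b * lagr 0 (z e) (Suc M) (\<lambda>y. y * ?q y)"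
      unfolding lagr_sum by (simp add: numeral_2_eq_2)
    finally have "?L B (Suc M) e = (1 - b * z e (Suc M)) * ?L (Suc B) (Suc M) e - b * ?L (Suc B) M e"
      unfolding lagr0_mult[OF i] by (simp add: algebra_simps)
    then show "(?L B (Suc M) e + b * ?L (Suc B) M e) / (1 - b * z e (Suc M)) = ?L (Suc B) (Suc M) e"
      using n by (simp add: divide_simps)
  qed
  have den: "((\<lambda>e. 1 - b * z e r) \<longlongrightarrow> 1 / \<beta>) F" for r
    using tendsto_diff[OF tendsto_const[of 1] tendsto_mult[OF tendsto_const[of b] lim[of r]]] c by simp
  have step: "(?L (Suc B) (Suc M) \<longlongrightarrow> \<beta> ^ Suc B * \<beta> ^ M / \<beta> ^ A * fps_nth (wfps b A (Suc B)) M) F"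
    if l: "(?L (Suc B) M \<longlongrightarrow> l) F"
      "l = (if M = 0 then 0 else \<beta> ^ Suc B * \<beta> ^ (M - 1) / \<beta> ^ A * fps_nth (wfps b A (Suc B)) (M - 1))" for M l
  proof -
    have "((\<lambda>e. (?L B (Suc M) e + b * ?L (Suc B) M e) / (1 - b * z e (Suc M))) \<longlongrightarrow>
      (\<beta> ^ B * \<beta> ^ M / \<beta> ^ A * fps_nth (wfps b A B) M + b * l) / (1 / \<beta>)) F"
      by (intro tendsto_divide tendsto_add tendsto_mult tendsto_const Suc l den) (use \<beta> in simp)
    moreover have "(\<beta> ^ B * \<beta> ^ M / \<beta> ^ A * fps_nth (wfps b A B) M + b * l) / (1 / \<beta>) =
        \<beta> ^ Suc B * \<beta> ^ M / \<beta> ^ A * fps_nth (wfps b A (Suc B)) M"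
      using \<beta>(2) unfolding wfps_Suc_right[of b A B M] l(2) by (cases M) (simp_all add: field_simps)
    ultimately show ?thesis using Lim_transform_eventually[OF _ e[of M]] by simp
  qed
  show ?case
  proof (induction M)
    case 0
    show ?case by (rule step[of 0 0]) (simp_all add: lagr_def)
  next
    case (Suc M)
    show ?case by (rule step[OF Suc]) simp
  qed
qed

lemma det_mat_leibniz:
  "det (mat n n (\<lambda>(i, j). K i j)) =
    (\<Sum>p | p permutes {0..<n}. signof p * (\<Prod>i = 0..<n. K i (p i)))"
proof -
  have "det (mat n n (\<lambda>(i, j). K i j)) =
    (\<Sum>p | p permutes {0..<n}. signof p * (\<Prod>i = 0..<n. mat n n (\<lambda>(i, j). K i j) $$ (i, p i)))"
    by (rule det_def') simp
  also have "\<dots> = (\<Sum>p | p permutes {0..<n}. signof p * (\<Prod>i = 0..<n. K i (p i)))"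
    by (intro sum.cong refl arg_cong2[of _ _ _ _ "(*)"] prod.cong)
       (use permutes_in_image in force)
  finally show ?thesis .
qed

lemma tendsto_det:
  fixes F :: "'c \<Rightarrow> nat \<Rightarrow> nat \<Rightarrow> real"
  assumes "\<And>i j. i < n \<Longrightarrow> j < n \<Longrightarrow> ((\<lambda>e. F e i j) \<longlongrightarrow> F0 i j) G"
  shows "((\<lambda>e. det (mat n n (\<lambda>(i, j). F e i j))) \<longlongrightarrow> det (mat n n (\<lambda>(i, j). F0 i j))) G"
proof -
  show ?thesis
    unfolding det_mat_leibniz
  proof (intro tendsto_sum tendsto_mult tendsto_const tendsto_prod)
    fix p i assume "p \<in> {p. p permutes {0..<n}}" "i \<in> {0..<n}"
    then show "((\<lambda>e. F e i (p i)) \<longlongrightarrow> F0 i (p i)) G"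
      using permutes_in_image[of p "{0..<n}" i] by (intro assms) auto
  qed
qed

lemma tendsto_groth:
  fixes x :: "real \<Rightarrow> nat \<Rightarrow> real"
  assumes "\<And>r. ((\<lambda>e. x e r) \<longlongrightarrow> y r) F"
  shows "((\<lambda>e. groth b (x e) m w) \<longlongrightarrow> groth b y m w) F"
proof -
  have "((\<lambda>e. fold (act_fac b) (map (map_prod (x e) (\<lambda>i. i)) L) (X e) w) \<longlongrightarrow>
      fold (act_fac b) (map (map_prod y (\<lambda>i. i)) L) X0 w) F"
    if "\<And>w. ((\<lambda>e. X e w) \<longlongrightarrow> X0 w) F" for L X X0 w
    using that
  proof (induction L arbitrary: X X0)
    case (Cons f L)
    have "((\<lambda>e. act_fac b (map_prod (x e) (\<lambda>i. i) f) (X e) w) \<longlongrightarrow> act_fac b (map_prod y (\<lambda>i. i) f) X0 w) F" for w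
    proof (cases f)
      case (Pair r i)
      then show ?thesis
        by (cases "w (Suc i) < w i")
           (auto simp: act_fac_apply act_gen_def intro!: tendsto_intros assms Cons.prems)
    qed
    then show ?case
      using Cons.IH[of "\<lambda>e. act_fac b (map_prod (x e) (\<lambda>i. i) f) (X e)" "act_fac b (map_prod y (\<lambda>i. i) f) X0"] by simp
  qed simp
  moreover have "groth_factors m z = map (map_prod z (\<lambda>i. i)) (groth_factors m (\<lambda>i. i))" for z :: "nat \<Rightarrow> real"
    by (simp add: groth_factors_def map_concat comp_def)
  ultimately show ?thesis unfolding groth_def by simp
qed

text \<open>In the new variable a difference is divided by (1 + b x_r) (1 + b x_s). The factor for s
  is the numerator in \<open>lagr\<close>, and the M factors for r form the power in the second
  assumption.\<close>

lemma lagr_change_variable: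
  assumes "\<And>r. 1 + b * x r \<noteq> 0"
    and "\<And>r. f (x r) = g (x r / (1 + b * x r)) * (1 + b * x r) ^ M"
  shows "lagr b x (Suc M) f = lagr 0 (\<lambda>r. x r / (1 + b * x r)) (Suc M) g"
  unfolding lagr_def
proof (rule sum.cong)
  let ?z = "\<lambda>r. x r / (1 + b * x r)"
  fix r assume r: "r \<in> {1..Suc M}"
  have "(1 + b * x r) * ((1 + b * x s) / (x r - x s)) = 1 / (?z r - ?z s)" for s
  proof -
    have "?z r - ?z s = (x r - x s) / ((1 + b * x r) * (1 + b * x s))"
      using assms(1)[of r] assms(1)[of s] by (simp add: divide_simps) (simp add: algebra_simps)
    then show ?thesis by simp
  qed
  then have "(\<Prod>s\<in>{1..Suc M} - {r}. (1 + 0 * ?z s) / (?z r - ?z s)) =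
      (\<Prod>s\<in>{1..Suc M} - {r}. (1 + b * x r) * ((1 + b * x s) / (x r - x s)))" by simp
  also have "\<dots> = (1 + b * x r) ^ M * (\<Prod>s\<in>{1..Suc M} - {r}. (1 + b * x s) / (x r - x s))"
    using r by (simp only: prod.distrib prod_constant) simp
  finally show "f (x r) * (\<Prod>s\<in>{1..Suc M} - {r}. (1 + b * x s) / (x r - x s)) =
      g (?z r) * (\<Prod>s\<in>{1..Suc M} - {r}. (1 + 0 * ?z s) / (?z r - ?z s))"
    unfolding assms(2) by (simp add: mult.assoc)
qed simp

text \<open>Conjugation by a diagonal matrix: the scalars cancel in each Leibniz term.\<close>

lemma det_scale:
  fixes F :: "nat \<Rightarrow> nat \<Rightarrow> real"
  assumes "\<And>i. d i \<noteq> 0"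
  shows "det (mat n n (\<lambda>(i, j). d i / d j * F i j)) = det (mat n n (\<lambda>(i, j). F i j))"
proof -
  have "(\<Prod>i = 0..<n. d i / d (p i) * F i (p i)) = (\<Prod>i = 0..<n. F i (p i))" if "p permutes {0..<n}" for p
  proof -
    have "(\<Prod>i = 0..<n. d (p i)) = (\<Prod>i = 0..<n. d i)"
      by (rule prod.reindex_bij_betw) (rule permutes_imp_bij[OF that])
    then have "(\<Prod>i = 0..<n. d i / d (p i)) = 1"
      using assms by (simp add: prod_dividef)
    then show ?thesis by (simp only: prod.distrib mult_1)
  qed
  then show ?thesis unfolding det_mat_leibniz by (intro sum.cong) auto
qed

lemma fps_nth_pow_binomial:
  "fps_nth ((1 + fps_X) ^ j * F) i = (\<Sum>l\<le>j. of_nat (j choose l) * fps_nth (fps_X ^ l * F) i)"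
  for F :: "'a::comm_ring_1 fps"
proof -
  have "(1 + fps_X) ^ j * F = (\<Sum>l\<le>j. of_nat (j choose l) * (fps_X ^ l * F))"
    unfolding binomial_ring[of fps_X "1 :: 'a fps" j, unfolded add.commute[of fps_X]]
    by (simp add: sum_distrib_right mult.assoc)
  then show ?thesis
    by (simp add: fps_sum_nth fps_of_nat[symmetric] fps_mult_left_const_nth del: fps_of_nat)
qed

text \<open>Expanding (1 + X)^j in powers of X is a unitriangular column operation, the same for
  every row.\<close>

lemma det_binomial_columns:
  fixes Q :: "nat \<Rightarrow> 'a::idom fps"
  shows "det (mat n n (\<lambda>(i, j). fps_nth ((1 + fps_X) ^ j * Q i) (k + i))) =
    det (mat n n (\<lambda>(i, j). fps_nth (fps_X ^ j * Q i) (k + i)))"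
proof (rule det_mult_unitriangular[where T = "\<lambda>l j. of_nat (j choose l)"])
  fix i j assume "j < n"
  have "fps_nth ((1 + fps_X) ^ j * Q i) (k + i) =
      (\<Sum>l\<le>j. of_nat (j choose l) * fps_nth (fps_X ^ l * Q i) (k + i))"
    by (rule fps_nth_pow_binomial)
  also have "\<dots> = (\<Sum>l<n. of_nat (j choose l) * fps_nth (fps_X ^ l * Q i) (k + i))"
    by (rule sum.mono_neutral_left) (use \<open>j < n\<close> in \<open>auto simp: binomial_eq_0\<close>)
  finally show "fps_nth ((1 + fps_X) ^ j * Q i) (k + i) =
      (\<Sum>l<n. fps_nth (fps_X ^ l * Q i) (k + i) * of_nat (j choose l))"
    by (simp add: mult.commute)
qed (auto simp: binomial_eq_0)

lemma groth_at_one: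
  fixes b :: real
  assumes lam: "\<And>i. Suc i < n \<Longrightarrow> lam (Suc i) \<le> lam i" and b: "b > 0"
    and w: "w permutes {1..m}"
    and c: "\<And>i. i < n \<Longrightarrow> code w (k + Suc i) = lam i"
    and c0: "\<And>j. j \<notin> {k + 1..k + n} \<Longrightarrow> code w j = 0"
  shows "groth b (\<lambda>_. 1) m w =
    det (mat n n (\<lambda>(i, j). fps_nth (fps_X ^ j * wfps b (lam i + k) (lam i)) (k + i)))"
proof -
  let ?F = "at_right (0::real)"
  \<comment> \<open>For e > 0 these coordinates are distinct and positive, and they tend to
    1.\<close>
  define x where "x = (\<lambda>(e::real) (r::nat). 1 + e * real r)"
  define \<beta> where "\<beta> = 1 + b"
  have \<beta>: "\<beta> \<noteq> 0" using b by (simp add: \<beta>_def)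
  have pos: "\<forall>\<^sub>F e in ?F. 0 < e" by (simp add: eventually_at_right_less)
  have xpos: "1 + b * x e r \<noteq> 0" if "0 < e" for e r
  proof -
    have "0 \<le> b * x e r" using b that by (simp add: x_def)
    then show ?thesis by linarith
  qed
  have xinj: "inj (x e)" if "0 < e" for e using that by (auto simp: x_def inj_on_def)
  have gen: "generic_point b (x e)" if "0 < e" for e
    using xinj[OF that] xpos[OF that] by (simp add: generic_point_def)
  have xlim: "((\<lambda>e. x e r) \<longlongrightarrow> 1) ?F" for r
  proof -
    have "((\<lambda>e. 1 + e * real r) \<longlongrightarrow> 1 + 0 * real r) ?F" by (intro tendsto_intros)
    then show ?thesis by (simp add: x_def)
  qed
  define z where "z = (\<lambda>e r. x e r / (1 + b * x e r))"
  have zlim: "((\<lambda>e. z e r) \<longlongrightarrow> 1 / \<beta>) ?F" for r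
  proof -
    have "((\<lambda>e. x e r / (1 + b * x e r)) \<longlongrightarrow> 1 / (1 + b * 1)) ?F"
      by (intro tendsto_intros xlim) (use b in simp)
    then show ?thesis by (simp add: z_def \<beta>_def)
  qed
  have znz: "1 - b * z e r = 1 / (1 + b * x e r)" if "0 < e" for e r
    using xpos[OF that, of r] by (simp add: z_def divide_simps)
  have zinj: "inj (z e)" if "0 < e" for e
  proof (rule injI)
    fix r s assume "z e r = z e s"
    then have "x e r = x e s"
      using xpos[OF that, of r] xpos[OF that, of s] by (simp add: z_def divide_simps) (simp add: algebra_simps)
    then show "r = s" using injD[OF xinj[OF that]] by blast
  qed
  have entry: "((\<lambda>e. lagr b (x e) (k + Suc i) (flag_fun b (lam i + k) i j)) \<longlongrightarrow>
      \<beta> ^ i / \<beta> ^ j * fps_nth (wfps b (lam i + k + j) (lam i)) (k + i)) ?F" for i j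
  proof -
    let ?A = "lam i + k + j" and ?B = "lam i"
    have e: "\<forall>\<^sub>F e in ?F. lagr 0 (z e) (Suc (k + i)) (\<lambda>y. y ^ ?A / (1 - b * y) ^ ?B) =
        lagr b (x e) (k + Suc i) (flag_fun b (lam i + k) i j)"
      using pos
    proof eventually_elim
      fix e :: real assume e: "0 < e"
      have "lagr b (x e) (Suc (k + i)) (flag_fun b (lam i + k) i j) =
        lagr 0 (\<lambda>r. x e r / (1 + b * x e r)) (Suc (k + i)) (\<lambda>y. y ^ ?A / (1 - b * y) ^ ?B)"
      proof (rule lagr_change_variable[OF xpos[OF e]])
        fix r
        \<comment> \<open>With z = x / (1 + b x) one has 1 - b z = 1 / (1 + b x), so the exponents
          of 1 + b x add up to i - j.\<close>
        show "flag_fun b (lam i + k) i j (x e r) = (x e r / (1 + b * x e r)) ^ ?A /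
          (1 - b * (x e r / (1 + b * x e r))) ^ ?B * (1 + b * x e r) ^ (k + i)"
          using xpos[OF e, of r] znz[OF e, of r]
          by (simp add: flag_fun_def z_def power_divide power_add divide_simps)
      qed
      then show "lagr 0 (z e) (Suc (k + i)) (\<lambda>y. y ^ ?A / (1 - b * y) ^ ?B) =
        lagr b (x e) (k + Suc i) (flag_fun b (lam i + k) i j)" by (simp add: z_def)
    qed
    have "((\<lambda>e. lagr 0 (z e) (Suc (k + i)) (\<lambda>y. y ^ ?A / (1 - b * y) ^ ?B)) \<longlongrightarrow>
        \<beta> ^ ?B * \<beta> ^ (k + i) / \<beta> ^ ?A * fps_nth (wfps b ?A ?B) (k + i)) ?F"
    proof (rule tendsto_lagr0)
      show "\<forall>\<^sub>F e in ?F. inj (z e)" using pos by eventually_elim (rule zinj)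
      show "\<forall>\<^sub>F e in ?F. \<forall>r. 1 - b * z e r \<noteq> 0"
        using pos by eventually_elim (simp add: znz xpos)
    qed (use zlim \<beta> in \<open>auto simp: \<beta>_def\<close>)
    \<comment> \<open>The powers with \<lambda>_i and k cancel; what remains is a quotient of a row
      factor by a column factor, which \<open>det_scale\<close> removes.\<close>
    moreover have "\<beta> ^ ?B * \<beta> ^ (k + i) / \<beta> ^ ?A = \<beta> ^ i / \<beta> ^ j"
      using \<beta> by (simp add: power_add)
    ultimately show ?thesis using Lim_transform_eventually[OF _ e] by simp
  qed
  have ev: "\<forall>\<^sub>F e in ?F. det (mat n n (\<lambda>(i, j). lagr b (x e) (k + Suc i) (flag_fun b (lam i + k) i j))) =
      groth b (x e) m w"
    using pos
  proof eventually_elim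
    fix e :: real assume "0 < e"
    have im: "(\<lambda>i. k + Suc i) ` {..<n} = {k + 1..k + n}"
    proof -
      have "j \<in> (\<lambda>i. k + Suc i) ` {..<n}" if "j \<in> {k + 1..k + n}" for j
        using that by (intro image_eqI[of _ _ "j - k - 1"]) auto
      then show ?thesis by auto
    qed
    show "det (mat n n (\<lambda>(i, j). lagr b (x e) (k + Suc i) (flag_fun b (lam i + k) i j))) = groth b (x e) m w"
      by (rule groth_flagged_det[where lam = lam and \<phi> = "\<lambda>i. k + Suc i", symmetric])
         (use lam w c c0 im gen[OF \<open>0 < e\<close>] in auto)
  qed
  have "((\<lambda>e. det (mat n n (\<lambda>(i, j). lagr b (x e) (k + Suc i) (flag_fun b (lam i + k) i j)))) \<longlongrightarrow>
      det (mat n n (\<lambda>(i, j). \<beta> ^ i / \<beta> ^ j * fps_nth (wfps b (lam i + k + j) (lam i)) (k + i)))) ?F"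
    by (intro tendsto_det entry)
  then have "((\<lambda>e. groth b (x e) m w) \<longlongrightarrow>
      det (mat n n (\<lambda>(i, j). \<beta> ^ i / \<beta> ^ j * fps_nth (wfps b (lam i + k + j) (lam i)) (k + i)))) ?F"
    using ev by (rule Lim_transform_eventually)
  moreover have "((\<lambda>e. groth b (x e) m w) \<longlongrightarrow> groth b (\<lambda>_. 1) m w) ?F"
    by (rule tendsto_groth[OF xlim])
  ultimately have "groth b (\<lambda>_. 1) m w =
      det (mat n n (\<lambda>(i, j). \<beta> ^ i / \<beta> ^ j * fps_nth (wfps b (lam i + k + j) (lam i)) (k + i)))"
    using tendsto_unique trivial_limit_at_right_real by blast
  also have "\<dots> = det (mat n n (\<lambda>(i, j). fps_nth (wfps b (lam i + k + j) (lam i)) (k + i)))"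
    by (rule det_scale) (simp add: \<beta>)
  also have "\<dots> = det (mat n n (\<lambda>(i, j). fps_nth ((1 + fps_X) ^ j * wfps b (lam i + k) (lam i)) (k + i)))"
    by (simp add: wfps_def power_add mult_ac)
  also have "\<dots> = det (mat n n (\<lambda>(i, j). fps_nth (fps_X ^ j * wfps b (lam i + k) (lam i)) (k + i)))"
    by (rule det_binomial_columns)
  finally show ?thesis .
qed

section \<open>Evaluation of the determinants\<close>

lemma fps_nth_one_plus_X_power:
  "fps_nth ((1 + fps_X) ^ a :: 'a::comm_ring_1 fps) d = of_nat (a choose d)"
proof -
  have "fps_nth ((1 + fps_X) ^ a * 1 :: 'a fps) d = (\<Sum>l\<le>a. of_nat (a choose l) * fps_nth (fps_X ^ l * 1 :: 'a fps) d)"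
    by (rule fps_nth_pow_binomial)
  also have "\<dots> = (\<Sum>l\<le>a. if l = d then of_nat (a choose d) else 0)"
    by (rule sum.cong) (auto simp: fps_X_power_mult_nth)
  finally show ?thesis by (simp add: binomial_eq_0)
qed

lemma det_unit_last_row:
  fixes F :: "nat \<Rightarrow> nat \<Rightarrow> 'a::comm_ring_1"
  assumes "\<And>j. j < n \<Longrightarrow> F n j = 0" "F n n = 1"
  shows "det (mat (Suc n) (Suc n) (\<lambda>(i, j). F i j)) = det (mat n n (\<lambda>(i, j). F i j))"
proof -
  let ?A = "mat (Suc n) (Suc n) (\<lambda>(i, j). F i j)"
  have "det ?A = (\<Sum>j<Suc n. ?A $$ (n, j) * cofactor ?A n j)"
    by (rule laplace_expansion_row) auto
  also have "\<dots> = cofactor ?A n n" using assms by simp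
  also have "mat_delete ?A n n = mat n n (\<lambda>(i, j). F i j)"
    unfolding mat_delete_def by (intro eq_matI) auto
  then have "cofactor ?A n n = det (mat n n (\<lambda>(i, j). F i j))" by (simp add: cofactor_def)
  finally show ?thesis .
qed

lemma wfps_hom:
  assumes "comm_ring_hom h"
  shows "h (fps_nth (wfps b A B) M) = fps_nth (wfps (h b) A B) M"
proof -
  interpret comm_ring_hom h by fact
  have nat: "h (of_nat c) = of_nat c" for c by (induction c) (simp_all add: hom_distribs)
  show ?thesis
  proof (induction B arbitrary: M)
    case 0
    show ?case by (simp add: nat wfps_def fps_nth_one_plus_X_power)
  next
    case (Suc B)
    show ?case by (induction M) (simp_all add: wfps_Suc_right Suc hom_distribs)
  qed
qed

text \<open>Powers of the polynomial variable come only from the geometric factor, one for each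
  power of X. Degree M is attained by taking all of X^M there, so the leading coefficient depends
  neither on A nor on q.\<close>

lemma wfps_top_coeff:
  fixes q :: "'a::idom"
  shows "degree (fps_nth (wfps [:q, 1:] A B) M) \<le> M \<and>
    coeff (fps_nth (wfps [:q, 1:] A B) M) M = of_nat ((B + M - 1) choose M)"
proof (induction B arbitrary: M)
  case 0
  have "fps_nth (wfps [:q, 1:] A 0) M = of_nat (A choose M)"
    by (simp add: wfps_def fps_nth_one_plus_X_power)
  \<comment> \<open>With B = 0 the truncated subtraction gives the right values: 1 for M = 0 and 0
    for M > 0.\<close>
  then show ?case by (cases M) (simp_all add: of_nat_poly binomial_eq_0)
next
  case (Suc B)
  show ?case
  proof (induction M)
    case 0
    then show ?case using Suc[of 0] by (simp add: wfps_Suc_right)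
  next
    case (Suc M)
    let ?P = "fps_nth (wfps [:q, 1:] A (Suc B)) M"
    let ?Q = "fps_nth (wfps [:q, 1:] A B) (Suc M)"
    have P: "degree ?P \<le> M" "coeff ?P M = of_nat (B + M choose M)" using Suc by simp_all
    have Q: "degree ?Q \<le> Suc M" "coeff ?Q (Suc M) = of_nat (B + M choose Suc M)"
      using \<open>\<And>M. degree (fps_nth (wfps [:q, 1:] A B) M) \<le> M \<and> _\<close>[of "Suc M"] by simp_all
    have e: "fps_nth (wfps [:q, 1:] A (Suc B)) (Suc M) = ?Q + (smult q ?P + pCons 0 ?P)"
      by (simp add: wfps_Suc_right[of _ _ _ "Suc M"])
    have "degree (smult q ?P) \<le> Suc M" using degree_smult_le[of q ?P] P(1) by simp
    moreover have "degree (pCons 0 ?P) \<le> Suc M" using degree_pCons_le[of 0 ?P] P(1) by simp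
    moreover have "coeff ?P (Suc M) = 0" using P(1) by (simp add: coeff_eq_0)
    ultimately show ?case unfolding e using P(2) Q by (auto intro!: degree_add_le)
  qed
qed

lemma prod_degree_top_coeff:
  fixes f :: "'b \<Rightarrow> 'a::idom poly"
  assumes "finite S" "\<And>i. i \<in> S \<Longrightarrow> degree (f i) \<le> d i"
  shows "degree (\<Prod>i\<in>S. f i) \<le> (\<Sum>i\<in>S. d i) \<and>
    coeff (\<Prod>i\<in>S. f i) (\<Sum>i\<in>S. d i) = (\<Prod>i\<in>S. coeff (f i) (d i))"
  using assms
proof (induction S rule: finite_induct)
  case (insert x S)
  let ?P = "\<Prod>i\<in>S. f i" and ?D = "\<Sum>i\<in>S. d i"
  have IH: "degree ?P \<le> ?D" "coeff ?P ?D = (\<Prod>i\<in>S. coeff (f i) (d i))" using insert by auto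
  have dx: "degree (f x) \<le> d x" using insert by auto
  have "coeff (f x * ?P) (d x + ?D) = (\<Sum>i\<le>d x + ?D. coeff (f x) i * coeff ?P (d x + ?D - i))"
    by (rule coeff_mult)
  also have "\<dots> = (\<Sum>i\<in>{d x}. coeff (f x) i * coeff ?P (d x + ?D - i))"
  proof (rule sum.mono_neutral_right)
    show "\<forall>i\<in>{..d x + ?D} - {d x}. coeff (f x) i * coeff ?P (d x + ?D - i) = 0"
    proof
      fix i assume i: "i \<in> {..d x + ?D} - {d x}"
      then consider "d x < i" | "?D < d x + ?D - i" by fastforce
      then show "coeff (f x) i * coeff ?P (d x + ?D - i) = 0"
      proof cases
        case 1
        then have "coeff (f x) i = 0" using dx by (intro coeff_eq_0) simp
        then show ?thesis by simp
      next
        case 2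
        then have "coeff ?P (d x + ?D - i) = 0" using IH(1) by (intro coeff_eq_0) simp
        then show ?thesis by simp
      qed
    qed
  qed auto
  finally have "coeff (f x * ?P) (d x + ?D) = coeff (f x) (d x) * coeff ?P ?D" by simp
  moreover have "degree (f x * ?P) \<le> d x + ?D"
    using degree_mult_le[of "f x" ?P] dx IH(1) by linarith
  ultimately show ?case using insert IH by simp
qed simp

text \<open>The degree bounds k + i - p(i) sum to n k for every permutation p. Leading coefficients
  may therefore be taken entrywise in the Leibniz formula.\<close>

lemma det_top_coeff:
  fixes F :: "nat \<Rightarrow> nat \<Rightarrow> 'a::idom poly"
  assumes deg: "\<And>i j. i < n \<Longrightarrow> j < n \<Longrightarrow> j \<le> k + i \<Longrightarrow> degree (F i j) \<le> k + i - j"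
    and zero: "\<And>i j. i < n \<Longrightarrow> j < n \<Longrightarrow> k + i < j \<Longrightarrow> F i j = 0"
  shows "degree (det (mat n n (\<lambda>(i, j). F i j))) \<le> n * k"
    and "coeff (det (mat n n (\<lambda>(i, j). F i j))) (n * k) =
      det (mat n n (\<lambda>(i, j). if j \<le> k + i then coeff (F i j) (k + i - j) else 0))"
proof -
  let ?G = "\<lambda>i j. if j \<le> k + i then coeff (F i j) (k + i - j) else 0"
  have leibniz: "degree (\<Prod>i = 0..<n. F i (p i)) \<le> n * k \<and>
      coeff (\<Prod>i = 0..<n. F i (p i)) (n * k) = (\<Prod>i = 0..<n. ?G i (p i))"
    if p: "p permutes {0..<n}" for p
  proof (cases "\<exists>i<n. k + i < p i")
    case True
    then obtain i where i: "i < n" "k + i < p i" by blast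
    then have "p i < n" using permutes_in_image[OF p, of i] by simp
    then have "F i (p i) = 0" using zero i by simp
    then have "(\<Prod>i = 0..<n. F i (p i)) = 0" using i by (auto simp: prod_zero_iff)
    moreover have "(\<Prod>i = 0..<n. ?G i (p i)) = 0"
      using i by (intro prod_zero) (auto intro!: bexI[of _ i])
    ultimately show ?thesis by (simp only: degree_0 coeff_0 le0 simp_thms)
  next
    case False
    then have le: "p i \<le> k + i" if "i < n" for i using that by force
    have pn: "p i < n" if "i < n" for i using permutes_in_image[OF p, of i] that by simp
    have "(\<Sum>i = 0..<n. k + i - p i) + (\<Sum>i = 0..<n. p i) = (\<Sum>i = 0..<n. k + i)"
      unfolding sum.distrib[symmetric] by (rule sum.cong) (use le in auto)
    moreover have "(\<Sum>i = 0..<n. p i) = (\<Sum>i = 0..<n. i)"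
      by (rule sum.reindex_bij_betw) (rule permutes_imp_bij[OF p])
    ultimately have s: "(\<Sum>i = 0..<n. k + i - p i) = n * k" by (simp add: sum.distrib)
    have "degree (\<Prod>i = 0..<n. F i (p i)) \<le> (\<Sum>i = 0..<n. k + i - p i) \<and>
      coeff (\<Prod>i = 0..<n. F i (p i)) (\<Sum>i = 0..<n. k + i - p i) =
      (\<Prod>i = 0..<n. coeff (F i (p i)) (k + i - p i))"
      by (rule prod_degree_top_coeff) (use deg le pn in auto)
    moreover have "(\<Prod>i = 0..<n. coeff (F i (p i)) (k + i - p i)) = (\<Prod>i = 0..<n. ?G i (p i))"
      by (rule prod.cong) (use le in auto)
    ultimately show ?thesis unfolding s by simp
  qed
  have c: "coeff (of_int z * P) d = of_int z * coeff P d" for z d and P :: "'a poly"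
    by (simp add: of_int_poly)
  have sgn: "degree (of_int z * P) \<le> degree P" for z and P :: "'a poly"
    using degree_smult_le[of "of_int z" P] by (simp add: of_int_poly)
  show "degree (det (mat n n (\<lambda>(i, j). F i j))) \<le> n * k"
    unfolding det_mat_leibniz
    by (rule degree_sum_le) (use leibniz sgn in \<open>auto simp: finite_permutations intro: order_trans\<close>)
  show "coeff (det (mat n n (\<lambda>(i, j). F i j))) (n * k) = det (mat n n (\<lambda>(i, j). ?G i j))"
    unfolding det_mat_leibniz coeff_sum c by (rule sum.cong) (use leibniz in auto)
qed

text \<open>The entries are the binomial coefficients of \<mu>_i + k over k + i - j, kept as series
  coefficients so that they vanish for j > k + i and column operations become multiplication by
  powers of 1 + X.\<close>

definition plane_partition_det :: "nat \<Rightarrow> nat \<Rightarrow> (nat \<Rightarrow> nat) \<Rightarrow> int" where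
  "plane_partition_det n k \<mu> =
    det (mat n n (\<lambda>(i, j). fps_nth (fps_X ^ j * (1 + fps_X) ^ (\<mu> i + k)) (k + i)))"

text \<open>The determinant counts plane partitions of shape \<open>\<mu>\<close> with entries at most \<open>k\<close>.  Row by row,
  multilinearity writes the matrix for \<open>k + 1\<close> as a sum of matrices for \<open>k\<close> over all smaller parts; the
  boundary terms vanish because they have two equal rows or a zero row.\<close>

lemma plane_partition_det_pos:
  assumes "\<And>i. Suc i < n \<Longrightarrow> \<mu> (Suc i) \<le> \<mu> i"
  shows "plane_partition_det n k \<mu> > 0"
proof -
  define row :: "nat \<Rightarrow> nat \<Rightarrow> nat \<Rightarrow> nat \<Rightarrow> int" where
    "row = (\<lambda>a c i j. fps_nth (fps_X ^ j * (1 + fps_X) ^ a) (c + i))"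
  \<comment> \<open>An interpolation between k and k + 1: the first q rows already have parameter k
    + 1.\<close>
  define H where "H = (\<lambda>k q \<nu>. det (mat n n (\<lambda>(i, j).
      if i < q then row (\<nu> i + k + 1) (k + 1) i j else row (\<nu> i + k) k i j)))"
  define anti where "anti = (\<lambda>\<nu> :: nat \<Rightarrow> nat. \<forall>i. Suc i < n \<longrightarrow> \<nu> (Suc i) \<le> \<nu> i)"
  have pascal: "row (Suc a) (Suc c) i j = row a (Suc c) i j + row a c i j" for a c i j
  proof -
    have "fps_X ^ j * (1 + fps_X) ^ Suc a =
        fps_X ^ j * (1 + fps_X) ^ a + fps_X * (fps_X ^ j * (1 + fps_X) ^ a :: int fps)"
      by (simp add: algebra_simps)
    then show ?thesis by (simp add: row_def)
  qed
  have step: "H k (Suc q) \<nu> > 0"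
    if q: "q < n" and IH: "\<And>\<nu>. anti \<nu> \<Longrightarrow> H k q \<nu> > 0" and \<nu>: "anti \<nu>" for k q \<nu>
  proof -
    \<comment> \<open>The smallest value that part q may take: the next part, or 0 after the last
      one.\<close>
    define lo where "lo = (\<lambda>\<nu> :: nat \<Rightarrow> nat. if Suc q < n then \<nu> (Suc q) else 0)"
    have base: "H k (Suc q) \<nu> = H k q \<nu>" if e: "\<nu> q = lo \<nu>" for \<nu>
    proof -
      \<comment> \<open>The remainder of Pascal's rule in row q. If part q equals the next part,
        rows q and q + 1 coincide; in the last row, with part 0, every binomial has its lower index
        above its upper one.\<close>
      define Z where "Z = (\<lambda>i j. if i = q then row (\<nu> q + k) (k + 1) q j
        else if i < q then row (\<nu> i + k + 1) (k + 1) i j else row (\<nu> i + k) k i j)"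
      have "1 * H k (Suc q) \<nu> = 1 * H k q \<nu> + 1 * det (mat n n (\<lambda>(i, j). Z i j))"
        unfolding H_def by (rule det_row_linear[OF q]) (auto simp: Z_def pascal)
      moreover have "det (mat n n (\<lambda>(i, j). Z i j)) = 0"
      proof (cases "Suc q < n")
        case True
        show ?thesis
        proof (rule det_identical_rows[of _ n q "Suc q"])
          show "Matrix.row (mat n n (\<lambda>(i, j). Z i j)) q = Matrix.row (mat n n (\<lambda>(i, j). Z i j)) (Suc q)"
            using True e by (intro eq_vecI) (auto simp: Z_def row_def lo_def)
        qed (use True in auto)
      next
        case False
        then have "Z q j = 0" if "j < n" for j
          using that e q by (simp add: Z_def row_def lo_def fps_X_power_mult_nth fps_nth_one_plus_X_power binomial_eq_0)
        then show ?thesis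
          using laplace_expansion_row[of "mat n n (\<lambda>(i, j). Z i j)" n q] q by simp
      qed
      ultimately show ?thesis by simp
    qed
    show ?thesis
      using \<nu>
    proof (induction "\<nu> q - lo \<nu>" arbitrary: \<nu>)
      case 0
      have "lo \<nu> \<le> \<nu> q" using 0(2) by (auto simp: lo_def anti_def)
      then have "\<nu> q = lo \<nu>" using 0(1) by simp
      then show ?case using base IH[OF 0(2)] by simp
    next
      case (Suc t)
      define \<nu>' where "\<nu>' = \<nu>(q := \<nu> q - 1)"
      have "lo \<nu>' = lo \<nu>" by (simp add: lo_def \<nu>'_def)
      then have t: "t = \<nu>' q - lo \<nu>'" using Suc(2) by (simp add: \<nu>'_def)
      have a: "anti \<nu>'"
        unfolding anti_def
      proof (intro allI impI)
        fix i assume i: "Suc i < n"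
        then have "\<nu> (Suc i) \<le> \<nu> i" using Suc(3) by (simp add: anti_def)
        then show "\<nu>' (Suc i) \<le> \<nu>' i"
          using Suc(2) i by (cases "i = q") (auto simp: \<nu>'_def lo_def)
      qed
      have \<nu>q: "\<nu> q = Suc (\<nu> q - 1)" using Suc(2) by simp
      \<comment> \<open>Pascal's rule again: above the lower bound, the remainder is the same
        determinant with part q lowered by one.\<close>
      have "1 * H k (Suc q) \<nu> = 1 * H k q \<nu> + 1 * H k (Suc q) \<nu>'"
        unfolding H_def
      proof (rule det_row_linear[OF q])
        fix j
        show "1 * (if q < Suc q then row (\<nu> q + k + 1) (k + 1) q j else row (\<nu> q + k) k q j) =
          1 * (if q < q then row (\<nu> q + k + 1) (k + 1) q j else row (\<nu> q + k) k q j) +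
          1 * (if q < Suc q then row (\<nu>' q + k + 1) (k + 1) q j else row (\<nu>' q + k) k q j)"
          using pascal[of "\<nu> q + k" k q j] arg_cong[OF \<nu>q, of "\<lambda>t. row (t + k) (Suc k) q j"]
          by (simp add: \<nu>'_def)
      qed (auto simp: \<nu>'_def)
      then show ?case using IH[OF Suc(3)] Suc(1)[OF t a] by simp
    qed
  qed
  have pos: "H k q \<nu> > 0" if "q \<le> n" "anti \<nu>" for k q \<nu>
    using that
  proof (induction k arbitrary: q \<nu>)
    case 0
    then show ?case
    proof (induction q arbitrary: \<nu>)
      case 0
      have "H 0 0 \<nu> = det (mat n n (\<lambda>(i, j). row (\<nu> i) 0 i j))" by (simp add: H_def)
      also have "\<dots> = (\<Prod>i<n. row (\<nu> i) 0 i i)"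
        by (rule det_lower_triangular_mat) (simp add: row_def fps_X_power_mult_nth)
      also have "\<dots> = 1" by (rule prod.neutral) (simp add: row_def fps_X_power_mult_nth fps_nth_one_plus_X_power)
      finally show ?case by simp
    next
      case (Suc q)
      then show ?case using step[of q 0 \<nu>] by simp
    qed
  next
    case (Suc k)
    show ?case
      using Suc.prems
    proof (induction q arbitrary: \<nu>)
      case 0
      have "mat n n (\<lambda>(i, j). if i < n then row (\<nu> i + k + 1) (k + 1) i j else row (\<nu> i + k) k i j) =
          mat n n (\<lambda>(i, j). if i < 0 then row (\<nu> i + Suc k + 1) (Suc k + 1) i j else row (\<nu> i + Suc k) (Suc k) i j)"
        by (intro eq_matI) auto
      \<comment> \<open>Raising all n rows from k is the same as raising none from k + 1.\<close>
      then have "H (Suc k) 0 \<nu> = H k n \<nu>" by (simp only: H_def)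
      then show ?case using Suc.IH[of n \<nu>] 0 by simp
    next
      case (Suc q)
      then show ?case using step[of q "Suc k" \<nu>] by simp
    qed
  qed
  have "plane_partition_det n k \<mu> = H k 0 \<mu>" by (simp add: plane_partition_det_def H_def row_def)
  then show ?thesis using pos[of 0 \<mu> k] assms by (simp add: anti_def)
qed

text \<open>An extra part 0 adds a last row that is a unit vector, which explains the size n + 1.
  The column operations with (1 + X)^j then give the binomials of the claim.\<close>

lemma plane_partition_det_binomial:
  assumes "\<mu> n = 0"
  shows "plane_partition_det n k \<mu> =
    det (mat (n + 1) (n + 1) (\<lambda>(i, j). int ((\<mu> i + j + k) choose (k + i))))"
proof -
  let ?Q = "\<lambda>i. (1 + fps_X) ^ (\<mu> i + k) :: int fps"
  have "det (mat (n + 1) (n + 1) (\<lambda>(i, j). int ((\<mu> i + j + k) choose (k + i)))) =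
      det (mat (Suc n) (Suc n) (\<lambda>(i, j). fps_nth ((1 + fps_X) ^ j * ?Q i) (k + i)))"
    unfolding power_add[symmetric] fps_nth_one_plus_X_power by (simp add: add_ac)
  also have "\<dots> = det (mat (Suc n) (Suc n) (\<lambda>(i, j). fps_nth (fps_X ^ j * ?Q i) (k + i)))"
    by (rule det_binomial_columns)
  also have "\<dots> = det (mat n n (\<lambda>(i, j). fps_nth (fps_X ^ j * ?Q i) (k + i)))"
    by (rule det_unit_last_row)
       (auto simp: assms fps_X_power_mult_nth fps_nth_one_plus_X_power binomial_eq_0)
  finally show ?thesis by (simp add: plane_partition_det_def)
qed

text \<open>The column operations here multiply column j by (1 + X)^{n-1-j}. This exponent makes the
  upper indices those of the leading coefficients, where only \<mu>_i depends on the row and -j on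
  the column.\<close>

lemma plane_partition_det_shifted:
  "det (mat n n (\<lambda>(i, j). if j \<le> k + i
      then int ((\<mu> i + n + k - 1 - j) choose (k + i - j)) else 0)) = plane_partition_det n k \<mu>"
proof -
  let ?Q = "\<lambda>i. (1 + fps_X) ^ (\<mu> i + k) :: int fps"
  have "det (mat n n (\<lambda>(i, j). if j \<le> k + i
      then int ((\<mu> i + n + k - 1 - j) choose (k + i - j)) else 0)) =
    det (mat n n (\<lambda>(i, j). fps_nth ((1 + fps_X) ^ (n - 1 - j) * (fps_X ^ j * ?Q i)) (k + i)))"
  proof (intro arg_cong[of _ _ det] eq_matI)
    fix i j assume "i < dim_row (mat n n (\<lambda>(i, j). fps_nth ((1 + fps_X) ^ (n - 1 - j) * (fps_X ^ j * ?Q i)) (k + i)))"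
      "j < dim_col (mat n n (\<lambda>(i, j). fps_nth ((1 + fps_X) ^ (n - 1 - j) * (fps_X ^ j * ?Q i)) (k + i)))"
    then have ij: "i < n" "j < n" by auto
    have e: "(1 + fps_X) ^ (n - 1 - j) * (fps_X ^ j * ?Q i) = fps_X ^ j * (1 + fps_X) ^ (n - 1 - j + (\<mu> i + k))"
      by (simp add: power_add mult_ac)
    have d: "n - 1 - j + (\<mu> i + k) = \<mu> i + n + k - 1 - j" using ij by simp
    have "fps_nth ((1 + fps_X) ^ (n - 1 - j) * (fps_X ^ j * ?Q i)) (k + i) =
        (if j \<le> k + i then int ((\<mu> i + n + k - 1 - j) choose (k + i - j)) else 0)"
      unfolding e d fps_X_power_mult_nth fps_nth_one_plus_X_power by simp
    then show "mat n n (\<lambda>(i, j). if j \<le> k + i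
        then int ((\<mu> i + n + k - 1 - j) choose (k + i - j)) else 0) $$ (i, j) =
      mat n n (\<lambda>(i, j). fps_nth ((1 + fps_X) ^ (n - 1 - j) * (fps_X ^ j * ?Q i)) (k + i)) $$ (i, j)"
      using ij by simp
  qed auto
  also have "\<dots> = det (mat n n (\<lambda>(i, j). fps_nth (fps_X ^ j * ?Q i) (k + i)))"
  proof (rule det_mult_unitriangular[where T = "\<lambda>l j. if j \<le> l then int ((n - 1 - j) choose (l - j)) else 0"])
    fix i j assume j: "j < n"
    have "fps_nth ((1 + fps_X) ^ (n - 1 - j) * (fps_X ^ j * ?Q i)) (k + i) =
        (\<Sum>l\<le>n - 1 - j. of_nat ((n - 1 - j) choose l) * fps_nth (fps_X ^ l * (fps_X ^ j * ?Q i)) (k + i))"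
      by (rule fps_nth_pow_binomial)
    also have "\<dots> = (\<Sum>l\<in>{j..<n}. of_nat ((n - 1 - j) choose (l - j)) * fps_nth (fps_X ^ l * ?Q i) (k + i))"
      by (rule sum.reindex_bij_witness[of _ "\<lambda>l. l - j" "\<lambda>l. l + j"])
         (use j in \<open>auto simp: power_add mult.assoc\<close>)
    also have "\<dots> = (\<Sum>l<n. fps_nth (fps_X ^ l * ?Q i) (k + i) *
        (if j \<le> l then int ((n - 1 - j) choose (l - j)) else 0))"
      by (rule sum.mono_neutral_cong_left) auto
    finally show "fps_nth ((1 + fps_X) ^ (n - 1 - j) * (fps_X ^ j * ?Q i)) (k + i) =
      (\<Sum>l<n. fps_nth (fps_X ^ l * ?Q i) (k + i) *
        (if j \<le> l then int ((n - 1 - j) choose (l - j)) else 0))" .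
  qed auto
  finally show ?thesis by (simp add: plane_partition_det_def)
qed

section \<open>The case k = 1\<close>

lemma geo_fps_power_nth:
  "fps_nth (geo_fps (- 1) ^ Suc a :: 'a::comm_ring_1 fps) m = (- 1) ^ m * of_nat ((a + m) choose m)"
proof -
  have "fps_nth (wfps (- 1 :: 'a) 0 (Suc a)) m = (- 1) ^ m * of_nat ((a + m) choose m)"
  proof (induction a arbitrary: m)
    case 0
    show ?case by (simp add: wfps_def geo_fps_def)
  next
    case (Suc a)
    show ?case
    proof (induction m)
      case 0
      then show ?case using Suc[of 0] wfps_Suc_right[of "- 1 :: 'a" 0 "Suc a" 0] by simp
    next
      case (Suc m)
      have "fps_nth (wfps (- 1 :: 'a) 0 (Suc (Suc a))) (Suc m) =
          (- 1) ^ Suc m * of_nat ((a + Suc m) choose Suc m) - (- 1) ^ m * of_nat ((Suc a + m) choose m)"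
        unfolding wfps_Suc_right[of "- 1 :: 'a" 0 "Suc a" "Suc m"]
        using Suc \<open>\<And>m. fps_nth (wfps (- 1 :: 'a) 0 (Suc a)) m = _\<close>[of "Suc m"] by simp
      then show ?case by (simp add: algebra_simps)
    qed
  qed
  then show ?thesis by (simp add: wfps_def)
qed

text \<open>Adding multiples of the other columns, with coefficients \<open>f\<close>, clears the first column of the
  bordered matrix except for its last entry.\<close>

lemma det_hessenberg:
  fixes F :: "nat \<Rightarrow> nat \<Rightarrow> 'a::idom"
  assumes F: "\<And>i. i < n \<Longrightarrow> F i (Suc i) = 1" "\<And>i j. i < n \<Longrightarrow> Suc i < j \<Longrightarrow> F i j = 0"
    "\<And>j. j < n \<Longrightarrow> F n j = 0" "F n n = 1"
    and f: "f 0 = 1" "\<And>i. i < n \<Longrightarrow> (\<Sum>l<Suc n. F i l * f l) = 0"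
  shows "det (mat n n (\<lambda>(i, j). F i j)) = (- 1) ^ n * f n"
proof -
  define T where "T = (\<lambda>l j. if j = 0 then f l else if l = j then 1 else 0 :: 'a)"
  define G where "G = (\<lambda>i j. \<Sum>l<Suc n. F i l * T l j)"
  have G0: "G i 0 = 0" if "i < n" for i using f(2)[OF that] by (simp add: G_def T_def)
  have Gn: "G n 0 = f n" using F(3,4) by (simp add: G_def T_def)
  have GS: "G i j = F i j" if "0 < j" "j < Suc n" for i j
  proof -
    have "G i j = (\<Sum>l<Suc n. if l = j then F i j else 0)"
      unfolding G_def T_def using that by (intro sum.cong) auto
    then show ?thesis using that by simp
  qed
  let ?G = "mat (Suc n) (Suc n) (\<lambda>(i, j). G i j)"
  have "det (mat n n (\<lambda>(i, j). F i j)) = det (mat (Suc n) (Suc n) (\<lambda>(i, j). F i j))"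
    by (rule det_unit_last_row[symmetric]) (use F in auto)
  also have "\<dots> = det ?G"
    by (rule det_mult_unitriangular[where T = T, symmetric]) (auto simp: G_def T_def f(1))
  also have "\<dots> = (\<Sum>i<Suc n. ?G $$ (i, 0) * cofactor ?G i 0)"
    by (rule laplace_expansion_column) auto
  also have "\<dots> = f n * cofactor ?G n 0" using G0 Gn by simp
  \<comment> \<open>Without the first column and the last row, the unit superdiagonal of F becomes
    the diagonal of a lower triangular matrix.\<close>
  also have "mat_delete ?G n 0 = mat n n (\<lambda>(i, j). F i (Suc j))"
    unfolding mat_delete_def by (intro eq_matI) (auto simp: GS)
  then have "cofactor ?G n 0 = (- 1) ^ n * det (mat n n (\<lambda>(i, j). F i (Suc j)))"
    by (simp add: cofactor_def)
  also have "det (mat n n (\<lambda>(i, j). F i (Suc j))) = (\<Prod>i<n. F i (Suc i))"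
    by (rule det_lower_triangular_mat) (use F in auto)
  also have "\<dots> = 1" using F by simp
  finally show ?thesis by simp
qed

text \<open>With \<open>u = ((1 + s) / (1 - b s))\<^sup>p\<close> and \<open>v = 1 / u\<close>, the annihilated series is
  \<open>(v\<^sup>n\<^sup>+\<^sup>1 - s v' v\<^sup>n) / (1 + s)\<close>; this is the solution provided by Lagrange inversion.\<close>

lemma det_narayana:
  fixes b :: real
  shows "det (mat n n (\<lambda>(i, j). fps_nth (fps_X ^ j * wfps b ((n - i) * p + 1) ((n - i) * p)) (1 + i))) =
    (\<Sum>r\<le>n. of_nat ((n + 1) choose (r + 1)) * of_nat (((n + 1) * p) choose r) * (1 + b) ^ r) / of_nat (n + 1)"
proof -
  define g where "g = geo_fps b"
  define h where "h = geo_fps (- 1 :: real)"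
  have g: "(1 - fps_const b * fps_X) * g = 1" unfolding g_def by (rule geo_fps_inverse)
  have h: "(1 + fps_X) * h = 1" using geo_fps_inverse[of "- 1 :: real"] 
    by (simp add: h_def fps_const_neg[symmetric] del: fps_const_neg)
  define u where "u = ((1 + fps_X) * g) ^ p"
  define v where "v = ((1 - fps_const b * fps_X) * h) ^ p"
  have uv: "u * v = 1"
  proof -
    have "u * v = (((1 + fps_X) * h) * ((1 - fps_const b * fps_X) * g)) ^ p"
      unfolding u_def v_def power_mult_distrib[symmetric] by (simp only: mult_ac)
    then show ?thesis unfolding g h by simp
  qed
  have W: "wfps b (a * p + 1) (a * p) = (1 + fps_X) * u ^ a" for a
    by (simp add: wfps_def u_def g_def power_mult_distrib power_mult[symmetric] mult_ac)
  define f where "f = (v ^ Suc n - fps_X * fps_deriv v * v ^ n) * h"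
  have v0: "fps_nth v 0 = 1" and h0: "fps_nth h 0 = 1"
    by (simp_all add: v_def h_def geo_fps_def fps_nth_power_0)
  have f0: "fps_nth f 0 = 1" by (simp add: f_def v0 h0 fps_nth_power_0 mult.assoc)
  have Wf: "wfps b (a * p + 1) (a * p) * f = u ^ a * (v ^ Suc n - fps_X * fps_deriv v * v ^ n)" for a
  proof -
    have "wfps b (a * p + 1) (a * p) * f =
        ((1 + fps_X) * h) * (u ^ a * (v ^ Suc n - fps_X * fps_deriv v * v ^ n))"
      unfolding W f_def by (simp only: mult_ac)
    then show ?thesis unfolding h by simp
  qed
  \<comment> \<open>Since u v = 1, the series reduces to v^{i+1} - s v' v^i. Its coefficient at
    s^{i+1} is 0, because (v^{i+1})' = (i + 1) v' v^i.\<close>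
  have vanish: "fps_nth (wfps b ((n - i) * p + 1) ((n - i) * p) * f) (Suc i) = 0" if "i < n" for i
  proof -
    have n: "n = (n - i) + i" using that by simp
    have uvi: "u ^ (n - i) * v ^ (n - i) = 1" unfolding power_mult_distrib[symmetric] uv by simp
    have "v ^ Suc n = v ^ (n - i) * v ^ Suc i" "v ^ n = v ^ (n - i) * v ^ i"
      using that by (simp_all flip: power_add)
    then have "u ^ (n - i) * (v ^ Suc n - fps_X * fps_deriv v * v ^ n) =
        (u ^ (n - i) * v ^ (n - i)) * (v ^ Suc i - fps_X * (fps_deriv v * v ^ i))"
      by (simp only: right_diff_distrib mult_ac)
    then have e: "wfps b ((n - i) * p + 1) ((n - i) * p) * f = v ^ Suc i - fps_X * (fps_deriv v * v ^ i)"
      unfolding Wf uvi by simp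
    have "fps_deriv (v ^ Suc i) = fps_const (of_nat (Suc i)) * (fps_deriv v * v ^ i)"
      unfolding fps_deriv_power by (simp add: mult_ac fps_of_nat del: power_Suc of_nat_Suc)
    then have "of_nat (Suc i) * fps_nth (v ^ Suc i) (Suc i) = of_nat (Suc i) * fps_nth (fps_deriv v * v ^ i) i"
      using fps_deriv_nth[of "v ^ Suc i" i] by (simp add: fps_mult_left_const_nth)
    then show ?thesis unfolding e by simp
  qed
  let ?F = "\<lambda>i j. fps_nth (fps_X ^ j * wfps b ((n - i) * p + 1) ((n - i) * p)) (1 + i)"
  have w0: "fps_nth (wfps b A B) 0 = 1" for A B
    by (simp add: wfps_def geo_fps_def fps_nth_power_0)
  have "det (mat n n (\<lambda>(i, j). ?F i j)) = (- 1) ^ n * fps_nth f n"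
  proof (rule det_hessenberg)
    fix i assume i: "i < n"
    show "?F i (Suc i) = 1" by (simp add: fps_X_power_mult_nth w0 del: power_Suc)
    show "?F i j = 0" if "Suc i < j" for j using that by (simp add: fps_X_power_mult_nth)
    have "(\<Sum>l<Suc n. ?F i l * fps_nth f l) = (\<Sum>l\<le>Suc i. ?F i l * fps_nth f l)"
      by (rule sum.mono_neutral_right) (use i in \<open>auto simp: fps_X_power_mult_nth\<close>)
    also have "\<dots> = (\<Sum>l=0..Suc i. fps_nth f l * fps_nth (wfps b ((n - i) * p + 1) ((n - i) * p)) (Suc i - l))"
      unfolding atMost_atLeast0 by (rule sum.cong) (auto simp: fps_X_power_mult_nth)
    also have "\<dots> = fps_nth (f * wfps b ((n - i) * p + 1) ((n - i) * p)) (Suc i)"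
      by (simp only: fps_mult_nth)
    finally show "(\<Sum>l<Suc n. ?F i l * fps_nth f l) = 0" using vanish[OF i] by (simp add: mult.commute)
  next
    fix j assume j: "j < n"
    have "fps_nth (1 + fps_X :: real fps) (Suc n - j) = 0"
      using j fps_nth_one_plus_X_power[of 1 "Suc n - j", where 'a = real] by (simp add: binomial_eq_0)
    then show "?F n j = 0" using j by (simp add: fps_X_power_mult_nth wfps_def)
  next
    have "wfps b 1 0 = 1 + fps_X" by (simp add: wfps_def)
    then show "?F n n = 1" by (simp add: fps_X_power_mult_nth)
  qed (rule f0)
  \<comment> \<open>With Y = v^{n+1} the derivative is moved from Y to h Y. At s^n the series s (h
    Y)' has n times the coefficient of h Y, and the remaining h Y - s h^2 Y is h^2 Y because (1 + s)
    h = 1.\<close>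
  moreover have "of_nat (n + 1) * fps_nth f n = fps_nth (h ^ 2 * v ^ Suc n) n"
  proof -
    have h': "fps_deriv h = - (h ^ 2)"
    proof -
      have "fps_deriv ((1 + fps_X) * h) = 0" unfolding h by simp
      then have "h + (1 + fps_X) * fps_deriv h = 0" by (simp add: algebra_simps)
      then have "h * (h + (1 + fps_X) * fps_deriv h) = 0" by simp
      then have "h ^ 2 + ((1 + fps_X) * h) * fps_deriv h = 0"
        by (simp only: distrib_left power2_eq_square mult_ac)
      then show ?thesis unfolding h by (simp add: eq_neg_iff_add_eq_0 add.commute)
    qed
    define Y where "Y = v ^ Suc n"
    have Y': "fps_deriv Y = fps_const (of_nat (Suc n)) * (fps_deriv v * v ^ n)"
      unfolding Y_def fps_deriv_power by (simp add: mult_ac fps_of_nat del: power_Suc of_nat_Suc)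
    have "fps_const (of_nat (Suc n)) * f = fps_const (of_nat (Suc n)) * (h * Y) - fps_X * h * fps_deriv Y"
      unfolding f_def Y' Y_def[symmetric] by (simp only: right_diff_distrib left_diff_distrib mult_ac)
    also have "fps_X * h * fps_deriv Y = fps_X * fps_deriv (h * Y) + fps_X * (h ^ 2 * Y)"
      by (simp add: h' algebra_simps)
    finally have f: "fps_const (of_nat (Suc n)) * f =
        fps_const (of_nat (Suc n)) * (h * Y) - (fps_X * fps_deriv (h * Y) + fps_X * (h ^ 2 * Y))" .
    define H K E where "H = fps_nth (h * Y) n" and "K = fps_nth (h ^ 2 * Y) n"
      and "E = fps_nth (fps_X * (h ^ 2 * Y)) n"
    have D: "fps_nth (fps_X * fps_deriv (h * Y)) n = of_nat n * H"
      unfolding H_def by (cases n) (simp_all del: fps_deriv_mult)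
    have "h ^ 2 * Y + fps_X * (h ^ 2 * Y) = ((1 + fps_X) * h) * (h * Y)"
      by (simp add: algebra_simps power2_eq_square)
    then have "h * Y = h ^ 2 * Y + fps_X * (h ^ 2 * Y)" unfolding h by simp
    from arg_cong[OF this, of "\<lambda>F. fps_nth F n"] have HKE: "H = K + E"
      unfolding H_def K_def E_def by (simp only: fps_add_nth)
    have "of_nat (Suc n) * fps_nth f n = of_nat (Suc n) * H - (of_nat n * H + E)"
      using arg_cong[OF f, of "\<lambda>F. fps_nth F n"]
      unfolding fps_sub_nth fps_add_nth fps_mult_left_const_nth D H_def[symmetric] E_def[symmetric] .
    then show ?thesis
      unfolding Y_def[symmetric] K_def[symmetric] HKE by (simp add: algebra_simps)
  qed
  moreover have "fps_nth (h ^ 2 * v ^ Suc n) n = (- 1) ^ n *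
    (\<Sum>r\<le>n. of_nat ((n + 1) choose (r + 1)) * of_nat (((n + 1) * p) choose r) * (1 + b) ^ r)"
  proof -
    let ?P = "(n + 1) * p"
    \<comment> \<open>(1 - b s) / (1 + s) = 1 - (1 + b) s / (1 + s): this is where powers of \<beta>
      = 1 + b enter, by the binomial theorem.\<close>
    have c: "(1 - fps_const b * fps_X) * h = fps_const (- (1 + b)) * (fps_X * h) + 1"
    proof -
      have "(1 - fps_const b * fps_X) * h = (1 + fps_X) * h - (1 + fps_const b) * (fps_X * h)"
        by (simp add: algebra_simps)
      then have e: "(1 - fps_const b * fps_X) * h = 1 - (1 + fps_const b) * (fps_X * h)"
        unfolding h .
      have e': "fps_const (- (1 + b)) = - (1 + fps_const b)"
        by (simp only: fps_const_neg[symmetric] fps_const_add[symmetric] fps_const_1_eq_1)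
      show ?thesis unfolding e e' by (simp only: mult_minus_left uminus_add_conv_diff)
    qed
    have "v ^ Suc n = ((1 - fps_const b * fps_X) * h) ^ ?P"
      by (simp add: v_def power_mult[symmetric] mult.commute del: power_Suc)
    also have "\<dots> = (\<Sum>r\<le>?P. of_nat (?P choose r) * (fps_const (- (1 + b)) * (fps_X * h)) ^ r)"
      unfolding c by (simp add: binomial_ring)
    finally have "h ^ 2 * v ^ Suc n =
        (\<Sum>r\<le>?P. fps_const (of_nat (?P choose r) * (- (1 + b)) ^ r) * (fps_X ^ r * h ^ Suc (Suc r)))"
      by (simp add: sum_distrib_left power_mult_distrib fps_const_power[symmetric] fps_of_nat[symmetric]
          fps_const_mult[symmetric] power2_eq_square mult_ac del: fps_const_mult fps_const_power)
    then have "fps_nth (h ^ 2 * v ^ Suc n) n =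
        (\<Sum>r\<le>?P. of_nat (?P choose r) * (- (1 + b)) ^ r * fps_nth (fps_X ^ r * h ^ Suc (Suc r)) n)"
      by (simp only: fps_sum_nth fps_mult_left_const_nth)
    \<comment> \<open>The ranges are exchanged through their maximum: beyond the exponent the
      binomial is 0, and beyond n the factor X^r pushes the coefficient out.\<close>
    also have "\<dots> = (\<Sum>r\<le>max n ?P. of_nat (?P choose r) * (- (1 + b)) ^ r * fps_nth (fps_X ^ r * h ^ Suc (Suc r)) n)"
      by (rule sum.mono_neutral_left) (auto simp: binomial_eq_0)
    also have "\<dots> = (\<Sum>r\<le>n. of_nat (?P choose r) * (- (1 + b)) ^ r * fps_nth (fps_X ^ r * h ^ Suc (Suc r)) n)"
      by (rule sum.mono_neutral_right) (auto simp: fps_X_power_mult_nth simp del: power_Suc)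
    also have "\<dots> = (\<Sum>r\<le>n. (- 1) ^ n * (of_nat ((n + 1) choose (r + 1)) * of_nat (?P choose r) * (1 + b) ^ r))"
    proof (rule sum.cong)
      fix r assume "r \<in> {..n}"
      then have r: "r \<le> n" by simp
      have h_nth: "fps_nth (fps_X ^ r * h ^ Suc (Suc r)) n = (- 1) ^ (n - r) * of_nat ((n + 1) choose (n - r))"
        using r geo_fps_power_nth[of "Suc r" "n - r", where 'a = real]
        by (simp add: fps_X_power_mult_nth h_def del: power_Suc)
      have choose: "(n + 1) choose (n - r) = (n + 1) choose (r + 1)"
        using r binomial_symmetric[of "r + 1" "n + 1"] by simp
      have "(- (1 + b)) ^ r = (- 1) ^ r * (1 + b) ^ r" by (rule power_minus)
      moreover have "(- 1 :: real) ^ r * (- 1) ^ (n - r) = (- 1) ^ n" using r by (simp flip: power_add)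
      ultimately have sign: "(- (1 + b)) ^ r * (- 1) ^ (n - r) = (- 1) ^ n * (1 + b) ^ r"
        by (simp add: mult_ac)
      have "of_nat (?P choose r) * (- (1 + b)) ^ r * fps_nth (fps_X ^ r * h ^ Suc (Suc r)) n =
          of_nat (?P choose r) * of_nat ((n + 1) choose (r + 1)) * ((- (1 + b)) ^ r * (- 1) ^ (n - r))"
        unfolding h_nth choose by (simp only: mult_ac)
      also have "\<dots> = (- 1) ^ n * (of_nat ((n + 1) choose (r + 1)) * of_nat (?P choose r) * (1 + b) ^ r)"
        unfolding sign by (simp only: mult_ac)
      finally show "of_nat (?P choose r) * (- (1 + b)) ^ r * fps_nth (fps_X ^ r * h ^ Suc (Suc r)) n =
        (- 1) ^ n * (of_nat ((n + 1) choose (r + 1)) * of_nat (?P choose r) * (1 + b) ^ r)" .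
    qed simp
    finally show ?thesis by (simp add: sum_distrib_left)
  qed
  ultimately have "of_nat (n + 1) * det (mat n n (\<lambda>(i, j). ?F i j)) = ((- 1) ^ n * (- 1) ^ n) *
    (\<Sum>r\<le>n. of_nat ((n + 1) choose (r + 1)) * of_nat (((n + 1) * p) choose r) * (1 + b) ^ r)"
    by (simp only: mult.assoc mult.left_commute[of "of_nat (n + 1)"])
  also have "(- 1) ^ n * (- 1) ^ n = (1 :: real)" by (simp flip: power_mult_distrib)
  finally show ?thesis by (simp add: field_simps)
qed

section \<open>From real values back to polynomials\<close>

lemma real_poly_eqI:
  fixes P Q :: "real poly"
  assumes "\<And>r. r > 1 \<Longrightarrow> poly P r = poly Q r"
  shows "P = Q"
proof (rule ccontr)
  assume "P \<noteq> Q"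
  then have "finite {r. poly (P - Q) r = 0}" by (intro poly_roots_finite) simp
  moreover have "{1<..} \<subseteq> {r. poly (P - Q) r = 0}" using assms by auto
  ultimately have "finite {1::real<..}" by (rule rev_finite_subset)
  then show False using infinite_Ioi by blast
qed

lemma map_poly_inj:
  assumes "inj h" "h 0 = 0" "map_poly h P = map_poly h Q"
  shows "P = Q"
proof (rule poly_eqI)
  fix i
  have "h (coeff P i) = h (coeff Q i)"
    using arg_cong[OF assms(3), of "\<lambda>R. coeff R i"] by (simp add: coeff_map_poly assms(2))
  then show "coeff P i = coeff Q i" using assms(1) by (auto dest: injD)
qed

lemma map_poly_of_rat_sum:
  "map_poly real_of_rat (\<Sum>j\<in>A. monom (c j) (d j)) = (\<Sum>j\<in>A. monom (real_of_rat (c j)) (d j))"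
  by (rule poly_eqI) (auto simp: coeff_map_poly coeff_sum of_rat_sum intro!: sum.cong)

lemma poly_spec_varpi:
  fixes r :: real
  assumes "p \<ge> 1" "varpi n k p permutes {1..m}" "r > 1"
  shows "poly (map_poly of_int (grothendieck_spec m (varpi n k p))) r =
    det (mat n n (\<lambda>(i, j). fps_nth (fps_X ^ j * wfps (r - 1) ((n - i) * p + k) ((n - i) * p)) (k + i)))"
  unfolding poly_grothendieck_spec[OF assms(2)]
proof (rule groth_at_one[OF _ _ assms(2)])
  fix i assume "Suc i < n"
  then show "(n - Suc i) * p \<le> (n - i) * p" by (intro mult_le_mono1) simp
next
  fix i assume "i < n"
  then show "code (varpi n k p) (k + Suc i) = (n - i) * p"
    using varpi_code(2)[OF assms(1), of n k "k + Suc i"] by simp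
next
  fix j assume "j \<notin> {k + 1..k + n}"
  then show "code (varpi n k p) j = 0"
    using varpi_code(2)[OF assms(1), of n k j] by auto
qed (use assms in simp)

text \<open>Evaluation at a real r > 1 is a ring homomorphism and so commutes with the determinant
  and the series coefficients; there the real formula applies with b = r - 1.\<close>

lemma spec_varpi_det:
  assumes "p \<ge> 1" "varpi n k p permutes {1..m}"
  shows "grothendieck_spec m (varpi n k p) =
    det (mat n n (\<lambda>(i, j). fps_nth (fps_X ^ j * wfps [:- 1, 1:] ((n - i) * p + k) ((n - i) * p)) (k + i)))"
proof (rule map_poly_inj[of "of_int :: int \<Rightarrow> real"])
  let ?F = "\<lambda>q i j. fps_nth (fps_X ^ j * wfps q ((n - i) * p + k) ((n - i) * p)) (k + i)"
  show "map_poly real_of_int (grothendieck_spec m (varpi n k p)) =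
      map_poly real_of_int (det (mat n n (\<lambda>(i, j). ?F [:- 1, 1:] i j)))"
  proof (rule real_poly_eqI)
    fix r :: real assume r: "r > 1"
    define h where "h = (\<lambda>P. poly (map_poly real_of_int P) r)"
    have hom: "comm_ring_hom h" unfolding h_def by (rule eval_int_poly_hom)
    interpret comm_ring_hom h by (rule hom)
    have "h [:- 1, 1:] = r - 1" by (simp add: h_def map_poly_pCons)
    then have "h (?F [:- 1, 1:] i j) = ?F (r - 1) i j" for i j
      using wfps_hom[OF hom] by (simp add: fps_X_power_mult_nth)
    then have "map_mat h (mat n n (\<lambda>(i, j). ?F [:- 1, 1:] i j)) = mat n n (\<lambda>(i, j). ?F (r - 1) i j)"
      by (intro eq_matI) auto
    then have "h (det (mat n n (\<lambda>(i, j). ?F [:- 1, 1:] i j))) = det (mat n n (\<lambda>(i, j). ?F (r - 1) i j))"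
      unfolding hom_det[symmetric] by (rule arg_cong)
    then show "poly (map_poly real_of_int (grothendieck_spec m (varpi n k p))) r =
      poly (map_poly real_of_int (det (mat n n (\<lambda>(i, j). ?F [:- 1, 1:] i j)))) r"
      using poly_spec_varpi[OF assms r] by (simp add: h_def)
  qed
qed (simp_all add: inj_def)

theorem theorem5p10:
  fixes n k p :: nat
  assumes "n \<ge> 1" and "k \<ge> 1" and "p \<ge> 1"
  shows
    "(\<forall>m. varpi n 1 p permutes {1..m} \<longrightarrow>
       map_poly rat_of_int (grothendieck_spec m (varpi n 1 p)) =
       (\<Sum>j = 1..n + 1. monom (1 / of_nat (n + 1) * of_nat ((n + 1) choose j) *
          of_nat (((n + 1) * p) choose (j - 1))) (j - 1))) \<and>
     (k \<ge> 2 \<longrightarrow> (\<forall>m. varpi n k p permutes {1..m} \<longrightarrow>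
       Polynomial.degree (grothendieck_spec m (varpi n k p)) = n * k \<and>
       poly.coeff (grothendieck_spec m (varpi n k p)) (n * k) =
       det (mat (n + 1) (n + 1) (\<lambda>(i', j'). let i = i' + 1; j = j' + 1 in
         int (((n + 1 - i) * (p - 1) + j + k - 1) choose (k + i - 1))))))"
proof (intro conjI impI allI)
  fix m assume m: "varpi n 1 p permutes {1..m}"
  let ?S = "grothendieck_spec m (varpi n 1 p)"
  let ?c = "\<lambda>j. 1 / of_nat (n + 1) * of_nat ((n + 1) choose j) * of_nat (((n + 1) * p) choose (j - 1)) :: rat"
  let ?R = "\<Sum>j = 1..n + 1. monom (?c j) (j - 1)"
  show "map_poly rat_of_int ?S = ?R"
  \<comment> \<open>The rational identity is checked over the reals, where the determinant has been
    evaluated.\<close>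
  proof (rule map_poly_inj[of "of_rat :: rat \<Rightarrow> real"])
    have S: "map_poly real_of_rat (map_poly rat_of_int ?S) = map_poly real_of_int ?S"
      by (rule poly_eqI) (simp add: coeff_map_poly)
    show "map_poly real_of_rat (map_poly rat_of_int ?S) = map_poly real_of_rat ?R"
      unfolding S
    proof (rule real_poly_eqI)
      fix r :: real assume r: "r > 1"
      have "map_poly real_of_rat ?R = (\<Sum>j = 1..n + 1. monom (real_of_rat (?c j)) (j - 1))"
        by (rule map_poly_of_rat_sum)
      then have "poly (map_poly real_of_rat ?R) r = (\<Sum>j = 1..n + 1. real_of_rat (?c j) * r ^ (j - 1))"
        by (simp add: poly_sum poly_monom)
      also have "\<dots> = (\<Sum>i\<le>n. real_of_rat (?c (i + 1)) * r ^ i)"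
        by (rule sum.reindex_bij_witness[of _ "\<lambda>i. i + 1" "\<lambda>j. j - 1"]) auto
      also have "\<dots> = (\<Sum>i\<le>n. of_nat ((n + 1) choose (i + 1)) * of_nat (((n + 1) * p) choose i) * r ^ i) / of_nat (n + 1)"
        unfolding sum_divide_distrib
        by (rule sum.cong) (simp_all add: of_rat_mult of_rat_divide del: of_nat_Suc binomial_Suc_Suc)
      also have "\<dots> = poly (map_poly real_of_int ?S) r"
        using det_narayana[of n "r - 1" p] poly_spec_varpi[OF assms(3) m r] by simp
      finally show "poly (map_poly real_of_int ?S) r = poly (map_poly real_of_rat ?R) r" by simp
    qed
  qed (auto simp: inj_def)
next
  fix m assume k: "2 \<le> k" and m: "varpi n k p permutes {1..m}"
  \<comment> \<open>The shape left once the staircase n - i is removed from the parts (n - i)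
    p.\<close>
  define \<mu> where "\<mu> = (\<lambda>i. (n - i) * (p - 1))"
  define F :: "nat \<Rightarrow> nat \<Rightarrow> int poly" where
    "F = (\<lambda>i j. fps_nth (fps_X ^ j * wfps [:- 1, 1:] ((n - i) * p + k) ((n - i) * p)) (k + i))"
  have spec: "grothendieck_spec m (varpi n k p) = det (mat n n (\<lambda>(i, j). F i j))"
    unfolding F_def by (rule spec_varpi_det[OF assms(3) m])
  have deg: "degree (F i j) \<le> k + i - j" and top: "coeff (F i j) (k + i - j) =
      of_nat (((n - i) * p + (k + i - j) - 1) choose (k + i - j))" if "j \<le> k + i" for i j
    using wfps_top_coeff[of "- 1 :: int" "(n - i) * p + k" "(n - i) * p" "k + i - j"] that
    by (simp_all add: F_def fps_X_power_mult_nth)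
  have zero: "F i j = 0" if "k + i < j" for i j using that by (simp add: F_def fps_X_power_mult_nth)
  \<comment> \<open>Here (n - i) p = \<mu>_i + (n - i), so the i in the lower index cancels and the
    upper index depends on the row only through \<mu>_i.\<close>
  have ex: "(n - i) * p + (k + i) - Suc j = \<mu> i + n + k - Suc j" if "i < n" "j \<le> k + i" for i j
  proof -
    obtain p' where p: "p = Suc p'" using assms(3) by (cases p) auto
    have "(n - i) * p = \<mu> i + (n - i)" by (simp add: \<mu>_def p)
    then show ?thesis using that by simp
  qed
  have "det (mat n n (\<lambda>(i, j). if j \<le> k + i then coeff (F i j) (k + i - j) else 0)) =
      det (mat n n (\<lambda>(i, j). if j \<le> k + i then int ((\<mu> i + n + k - 1 - j) choose (k + i - j)) else 0))"
    by (intro arg_cong[of _ _ det] eq_matI) (auto simp: top ex)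
  also have "\<dots> = plane_partition_det n k \<mu>" by (rule plane_partition_det_shifted)
  finally have coeff: "coeff (grothendieck_spec m (varpi n k p)) (n * k) = plane_partition_det n k \<mu>"
    unfolding spec using det_top_coeff(2)[of n k F] deg zero by simp
  have "plane_partition_det n k \<mu> > 0"
    by (rule plane_partition_det_pos) (unfold \<mu>_def, intro mult_le_mono1, simp)
  moreover have "degree (grothendieck_spec m (varpi n k p)) \<le> n * k"
    unfolding spec by (rule det_top_coeff(1)) (use deg zero in auto)
  \<comment> \<open>Positivity makes the coefficient at n k nonzero, which turns the degree bound
    into an equality.\<close>
  ultimately show "Polynomial.degree (grothendieck_spec m (varpi n k p)) = n * k"
    using coeff le_degree[of "grothendieck_spec m (varpi n k p)" "n * k"] by simp
  have "plane_partition_det n k \<mu> = det (mat (n + 1) (n + 1) (\<lambda>(i, j). int ((\<mu> i + j + k) choose (k + i))))"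
    by (rule plane_partition_det_binomial) (simp add: \<mu>_def)
  also have "\<dots> = det (mat (n + 1) (n + 1) (\<lambda>(i', j'). let i = i' + 1; j = j' + 1 in
         int (((n + 1 - i) * (p - 1) + j + k - 1) choose (k + i - 1))))"
    by (simp add: \<mu>_def Let_def)
  finally show "poly.coeff (grothendieck_spec m (varpi n k p)) (n * k) =
       det (mat (n + 1) (n + 1) (\<lambda>(i', j'). let i = i' + 1; j = j' + 1 in
         int (((n + 1 - i) * (p - 1) + j + k - 1) choose (k + i - 1))))"
    using coeff by simp
qed

end
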